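(* Let $\mathfrak m\ne A$ be a nonzero ideal of $A$. For any prime ideal $\mathfrak p=(P)$ of $A$ ($P$ monic irreducible) with $\mathfrak p\nmid\mathfrak m$, $$S_{2,1}^{\mathfrak p-\mathrm{old}}(\Gamma_0(\mathfrak p\mathfrak m))\cap S_{2,1}^{\mathfrak p-\mathrm{new}}(\Gamma_0(\mathfrak p\mathfrak m))\ne\{0\}.$$
   Context: Let $q$ be a power of an odd prime, $A=\mathbb{F}_q[T]$, $K_\infty=\mathbb{F}_q((1/T))$, $C$ the completion of an algebraic closure of $K_\infty$, and $\Omega=C\setminus K_\infty$ the Drinfeld upper half-plane with its rigid analytic structure. For $\gamma=\begin{pmatrix} a & b \\ c & d \end{pmatrix}\in\mathrm{GL}_2(K_\infty)$ and $f:\Omega\to C$ rigid holomorphic put $(f|_{k,l}\gamma)(z)=(\det\gamma)^l(cz+d)^{-k}f(\gamma z)$. For a nonzero ideal $\mathfrak n=(n)$ of $A$ ($n$ monic), $\Gamma_0(\mathfrak n)=\{\begin{pmatrix} a & b \\ c & d \end{pmatrix}\in\mathrm{GL}_2(A): c\in\mathfrak n\}$. Let $\tilde\pi$ be the Carlitz period (so $L=\tilde\pi A$ is the lattice of the Carlitz module $\rho_T=TX+X^q$), $e_L(z)=z\prod_{0\ne\lambda\in L}(1-z/\lambda)$, $u(z)=1/e_L(\tilde\pi z)$. $S_{k,l}(\Gamma_0(\mathfrak n))$ is the $C$-space of Drinfeld cusp forms of weight $k$, type $l$: rigid holomorphic $f:\Omega\to C$ with $f|_{k,l}\gamma=f$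 for all $\gamma\in\Gamma_0(\mathfrak n)$ which are holomorphic and vanish at the cusps, i.e. for every $\gamma\in\mathrm{GL}_2(A)$ the expansion of $f|_{k,l}\gamma$ in powers of $u(z/n)$ (for $\inf_{x\in K_\infty}|z-x|$ large) has only positive powers. Let $m$ be the monic generator of $\mathfrak m$. $S^{\mathfrak p-\mathrm{old}}_{k,l}(\Gamma_0(\mathfrak p\mathfrak m))=\{f+g|_{k,l}\begin{pmatrix} P & 0 \\ 0 & 1 \end{pmatrix}: f,g\in S_{k,l}(\Gamma_0(\mathfrak m))\}$. The trace is $\mathrm{Tr}^{\mathfrak p\mathfrak m}_{\mathfrak m}(f)=\sum_{\gamma\in\Gamma_0(\mathfrak p\mathfrak m)\backslash\Gamma_0(\mathfrak m)}f|_{k,l}\gamma$; the (partial) Atkin–Lehner operator $W_{\mathfrak p}^{(\mathfrak p\mathfrak m)}$ on $S_{k,l}(\Gamma_0(\mathfrak p\mathfrak m))$ is $f\mapsto f|_{k,l}\begin{pmatrix} P & b \\ P m & P d \end{pmatrix}$ with $b,d\in A$, $P^2d-Pmb=P$ (independent of choice); $\mathrm{Tr}'^{\,\mathfrak p\mathfrak m}_{\mathfrak m}(f)=\mathrm{Tr}^{\mathfrak p\mathfrak m}_{\mathfrak m}(f|W_{\mathfrak p}^{(\mathfrak p\mathfrak m)})$. $S^{\mathfrak p-\mathrm{new}}_{k,l}(\Gamma_0(\mathfrak p\mathfrak m))=\ker(\mathrm{Tr}^{\mathfrak p\mathfrak m}_{\mathfrak m})\cap\ker(\mathrm{Tr}'^{\,\mathfrak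 p\mathfrak m}_{\mathfrak m})\subseteq S_{k,l}(\Gamma_0(\mathfrak p\mathfrak m))$. *)

theory Defs
  imports
    "HOL-Analysis.Analysis"
    "HOL-Algebra.Algebraic_Closure_Type"
    "HOL-Computational_Algebra.Formal_Laurent_Series"
begin

text \<open>
  The field F_q is a type \<open>'a\<close> of class \<open>finite_field\<close>, and A = F_q[T] is \<open>'a poly\<close>.
  K_infinity = F_q((1/T)) is \<open>'a fls\<close> with the formal variable \<open>fls_X\<close> playing the role of 1/T,
  so that T is \<open>fls_X_inv\<close>. Nonzero ideals of A are given by their monic generators.
\<close>

definition Kinf_of_A :: "'a::field poly \<Rightarrow> 'a fls" where
  "Kinf_of_A p = poly (map_poly fls_const p) fls_X_inv"

definition abs_Kinf :: "'a::finite_field fls \<Rightarrow> real" where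
  "abs_Kinf x = (if x = 0 then 0 else real CARD('a) powi (- fls_subdegree x))"

definition mat2 :: "'b::zero \<Rightarrow> 'b \<Rightarrow> 'b \<Rightarrow> 'b \<Rightarrow> 'b^2^2" where
  "mat2 a b c d = vector [vector [a, b], vector [c, d]]"

definition GL2_A :: "('a::field poly^2^2) set" where
  "GL2_A = {\<gamma>. invertible \<gamma>}"

definition Gamma0 :: "'a::field poly \<Rightarrow> ('a poly^2^2) set" where
  "Gamma0 n = {\<gamma> \<in> GL2_A. n dvd \<gamma> $ 2 $ 1}"

definition Gamma0_cosets :: "'a::field poly \<Rightarrow> 'a poly \<Rightarrow> ('a poly^2^2) set set" where
  "Gamma0_cosets n m = {{\<delta> ** \<gamma> | \<delta>. \<delta> \<in> Gamma0 n} | \<gamma>. \<gamma> \<in> Gamma0 m}"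

text \<open>
  The field C is a type \<open>'c\<close> which is a complete metric space and whose metric comes from a
  multiplicative ultrametric absolute value; it contains the algebraic closure of K_infinity as a
  dense subfield (via \<open>j\<close>), and its absolute value extends the one of K_infinity. These data
  determine C up to a unique isometric isomorphism over the algebraic closure.
\<close>

locale completed_alg_closure =
  fixes j :: "'a::finite_field fls alg_closure \<Rightarrow> 'c::{field, complete_space}"
  assumes dist_eq: "dist x y = dist (x - y) (0::'c)"
    and abs_mult: "dist (x * y) (0::'c) = dist x 0 * dist y 0"
    and abs_ultrametric: "dist (x + y) (0::'c) \<le> max (dist x 0) (dist y 0)"
    and j_one: "j 1 = 1"
    and j_add: "j (\<alpha> + \<beta>) = j \<alpha> + j \<beta>"
    and j_mult: "j (\<alpha> * \<beta>) = j \<alpha> * j \<beta>"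
    and j_dense: "closure (range j) = UNIV"
    and abs_extends: "dist (j (to_ac \<xi>)) 0 = abs_Kinf \<xi>"
begin

definition of_Kinf :: "'a fls \<Rightarrow> 'c" where
  "of_Kinf \<xi> = j (to_ac \<xi>)"

definition of_A :: "'a poly \<Rightarrow> 'c" where
  "of_A p = of_Kinf (Kinf_of_A p)"

abbreviation T :: 'c where
  "T \<equiv> of_A [:0, 1:]"

definition Omega :: "'c set" where
  "Omega = - range of_Kinf"

text \<open>
  The standard admissible covering of \<open>Omega\<close> by affinoids. Each member is the complement in the
  projective line of finitely many open discs, and its ring of rigid functions is the uniform
  closure of the rational functions without poles on it.
\<close>

definition Omega_affinoid :: "nat \<Rightarrow> 'c set" where
  "Omega_affinoid n =
     {z. dist z 0 \<le> real CARD('a) ^ n \<and> (\<forall>\<xi>. dist z (of_Kinf \<xi>) \<ge> 1 / real CARD('a) ^ n)}"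

definition rigid_holomorphic :: "('c \<Rightarrow> 'c) \<Rightarrow> bool" where
  "rigid_holomorphic f \<longleftrightarrow>
     (\<forall>n. \<exists>p q :: nat \<Rightarrow> 'c poly.
        (\<forall>i. \<forall>z\<in>Omega_affinoid n. poly (q i) z \<noteq> 0) \<and>
        uniform_limit (Omega_affinoid n) (\<lambda>i z. poly (p i) z / poly (q i) z) f sequentially)"

text \<open>
  Functions on \<open>Omega\<close> are represented by total functions that vanish outside \<open>Omega\<close>, so that
  equality of functions has the intended meaning.
\<close>

definition slash :: "int \<Rightarrow> int \<Rightarrow> ('c \<Rightarrow> 'c) \<Rightarrow> 'a fls^2^2 \<Rightarrow> 'c \<Rightarrow> 'c" where
  "slash k l f \<gamma> z =
     (if z \<in> Omega then
        of_Kinf (det \<gamma>) powi l *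
        (of_Kinf (\<gamma> $ 2 $ 1) * z + of_Kinf (\<gamma> $ 2 $ 2)) powi (- k) *
        f ((of_Kinf (\<gamma> $ 1 $ 1) * z + of_Kinf (\<gamma> $ 1 $ 2)) /
           (of_Kinf (\<gamma> $ 2 $ 1) * z + of_Kinf (\<gamma> $ 2 $ 2)))
      else 0)"

abbreviation slash_A :: "int \<Rightarrow> int \<Rightarrow> ('c \<Rightarrow> 'c) \<Rightarrow> 'a poly^2^2 \<Rightarrow> 'c \<Rightarrow> 'c" where
  "slash_A k l f \<gamma> \<equiv> slash k l f (map_matrix Kinf_of_A \<gamma>)"

text \<open>The infinite product is unordered, i.e. the limit over the finite subsets of \<open>L - {0}\<close>.\<close>

definition lattice_exp :: "'c set \<Rightarrow> 'c \<Rightarrow> 'c" where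
  "lattice_exp L z = z * Lim (finite_subsets_at_top (L - {0})) (\<lambda>F. \<Prod>w\<in>F. 1 - z / w)"

end

text \<open>
  The Carlitz period is determined up to a factor in the multiplicative group of F_q by the
  requirement that \<open>per A\<close> is the lattice of the Carlitz module \<open>T X + X^q\<close>.
\<close>

locale carlitz_period = completed_alg_closure j
  for j :: "'a::finite_field fls alg_closure \<Rightarrow> 'c::{field, complete_space}" +
  fixes per :: 'c
  assumes per_nonzero: "per \<noteq> 0"
    and per_carlitz: "lattice_exp (range (\<lambda>a. per * of_A a)) (T * z) =
        T * lattice_exp (range (\<lambda>a. per * of_A a)) z +
        lattice_exp (range (\<lambda>a. per * of_A a)) z ^ CARD('a)"
begin

definition u :: "'c \<Rightarrow> 'c" where
  "u z = 1 / lattice_exp (range (\<lambda>a. per * of_A a)) (per * z)"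

definition vanishes_at_cusps :: "int \<Rightarrow> int \<Rightarrow> 'a poly \<Rightarrow> ('c \<Rightarrow> 'c) \<Rightarrow> bool" where
  "vanishes_at_cusps k l n f \<longleftrightarrow>
     (\<forall>\<gamma>\<in>GL2_A. \<exists>(c :: nat \<Rightarrow> 'c) R. \<forall>z\<in>Omega. infdist z (range of_Kinf) > R \<longrightarrow>
        (\<lambda>i. c i * u (z / of_A n) ^ Suc i) sums slash_A k l f \<gamma> z)"

definition cusp_forms :: "int \<Rightarrow> int \<Rightarrow> 'a poly \<Rightarrow> ('c \<Rightarrow> 'c) set" where
  "cusp_forms k l n =
     {f. (\<forall>z. z \<notin> Omega \<longrightarrow> f z = 0) \<and> rigid_holomorphic f \<and>
         (\<forall>\<gamma>\<in>Gamma0 n. slash_A k l f \<gamma> = f) \<and> vanishes_at_cusps k l n f}"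

text \<open>
  For \<open>m dvd n\<close> and \<open>f\<close> invariant under \<open>Gamma0 n\<close>, the trace does not depend on the chosen
  representatives of the right cosets.
\<close>

definition level_trace :: "int \<Rightarrow> int \<Rightarrow> 'a poly \<Rightarrow> 'a poly \<Rightarrow> ('c \<Rightarrow> 'c) \<Rightarrow> 'c \<Rightarrow> 'c" where
  "level_trace k l n m f z =
     (\<Sum>R\<in>Gamma0_cosets n m. slash_A k l f (SOME \<gamma>. \<gamma> \<in> R) z)"

definition atkin_lehner_mat :: "'a poly \<Rightarrow> 'a poly \<Rightarrow> 'a poly^2^2" where
  "atkin_lehner_mat P m =
     (case SOME (b, d). P^2 * d - P * m * b = P of (b, d) \<Rightarrow> mat2 P b (P * m) (P * d))"

definition atkin_lehner :: "int \<Rightarrow> int \<Rightarrow> 'a poly \<Rightarrow> 'a poly \<Rightarrow> ('c \<Rightarrow> 'c) \<Rightarrow> 'c \<Rightarrow> 'c" where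
  "atkin_lehner k l P m f = slash_A k l f (atkin_lehner_mat P m)"

definition twisted_trace :: "int \<Rightarrow> int \<Rightarrow> 'a poly \<Rightarrow> 'a poly \<Rightarrow> ('c \<Rightarrow> 'c) \<Rightarrow> 'c \<Rightarrow> 'c" where
  "twisted_trace k l P m f = level_trace k l (P * m) m (atkin_lehner k l P m f)"

definition old_forms :: "int \<Rightarrow> int \<Rightarrow> 'a poly \<Rightarrow> 'a poly \<Rightarrow> ('c \<Rightarrow> 'c) set" where
  "old_forms k l P m =
     {(\<lambda>z. f z + slash_A k l g (mat2 P 0 0 1) z) | f g.
        f \<in> cusp_forms k l m \<and> g \<in> cusp_forms k l m}"

definition new_forms :: "int \<Rightarrow> int \<Rightarrow> 'a poly \<Rightarrow> 'a poly \<Rightarrow> ('c \<Rightarrow> 'c) set" where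
  "new_forms k l P m =
     {f \<in> cusp_forms k l (P * m).
        level_trace k l (P * m) m f = (\<lambda>_. 0) \<and> twisted_trace k l P m f = (\<lambda>_. 0)}"

lemma slash_zero: "slash k l (\<lambda>_. 0) \<gamma> = (\<lambda>_. 0)"
  by (simp add: slash_def fun_eq_iff)

lemma zero_in_cusp_forms: "(\<lambda>_. 0) \<in> cusp_forms k l n"
proof -
  have "rigid_holomorphic (\<lambda>_. 0)"
    unfolding rigid_holomorphic_def
    by (rule allI, rule exI[of _ "\<lambda>_. 0"], rule exI[of _ "\<lambda>_. 1"])
       (simp add: uniform_limit_iff)
  moreover have "vanishes_at_cusps k l n (\<lambda>_. 0)"
    unfolding vanishes_at_cusps_def slash_zero
    by (intro ballI exI[of _ "\<lambda>_. 0"] exI[of _ 0]) (simp add: sums_def)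
  ultimately show ?thesis
    by (simp add: cusp_forms_def slash_zero)
qed

lemma zero_in_old_forms: "(\<lambda>_. 0) \<in> old_forms k l P m"
proof -
  have "(\<lambda>_. 0) = (\<lambda>z. (\<lambda>_. 0) z + slash_A k l (\<lambda>_. 0) (mat2 P 0 0 1) z)"
    by (simp add: slash_zero)
  then show ?thesis
    unfolding old_forms_def mem_Collect_eq
    by (intro exI[of _ "\<lambda>_. 0"] conjI zero_in_cusp_forms)
qed

lemma zero_in_new_forms: "(\<lambda>_. 0) \<in> new_forms k l P m"
  by (simp add: new_forms_def zero_in_cusp_forms twisted_trace_def level_trace_def
      atkin_lehner_def slash_zero fun_eq_iff)

end

end

theory Submission
  imports Defs
begin

text \<open>
  Let \<open>E\<close> be Gekeler's false Eisenstein series, the sum of \<open>a * u (a z)\<close> over monic polynomials \<open>a\<close>.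
  It is not a modular form: in weight two and type one it satisfies \<open>E | \<gamma> = E + \<kappa> c / (c z + d)\<close>
  for \<open>\<gamma>\<close> in \<open>GL\<^sub>2(A)\<close> with bottom row \<open>(c, d)\<close> and a constant \<open>\<kappa>\<close>. But the correction term depends
  only on the bottom row, so it cancels in \<open>f = E - E | diag (m, 1)\<close>, which is a cusp form for
  \<open>Gamma0 m\<close>. Three facts make \<open>h = f - f | diag (P, 1)\<close> a nonzero form that is both \<open>P\<close>-old and
  \<open>P\<close>-new.

  \<^item> The trace from level \<open>P m\<close> to level \<open>m\<close> multiplies \<open>f\<close> by the index \<open>q ^ degree P + 1\<close>, which
    is \<open>1\<close> in characteristic \<open>p\<close>. The trace of \<open>f | diag (P, 1)\<close> is the image of \<open>f\<close> under the Hecke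
    operator at \<open>P\<close>, and \<open>E\<close> is an eigenform with eigenvalue \<open>1\<close>. Hence both traces equal \<open>f\<close>, and
    the trace of \<open>h\<close> vanishes (\<open>eis_hecke\<close>, \<open>level_trace_old_new_form\<close>).
  \<^item> The Atkin-Lehner operator interchanges \<open>f\<close> and \<open>f | diag (P, 1)\<close>, because scalar matrices act
    trivially in weight two and type one. So it maps \<open>h\<close> to \<open>- h\<close>, and the twisted trace of \<open>h\<close>
    vanishes as well (\<open>atkin_lehner_old_new_form\<close>).
  \<^item> At a square root of \<open>T\<close> the first term \<open>u z\<close> of \<open>E\<close> has larger absolute value than all the
    other terms of \<open>h\<close> (\<open>old_new_form_neq_0\<close>).

  The analytic input is developed from the double sum of \<open>a / (a z + b)\<close> over \<open>A \<times> A\<close>, which is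
  \<open>E\<close> up to a constant (\<open>eis\<close>). The sum over \<open>b\<close> is the reciprocal of the exponential function of
  \<open>A\<close> at \<open>a z\<close>, and this function grows at least quadratically in \<open>|a|\<close>, uniformly for \<open>z\<close> in an
  affinoid (\<open>nv_fin_exp_ge\<close>). Therefore the sums over boxes converge uniformly and however the two
  sides of the box tend to infinity (\<open>box_sum_uniform\<close>); as the box sums are rational functions,
  the limit is rigid holomorphic. Square boxes are invariant under exchanging \<open>a\<close> and \<open>b\<close>, which
  yields the transformation law under \<open>z \<mapsto> 1 / z\<close>; its inhomogeneous term arises because the
  number of nonzero pairs in a box is \<open>-1\<close> in characteristic \<open>p\<close> (\<open>eis_inverse\<close>).

  At a cusp, the addition theorem of the exponential function expands
  \<open>1 / (exponential of (w + \<theta>))\<close> into a geometric series in \<open>1 / (exponential of w)\<close>. Summing over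
  residues produces power sums over finite additive groups as coefficients. They vanish in low
  degrees, and this is what permits exchanging the two summations (\<open>eis_expansion\<close>).
\<close>

hide_const (open) up_ring.coeff module.smult Polynomials.degree Polynomials.lead_coeff

(* In the sequel the symbol $ denotes matrix entries only. *)
no_notation fps_nth (infixl \<open>$\<close> 75)

section \<open>Polynomials of bounded degree\<close>

definition polys_below :: "nat \<Rightarrow> 'a::zero poly set" where
  "polys_below D = {p. \<forall>i\<ge>D. coeff p i = 0}"

lemma polys_below_iff_degree: "p \<in> polys_below D \<longleftrightarrow> p = 0 \<or> degree p < D"
proof
  assume p: "p \<in> polys_below D"
  show "p = 0 \<or> degree p < D"
  proof (rule ccontr)
    assume "\<not> (p = 0 \<or> degree p < D)"
    then have "lead_coeff p \<noteq> 0" "D \<le> degree p" by auto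
    with p show False by (auto simp: polys_below_def)
  qed
qed (auto simp: polys_below_def coeff_eq_0)

lemma zero_in_polys_below [simp]: "0 \<in> polys_below D"
  by (simp add: polys_below_def)

lemma polys_below_0: "polys_below 0 = {0}"
  by (auto simp: polys_below_def poly_eq_iff)

lemma add_in_polys_below:
  fixes p q :: "'a::comm_monoid_add poly"
  shows "p \<in> polys_below D \<Longrightarrow> q \<in> polys_below D \<Longrightarrow> p + q \<in> polys_below D"
  by (simp add: polys_below_def)

lemma diff_in_polys_below:
  fixes p q :: "'a::ab_group_add poly"
  shows "p \<in> polys_below D \<Longrightarrow> q \<in> polys_below D \<Longrightarrow> p - q \<in> polys_below D"
  by (simp add: polys_below_def)

lemma uminus_in_polys_below:
  fixes p :: "'a::ab_group_add poly"
  shows "- p \<in> polys_below D \<longleftrightarrow> p \<in> polys_below D"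
  by (simp add: polys_below_def)

lemma smult_in_polys_below:
  fixes p :: "'a::field poly"
  shows "c \<noteq> 0 \<Longrightarrow> smult c p \<in> polys_below D \<longleftrightarrow> p \<in> polys_below D"
  by (simp add: polys_below_def)

lemma polys_below_mono: "D \<le> D' \<Longrightarrow> polys_below D \<subseteq> polys_below D'"
  by (auto simp: polys_below_def)

lemma one_in_polys_below: "D \<ge> 1 \<Longrightarrow> (1::'a::field poly) \<in> polys_below D"
  by (simp add: polys_below_iff_degree)

lemma polys_below_Suc:
  "polys_below (Suc D) = (\<lambda>(c, p). pCons c p) ` (UNIV \<times> polys_below D)"
proof (intro equalityI subsetI)
  fix p :: "'a poly" assume p: "p \<in> polys_below (Suc D)"
  obtain c p' where "p = pCons c p'" by (cases p)
  moreover have "p' \<in> polys_below D"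
    unfolding polys_below_def
  proof (intro CollectI allI impI)
    fix i assume "D \<le> i"
    with p have "coeff p (Suc i) = 0" by (simp add: polys_below_def)
    with \<open>p = pCons c p'\<close> show "coeff p' i = 0" by simp
  qed
  ultimately show "p \<in> (\<lambda>(c, p). pCons c p) ` (UNIV \<times> polys_below D)" by auto
qed (auto simp: polys_below_def coeff_pCons split: nat.splits)

lemma finite_polys_below: "finite (polys_below D :: 'a::{zero,finite} poly set)"
  by (induction D) (auto simp: polys_below_0 polys_below_Suc)

lemma sum_polys_below_Suc:
  fixes f :: "'a::{comm_monoid_add,finite} poly \<Rightarrow> 'b::comm_monoid_add"
  shows "(\<Sum>p\<in>polys_below (Suc D). f p) = (\<Sum>c\<in>UNIV. \<Sum>p\<in>polys_below D. f (pCons c p))"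
proof -
  have "(\<Sum>p\<in>polys_below (Suc D). f p)
      = (\<Sum>x\<in>UNIV \<times> polys_below D. f (case x of (c, p) \<Rightarrow> pCons c p))"
    unfolding polys_below_Suc by (subst sum.reindex) (auto simp: inj_on_def)
  also have "\<dots> = (\<Sum>(c, p)\<in>UNIV \<times> polys_below D. f (pCons c p))"
    by (auto intro!: sum.cong)
  finally show ?thesis by (simp add: sum.cartesian_product)
qed

lemma sum_polys_below_shift:
  fixes c :: "'a::ab_group_add poly"
  assumes "c \<in> polys_below D"
  shows "(\<Sum>p\<in>polys_below D. f (p + c)) = (\<Sum>p\<in>polys_below D. f p)"
  by (rule sum.reindex_bij_witness[of _ "\<lambda>p. p - c" "\<lambda>p. p + c"])
     (use assms in \<open>auto intro: add_in_polys_below diff_in_polys_below\<close>)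

lemma mod_in_polys_below:
  fixes s :: "'a::field poly"
  assumes "s \<noteq> 0"
  shows "p mod s \<in> polys_below (degree s)"
  using assms degree_mod_less[of s p] by (auto simp: polys_below_iff_degree)

lemma mod_polys_below_degree:
  fixes s :: "'a::field poly"
  assumes "r \<in> polys_below (degree s)"
  shows "r mod s = r"
  using assms by (auto simp: polys_below_iff_degree mod_poly_less)

lemma dvd_mult_in_polys_below:
  fixes p s :: "'a::field poly"
  assumes "s \<noteq> 0"
  shows "s * p \<in> polys_below (D + degree s) \<longleftrightarrow> p \<in> polys_below D"
  using assms by (cases "p = 0") (auto simp: polys_below_iff_degree degree_mult_eq)

lemma sum_polys_below_division:
  fixes s :: "'a::field poly"
  assumes "s \<noteq> 0"
  shows "(\<Sum>p\<in>polys_below (D + degree s). f p)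
       = (\<Sum>r\<in>polys_below (degree s). \<Sum>t\<in>polys_below D. f (r + s * t))"
proof -
  have div: "p div s \<in> polys_below D" if "p \<in> polys_below (D + degree s)" for p
  proof -
    have "s * (p div s) = p - p mod s" by (simp add: minus_mod_eq_mult_div)
    moreover have "p mod s \<in> polys_below (D + degree s)"
      using mod_in_polys_below[OF assms, of p] polys_below_mono[of "degree s" "D + degree s"] by auto
    ultimately have "s * (p div s) \<in> polys_below (D + degree s)"
      using diff_in_polys_below[OF that] by simp
    then show ?thesis using dvd_mult_in_polys_below[OF assms] by blast
  qed
  have mem: "r + s * t \<in> polys_below (D + degree s)"
    if "r \<in> polys_below (degree s)" "t \<in> polys_below D" for r t
    using that polys_below_mono[of "degree s" "D + degree s"] dvd_mult_in_polys_below[OF assms]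
    by (intro add_in_polys_below) auto
  have eqs: "r div s = 0" "r mod s = r" if "r \<in> polys_below (degree s)" for r
    using mod_polys_below_degree[OF that] div_mult_mod_eq[of r s] assms by simp_all
  have "(\<Sum>p\<in>polys_below (D + degree s). f p)
      = (\<Sum>(r, t)\<in>polys_below (degree s) \<times> polys_below D. f (r + s * t))"
    by (rule sum.reindex_bij_witness[of _ "\<lambda>(r, t). r + s * t" "\<lambda>p. (p mod s, p div s)"])
       (use assms in \<open>auto simp: mod_in_polys_below div mem eqs mod_mult_div_eq\<close>)
  then show ?thesis by (simp add: sum.cartesian_product)
qed

lemma bij_betw_mult_residues:
  fixes s a :: "'a::{field,finite} poly"
  assumes "prime_elem s" "\<not> s dvd a"
  shows "bij_betw (\<lambda>r. a * r mod s) (polys_below (degree s)) (polys_below (degree s))"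
proof -
  have s0: "s \<noteq> 0" using assms(1) by auto
  have inj: "inj_on (\<lambda>r. a * r mod s) (polys_below (degree s))"
  proof (rule inj_onI)
    fix x y assume xy: "x \<in> polys_below (degree s)" "y \<in> polys_below (degree s)"
      and "a * x mod s = a * y mod s"
    then have "s dvd a * (x - y)"
      by (simp add: mod_eq_dvd_iff right_diff_distrib)
    with assms have "s dvd x - y" by (simp add: prime_elem_dvd_mult_iff)
    then have "x mod s = y mod s" by (simp add: mod_eq_dvd_iff)
    with xy show "x = y" by (simp add: mod_polys_below_degree)
  qed
  moreover have "(\<lambda>r. a * r mod s) ` polys_below (degree s) = polys_below (degree s)"
    using mod_in_polys_below[OF s0] inj finite_polys_below
    by (intro card_subset_eq) (auto simp: card_image)
  ultimately show ?thesis by (simp add: bij_betw_def)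
qed

section \<open>The valued field\<close>

lemma Kinf_of_A_0 [simp]: "Kinf_of_A 0 = 0"
  by (simp add: Kinf_of_A_def)

lemma Kinf_of_A_pCons: "Kinf_of_A (pCons c p) = fls_const c + fls_X_inv * Kinf_of_A p"
  by (cases "pCons c p = 0") (auto simp: Kinf_of_A_def map_poly_pCons)

lemma Kinf_of_A_1 [simp]: "Kinf_of_A 1 = 1"
  unfolding one_pCons by (simp add: Kinf_of_A_pCons)

lemma Kinf_of_A_add: "Kinf_of_A (p + q) = Kinf_of_A p + Kinf_of_A q"
  by (induction p q rule: poly_induct2)
     (auto simp: Kinf_of_A_pCons fls_plus_const algebra_simps)

lemma Kinf_of_A_smult: "Kinf_of_A (smult c p) = fls_const c * Kinf_of_A p"
  by (induction p) (auto simp: Kinf_of_A_pCons fls_const_mult_const algebra_simps)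

lemma Kinf_of_A_mult: "Kinf_of_A (p * q) = Kinf_of_A p * Kinf_of_A q"
  by (induction p) (auto simp: Kinf_of_A_pCons Kinf_of_A_add Kinf_of_A_smult algebra_simps)

lemma Kinf_of_A_minus: "Kinf_of_A (- p) = - Kinf_of_A p"
  using Kinf_of_A_add[of p "- p"] by (simp add: add_eq_0_iff)

lemma Kinf_of_A_diff: "Kinf_of_A (p - q) = Kinf_of_A p - Kinf_of_A q"
  using Kinf_of_A_add[of p "- q"] by (simp add: Kinf_of_A_minus)

lemma Kinf_of_A_nth:
  "fls_nth (Kinf_of_A p) k = (if k \<le> 0 then coeff p (nat (- k)) else 0)"
proof (induction p arbitrary: k)
  case (pCons c p)
  show ?case
    by (auto simp: Kinf_of_A_pCons fls_X_inv_times_conv_shift pCons.IH coeff_pCons nat_diff_distrib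
        split: nat.splits)
qed auto

lemma Kinf_of_A_eq_0_iff [simp]: "Kinf_of_A p = 0 \<longleftrightarrow> p = 0"
proof
  assume "Kinf_of_A p = 0"
  then have "fls_nth (Kinf_of_A p) (- int (degree p)) = 0" by simp
  then show "p = 0" by (simp add: Kinf_of_A_nth)
qed auto

lemma fls_subdegree_Kinf_of_A: "p \<noteq> 0 \<Longrightarrow> fls_subdegree (Kinf_of_A p) = - int (degree p)"
  by (intro fls_subdegree_eqI) (auto simp: Kinf_of_A_nth coeff_eq_0)

lemma abs_Kinf_of_A: "abs_Kinf (Kinf_of_A p :: 'a::finite_field fls)
    = (if p = 0 then 0 else real CARD('a) ^ degree p)"
  by (simp add: abs_Kinf_def fls_subdegree_Kinf_of_A)

context completed_alg_closure
begin

abbreviation nv :: "'c \<Rightarrow> real" where "nv x \<equiv> dist x 0"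

lemma q_gt_1: "real CARD('a) > 1"
proof -
  have "card {0, 1 :: 'a} \<le> CARD('a)" by (rule card_mono) auto
  then show ?thesis by simp
qed

lemma nv_one [simp]: "nv 1 = 1"
  using abs_mult[of 1 1] by simp

lemma nv_minus [simp]: "nv (- x) = nv x"
  using dist_eq[of 0 x] by (simp add: dist_commute)

lemma nv_diff_commute: "nv (x - y) = nv (y - x)"
  using nv_minus[of "x - y"] by simp

lemma nv_diff_le: "nv (x - y) \<le> max (nv x) (nv y)"
  using abs_ultrametric[of x "- y"] by simp

lemma nv_divide: "nv (x / y) = nv x / nv y"
proof (cases "y = 0")
  case False
  then show ?thesis using abs_mult[of "x / y" y] by (simp add: field_simps)
qed auto

lemma nv_power: "nv (x ^ n) = nv x ^ n"
  by (induction n) (auto simp: abs_mult)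

lemma nv_prod: "nv (\<Prod>i\<in>I. f i) = (\<Prod>i\<in>I. nv (f i))"
  by (induction I rule: infinite_finite_induct) (auto simp: abs_mult)

lemma nv_sum_le:
  assumes "\<And>i. i \<in> I \<Longrightarrow> nv (f i) \<le> B" "B \<ge> 0"
  shows "nv (\<Sum>i\<in>I. f i) \<le> B"
  using assms
proof (induction I rule: infinite_finite_induct)
  case (insert i I)
  then have "nv (f i) \<le> B" "nv (sum f I) \<le> B" by auto
  with insert.hyps abs_ultrametric[of "f i" "sum f I"] show ?case by simp
qed auto

lemma nv_add_le: "nv x \<le> B \<Longrightarrow> nv y \<le> B \<Longrightarrow> nv (x + y) \<le> B"
  using abs_ultrametric[of x y] by simp

lemma nv_diff_leI: "nv x \<le> B \<Longrightarrow> nv y \<le> B \<Longrightarrow> nv (x - y) \<le> B"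
  using nv_diff_le[of x y] by simp

lemma nv_add_eq:
  assumes "nv y < nv x"
  shows "nv (x + y) = nv x"
proof (rule antisym)
  show "nv (x + y) \<le> nv x" using abs_ultrametric[of x y] assms by simp
  have "nv x \<le> max (nv (x + y)) (nv y)" using nv_diff_le[of "x + y" y] by simp
  with assms show "nv x \<le> nv (x + y)" by simp
qed

text \<open>Factors close to \<open>1\<close> have a product close to \<open>1\<close>, uniformly in their number.\<close>

lemma nv_prod_minus_one_le:
  assumes "finite I" "\<And>i. i \<in> I \<Longrightarrow> nv (f i - 1) \<le> e" "0 \<le> e" "e \<le> 1"
  shows "nv ((\<Prod>i\<in>I. f i) - 1) \<le> e"
  using assms
proof (induction I rule: finite_induct)
  case (insert i I)
  have eq: "(\<Prod>j\<in>insert i I. f j) - 1 = f i * (prod f I - 1) + (f i - 1)"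
    using insert.hyps by (simp add: algebra_simps)
  have "nv (f i * (prod f I - 1)) \<le> e"
  proof -
    have "nv (f i) \<le> 1"
      using abs_ultrametric[of "f i - 1" 1] insert.prems(1)[of i] insert.prems(3) by simp
    moreover have "nv (prod f I - 1) \<le> e" using insert by auto
    ultimately show ?thesis
      unfolding abs_mult using mult_mono[of "nv (f i)" 1 "nv (prod f I - 1)" e] by simp
  qed
  then show ?case
    unfolding eq using insert.prems(1)[of i] by (intro nv_add_le) auto
qed auto

subsection \<open>Limits\<close>

text \<open>
  The type \<open>'c\<close> is only known to be a metric space and a field, so the continuity of the field
  operations has to be derived from the ultrametric absolute value.
\<close>

lemma tendsto_iff_nv:
  fixes f :: "'b \<Rightarrow> 'c"
  shows "(f \<longlongrightarrow> l) F \<longleftrightarrow> (\<forall>e>0. eventually (\<lambda>x. nv (f x - l) < e) F)"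
  unfolding tendsto_iff by (subst dist_eq) simp

lemma tendsto_nv_diff:
  fixes f :: "'b \<Rightarrow> 'c"
  shows "(f \<longlongrightarrow> l) F \<longleftrightarrow> ((\<lambda>x. nv (f x - l)) \<longlongrightarrow> 0) F"
  unfolding tendsto_dist_iff[of f l F] by (subst dist_eq) simp

lemma lim_add:
  fixes f g :: "'b \<Rightarrow> 'c"
  assumes "(f \<longlongrightarrow> a) F" "(g \<longlongrightarrow> b) F"
  shows "((\<lambda>x. f x + g x) \<longlongrightarrow> a + b) F"
  unfolding tendsto_iff_nv
proof (intro allI impI)
  fix e :: real assume "e > 0"
  with assms have "eventually (\<lambda>x. nv (f x - a) < e) F" "eventually (\<lambda>x. nv (g x - b) < e) F"
    by (auto simp: tendsto_iff_nv)
  then show "eventually (\<lambda>x. nv (f x + g x - (a + b)) < e) F"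
  proof eventually_elim
    case (elim x)
    then show ?case
      using abs_ultrametric[of "f x - a" "g x - b"] by (simp add: algebra_simps)
  qed
qed

lemma lim_mult_const:
  fixes f :: "'b \<Rightarrow> 'c"
  assumes "(f \<longlongrightarrow> a) F"
  shows "((\<lambda>x. c * f x) \<longlongrightarrow> c * a) F"
proof -
  have "((\<lambda>x. nv c * nv (f x - a)) \<longlongrightarrow> nv c * 0) F"
    using assms by (intro tendsto_mult tendsto_const) (simp add: tendsto_nv_diff)
  then show ?thesis
    by (simp add: tendsto_nv_diff[of "\<lambda>x. c * f x"] abs_mult[symmetric] right_diff_distrib)
qed

lemma lim_minus:
  fixes f :: "'b \<Rightarrow> 'c"
  assumes "(f \<longlongrightarrow> a) F"
  shows "((\<lambda>x. - f x) \<longlongrightarrow> - a) F"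
  using lim_mult_const[OF assms, of "- 1"] by simp

lemma lim_diff:
  fixes f g :: "'b \<Rightarrow> 'c"
  assumes "(f \<longlongrightarrow> a) F" "(g \<longlongrightarrow> b) F"
  shows "((\<lambda>x. f x - g x) \<longlongrightarrow> a - b) F"
  using lim_add[OF assms(1) lim_minus[OF assms(2)]] by simp

lemma lim_sum:
  fixes f :: "'i \<Rightarrow> 'b \<Rightarrow> 'c"
  assumes "\<And>i. i \<in> I \<Longrightarrow> (f i \<longlongrightarrow> a i) F"
  shows "((\<lambda>x. \<Sum>i\<in>I. f i x) \<longlongrightarrow> (\<Sum>i\<in>I. a i)) F"
  using assms by (induction I rule: infinite_finite_induct) (auto intro!: lim_add)

lemma lim_nv:
  fixes f :: "'b \<Rightarrow> 'c"
  assumes "(f \<longlongrightarrow> a) F"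
  shows "((\<lambda>x. nv (f x)) \<longlongrightarrow> nv a) F"
  using assms by (intro tendsto_intros)

lemma lim_inverse:
  fixes f :: "'b \<Rightarrow> 'c"
  assumes "(f \<longlongrightarrow> a) F" "a \<noteq> 0"
  shows "((\<lambda>x. 1 / f x) \<longlongrightarrow> 1 / a) F"
  unfolding tendsto_iff_nv
proof (intro allI impI)
  fix e :: real assume "e > 0"
  let ?d = "min (nv a) (e * nv a * nv a)"
  have "?d > 0" using assms(2) \<open>e > 0\<close> by simp
  with assms(1) have "eventually (\<lambda>x. nv (f x - a) < ?d) F"
    by (simp only: tendsto_iff_nv)
  then show "eventually (\<lambda>x. nv (1 / f x - 1 / a) < e) F"
  proof eventually_elim
    case (elim x)
    have eq: "nv (f x) = nv a"
      using nv_add_eq[of "f x - a" a] elim by (simp add: algebra_simps)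
    then have "f x \<noteq> 0" using assms(2) by auto
    then have "1 / f x - 1 / a = (a - f x) / (f x * a)"
      using assms(2) by (simp add: field_simps)
    then have "nv (1 / f x - 1 / a) = nv (f x - a) / (nv a * nv a)"
      by (simp add: nv_divide abs_mult eq nv_diff_commute)
    also have "\<dots> < e" using elim assms(2) by (simp add: pos_divide_less_eq mult.assoc)
    finally show ?case .
  qed
qed

lemma lim_nv_le:
  fixes f :: "nat \<Rightarrow> 'c"
  assumes "(f \<longlongrightarrow> a) sequentially" "eventually (\<lambda>n. nv (f n) \<le> B) sequentially"
  shows "nv a \<le> B"
  using tendsto_upperbound[OF lim_nv[OF assms(1)] assms(2)] by simp

lemma convergent_nv_Cauchy:
  fixes f :: "nat \<Rightarrow> 'c"
  assumes "\<And>e. e > 0 \<Longrightarrow> \<exists>N. \<forall>m\<ge>N. \<forall>n\<ge>N. nv (f m - f n) \<le> e"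
  shows "\<exists>l. f \<longlonglongrightarrow> l"
proof -
  have "Cauchy f"
  proof (rule metric_CauchyI)
    fix e :: real assume "e > 0"
    then obtain N where N: "\<forall>m\<ge>N. \<forall>n\<ge>N. nv (f m - f n) \<le> e / 2"
      using assms[of "e / 2"] by auto
    have "dist (f m) (f n) < e" if "m \<ge> N" "n \<ge> N" for m n
    proof -
      have "nv (f m - f n) \<le> e / 2" using N that by blast
      then show ?thesis using \<open>e > 0\<close> by (subst dist_eq) simp
    qed
    then show "\<exists>M. \<forall>m\<ge>M. \<forall>n\<ge>M. dist (f m) (f n) < e" by blast
  qed
  then show ?thesis by (simp add: Cauchy_convergent_iff convergent_def)
qed

subsection \<open>The embeddings of \<open>A\<close> and \<open>K_\<infinity>\<close>\<close>

lemma of_Kinf_add: "of_Kinf (x + y) = of_Kinf x + of_Kinf y"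
  by (simp add: of_Kinf_def j_add)

lemma of_Kinf_mult: "of_Kinf (x * y) = of_Kinf x * of_Kinf y"
  by (simp add: of_Kinf_def j_mult)

lemma of_Kinf_1 [simp]: "of_Kinf 1 = 1"
  by (simp add: of_Kinf_def j_one)

lemma nv_of_Kinf: "nv (of_Kinf x) = abs_Kinf x"
  by (simp add: of_Kinf_def abs_extends)

lemma of_Kinf_eq_0_iff [simp]: "of_Kinf x = 0 \<longleftrightarrow> x = 0"
proof -
  have "nv (of_Kinf x) = 0 \<longleftrightarrow> x = 0"
    using q_gt_1 by (auto simp: nv_of_Kinf abs_Kinf_def)
  then show ?thesis by simp
qed

lemma of_Kinf_0 [simp]: "of_Kinf 0 = 0" by simp

lemma of_Kinf_minus: "of_Kinf (- x) = - of_Kinf x"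
  using of_Kinf_add[of x "- x"] by (simp add: add_eq_0_iff)

lemma of_Kinf_diff: "of_Kinf (x - y) = of_Kinf x - of_Kinf y"
  using of_Kinf_add[of x "- y"] by (simp add: of_Kinf_minus)

lemma of_Kinf_divide: "of_Kinf (x / y) = of_Kinf x / of_Kinf y"
proof (cases "y = 0")
  case False
  then have "of_Kinf (x / y) * of_Kinf y = of_Kinf x" by (simp flip: of_Kinf_mult)
  with False show ?thesis by (simp add: field_simps)
qed auto

lemma of_A_0 [simp]: "of_A 0 = 0"
  and of_A_1 [simp]: "of_A 1 = 1"
  and of_A_eq_0_iff [simp]: "of_A a = 0 \<longleftrightarrow> a = 0"
  by (simp_all add: of_A_def)

lemma of_A_add: "of_A (a + b) = of_A a + of_A b"
  and of_A_mult: "of_A (a * b) = of_A a * of_A b"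
  and of_A_diff: "of_A (a - b) = of_A a - of_A b"
  and of_A_minus: "of_A (- a) = - of_A a"
  by (simp_all add: of_A_def Kinf_of_A_add Kinf_of_A_mult Kinf_of_A_diff Kinf_of_A_minus
      of_Kinf_add of_Kinf_mult of_Kinf_diff of_Kinf_minus)

lemma of_A_eq_iff [simp]: "of_A a = of_A b \<longleftrightarrow> a = b"
  using of_A_eq_0_iff[of "a - b"] by (simp add: of_A_diff)

lemma nv_of_A: "nv (of_A a) = (if a = 0 then 0 else real CARD('a) ^ degree a)"
  by (simp add: of_A_def nv_of_Kinf abs_Kinf_of_A)

lemma nv_of_A_ge_1: "a \<noteq> 0 \<Longrightarrow> nv (of_A a) \<ge> 1"
  using q_gt_1 by (simp add: nv_of_A)

lemma nv_of_A_ge: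
  assumes "a \<notin> polys_below D"
  shows "nv (of_A a) \<ge> real CARD('a) ^ D"
  using assms q_gt_1 by (auto simp: nv_of_A polys_below_iff_degree)

lemma nv_of_A_less:
  assumes "a \<in> polys_below D"
  shows "nv (of_A a) < real CARD('a) ^ D"
  using assms q_gt_1 by (auto simp: nv_of_A polys_below_iff_degree)

text \<open>
  The number of polynomials of bounded degree is a power of \<open>q\<close>; it vanishes in \<open>'c\<close> because
  translation by \<open>1\<close> permutes them and changes their sum by that number.
\<close>

lemma card_polys_below_eq_0:
  assumes "D \<ge> 1"
  shows "(of_nat (card (polys_below D :: 'a poly set)) :: 'c) = 0"
proof -
  have "(\<Sum>p\<in>polys_below D. of_A (p + 1)) = (\<Sum>p\<in>polys_below D. of_A (p :: 'a poly))"
    by (rule sum_polys_below_shift) (rule one_in_polys_below[OF assms])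
  then show ?thesis by (simp add: of_A_add sum.distrib)
qed

lemma q_eq_0: "(of_nat CARD('a) :: 'c) = 0"
proof -
  have "polys_below (Suc 0) = (\<lambda>c :: 'a. [:c:]) ` UNIV"
    by (auto simp: polys_below_Suc polys_below_0)
  then have "card (polys_below (Suc 0) :: 'a poly set) = CARD('a)"
    by (simp add: card_image inj_on_def)
  then show ?thesis using card_polys_below_eq_0[of "Suc 0"] by simp
qed

end

section \<open>The exponential function of \<open>A\<close>\<close>

context completed_alg_closure
begin

definition recip_sum :: "nat \<Rightarrow> 'c \<Rightarrow> 'c" where
  "recip_sum D x = (\<Sum>c\<in>polys_below D. 1 / (x + of_A c))"

text \<open>
  The \<open>F\<^sub>q\<close>-linear polynomial with zero set \<open>polys_below D\<close>, normalized to have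
  derivative \<open>1\<close>; the truncation of the exponential function of the lattice \<open>A\<close>.
\<close>

definition fin_exp :: "nat \<Rightarrow> 'c \<Rightarrow> 'c" where
  "fin_exp D x = x * (\<Prod>c\<in>polys_below D - {0}. 1 - x / of_A c)"

text \<open>
  On a member of the admissible covering of \<open>Omega\<close> the distance from \<open>K_\<infinity>\<close> has a positive lower
  bound, so estimates that depend only on \<open>\<delta>\<close> are uniform there. The condition passes to
  \<open>a * x + b\<close> with \<open>\<delta>\<close> multiplied by \<open>|a|\<close>.
\<close>

definition far :: "real \<Rightarrow> 'c \<Rightarrow> bool" where
  "far \<delta> x \<longleftrightarrow> (\<forall>\<xi>. nv (x - of_Kinf \<xi>) \<ge> \<delta>)"

lemma fin_exp_alt: "fin_exp D x = x * (\<Prod>c\<in>polys_below D - {0}. 1 + x / of_A c)"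
proof -
  have "(\<Prod>c\<in>polys_below D - {0}. 1 - x / of_A c) = (\<Prod>c\<in>polys_below D - {0}. 1 + x / of_A c)"
    by (rule prod.reindex_bij_witness[of _ uminus uminus])
       (auto simp: of_A_minus uminus_in_polys_below)
  then show ?thesis by (simp add: fin_exp_def)
qed

lemma prod_add_polys_below:
  "(\<Prod>c\<in>polys_below D. x + of_A c) = fin_exp D x * (\<Prod>c\<in>polys_below D - {0}. of_A c)"
proof -
  have "(\<Prod>c\<in>polys_below D. x + of_A c) = x * (\<Prod>c\<in>polys_below D - {0}. x + of_A c)"
    by (subst prod.remove[of _ 0]) (auto simp: finite_polys_below)
  also have "(\<Prod>c\<in>polys_below D - {0}. x + of_A c)
      = (\<Prod>c\<in>polys_below D - {0}. (1 + x / of_A c) * of_A c)"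
    by (intro prod.cong) (auto simp: field_simps)
  finally show ?thesis by (simp add: prod.distrib fin_exp_alt)
qed

lemma prod_nonzero_polys_below: "(\<Prod>c\<in>polys_below D - {0}. of_A (c :: 'a poly)) \<noteq> 0"
  by (simp add: finite_polys_below)

lemma prod_polys_below_shift:
  assumes "c0 \<in> polys_below D"
  shows "(\<Prod>c\<in>polys_below D. f (c + c0)) = (\<Prod>c\<in>polys_below D. f (c :: 'a poly))"
  by (rule prod.reindex_bij_witness[of _ "\<lambda>c. c - c0" "\<lambda>c. c + c0"])
     (use assms in \<open>auto intro: add_in_polys_below diff_in_polys_below\<close>)

lemma card_polys_below_pos: "card (polys_below D :: 'a poly set) > 0"
  using finite_polys_below zero_in_polys_below by (metis card_gt_0_iff empty_iff)

lemma card_of_A_image: "card (of_A ` B) = card B"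
  by (simp add: card_image inj_on_def)

lemma linear_prod_poly:
  fixes y :: 'c and B :: "'a poly set"
  assumes "finite B"
  defines "f \<equiv> (\<Prod>c\<in>B. [:y + of_A c, 1:])"
  shows "degree f = card B" "lead_coeff f = 1" "poly f x = (\<Prod>c\<in>B. x + y + of_A c)"
proof -
  have "degree f = (\<Sum>c\<in>B. degree [:y + of_A c, 1:])"
    unfolding f_def by (rule degree_prod_eq_sum_degree) simp
  then show "degree f = card B" by simp
  show "lead_coeff f = 1" unfolding f_def lead_coeff_prod by simp
  show "poly f x = (\<Prod>c\<in>B. x + y + of_A c)" by (simp add: f_def poly_prod algebra_simps)
qed

text \<open>
  The two sides, as polynomials in \<open>x\<close>, are monic of the same degree and agree at the
  elements of the additive group that is divided out.
\<close>

lemma fin_exp_add: "fin_exp D (x + y) = fin_exp D x + fin_exp D y"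
proof -
  let ?B = "polys_below D :: 'a poly set"
  let ?f = "\<Prod>c\<in>?B. [:y + of_A c, 1:]"
  let ?h = "\<Prod>c\<in>?B. [:0 + of_A c, 1:]"
  let ?k = "[:\<Prod>c\<in>?B. y + of_A c:]"
  note f = linear_prod_poly[OF finite_polys_below[of D], where y = y]
  note h = linear_prod_poly[OF finite_polys_below[of D], where y = 0]
  have pos: "card ?B > 0" by (rule card_polys_below_pos)
  have "?f = ?h + ?k"
  proof (rule poly_eqI_degree_lead_coeff[of _ "card ?B" _ "of_A ` ?B"])
    show "coeff ?f (card ?B) = coeff (?h + ?k) (card ?B)"
      using f(1,2) h(1,2) pos by (simp add: coeff_eq_0)
    fix x assume "x \<in> of_A ` ?B"
    then obtain c0 where c0: "c0 \<in> ?B" "x = of_A c0" by auto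
    have "(\<Prod>c\<in>?B. x + y + of_A c) = (\<Prod>c\<in>?B. y + of_A (c + c0))"
      by (simp add: c0 of_A_add algebra_simps)
    also have "\<dots> = (\<Prod>c\<in>?B. y + of_A c)"
      by (rule prod_polys_below_shift[OF c0(1)])
    finally have "poly ?f x = (\<Prod>c\<in>?B. y + of_A c)" by (simp only: f(3))
    moreover have "poly ?h x = 0"
      unfolding h(3) using c0 finite_polys_below
      by (auto simp: of_A_minus uminus_in_polys_below intro!: prod_zero bexI[of _ "- c0"])
    ultimately show "poly ?f x = poly (?h + ?k) x" by simp
  next
    show "degree ?f \<le> card ?B" using f(1) by simp
    show "degree (?h + ?k) \<le> card ?B"
      using h(1) pos by (intro degree_add_le) auto
    show "card ?B \<le> card (of_A ` ?B)" by (simp add: card_of_A_image)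
  qed
  then have "poly ?f x = poly ?h x + poly ?k x" by simp
  then have "(\<Prod>c\<in>?B. (x + y) + of_A c) = (\<Prod>c\<in>?B. x + of_A c) + (\<Prod>c\<in>?B. y + of_A c)"
    by (simp only: f(3) h(3)) simp
  then show ?thesis
    unfolding prod_add_polys_below distrib_right[symmetric]
    using prod_nonzero_polys_below[of D] by simp
qed

text \<open>
  The partial fraction expansion. Its numerator over the common denominator, the derivative of the
  additive polynomial, takes the same value at all its zeros by translation and has smaller degree
  than their number, so it is constant.
\<close>

lemma recip_sum_eq:
  assumes "\<And>c. c \<in> polys_below D \<Longrightarrow> x + of_A c \<noteq> 0"
  shows "recip_sum D x = 1 / fin_exp D x"
proof -
  let ?B = "polys_below D :: 'a poly set"
  let ?k = "\<Prod>c\<in>?B - {0}. of_A c"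
  let ?f = "\<Sum>b\<in>?B. \<Prod>c\<in>?B - {b}. [:0 + of_A c, 1:]"
  note fin = finite_polys_below[where ?'a = 'a, of D]
  have pos: "card ?B > 0" by (rule card_polys_below_pos)
  note h = linear_prod_poly[where y = 0]
  have "?f = [:?k:]"
  proof (rule poly_eqI_degree[of "(\<lambda>c. - of_A c) ` ?B"])
    have "degree (\<Prod>c\<in>?B - {b}. [:0 + of_A c, 1:]) \<le> card ?B - 1" if "b \<in> ?B" for b
      using that fin by (subst h(1)) auto
    then have "degree ?f \<le> card ?B - 1"
      by (intro degree_sum_le) (use fin in auto)
    moreover have card: "card ((\<lambda>c. - of_A c) ` ?B) = card ?B"
      by (simp add: card_image inj_on_def)
    ultimately show "degree ?f < card ((\<lambda>c. - of_A c) ` ?B)" using pos by simp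
    show "degree [:?k:] < card ((\<lambda>c. - of_A c) ` ?B)" using pos card by simp
    fix x assume "x \<in> (\<lambda>c. - of_A c) ` ?B"
    then obtain b0 where b0: "b0 \<in> ?B" "x = - of_A b0" by auto
    have "poly ?f x = (\<Sum>b\<in>?B. \<Prod>c\<in>?B - {b}. x + of_A c)"
      using fin by (simp add: poly_sum poly_prod add.commute)
    also have "\<dots> = (\<Sum>b\<in>?B. if b = b0 then \<Prod>c\<in>?B - {b0}. x + of_A c else 0)"
    proof (intro sum.cong refl)
      fix b assume "b \<in> ?B"
      show "(\<Prod>c\<in>?B - {b}. x + of_A c) = (if b = b0 then \<Prod>c\<in>?B - {b0}. x + of_A c else 0)"
        using b0 fin by (cases "b = b0") (auto intro!: prod_zero bexI[of _ b0])
    qed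
    also have "\<dots> = (\<Prod>c\<in>?B - {b0}. x + of_A c)" using fin b0 by simp
    also have "\<dots> = ?k"
      by (rule prod.reindex_bij_witness[of _ "\<lambda>c. c + b0" "\<lambda>c. c - b0"])
         (use b0 in \<open>auto simp: of_A_diff intro: add_in_polys_below diff_in_polys_below\<close>)
    finally show "poly ?f x = poly [:?k:] x" by simp
  qed
  then have "poly ?f x = ?k" by simp
  then have "?k = (\<Sum>b\<in>?B. \<Prod>c\<in>?B - {b}. x + of_A c)"
    using fin by (simp add: poly_sum poly_prod add.commute)
  also have "\<dots> = (\<Sum>b\<in>?B. (\<Prod>c\<in>?B. x + of_A c) * (1 / (x + of_A b)))"
    using assms fin by (intro sum.cong refl) (simp add: prod.remove)
  also have "\<dots> = (\<Prod>c\<in>?B. x + of_A c) * recip_sum D x"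
    by (simp add: recip_sum_def sum_distrib_left)
  finally have "?k = ?k * (fin_exp D x * recip_sum D x)"
    by (simp add: prod_add_polys_below mult_ac)
  then have "fin_exp D x * recip_sum D x = 1"
    using prod_nonzero_polys_below[of D] by simp
  then show ?thesis by (metis nonzero_eq_divide_eq mult_zero_left mult.commute zero_neq_one)
qed

lemma fin_exp_of_A:
  assumes "a \<in> polys_below D"
  shows "fin_exp D (of_A a) = 0"
proof -
  have "(\<Prod>c\<in>polys_below D. of_A a + of_A c) = 0"
    using assms finite_polys_below
    by (auto simp: of_A_minus uminus_in_polys_below intro!: prod_zero bexI[of _ "- a"])
  then show ?thesis
    using prod_nonzero_polys_below[of D] by (simp add: prod_add_polys_below)
qed

text \<open>
  By translation one may assume that \<open>x\<close> is a shortest element of its class. Then every factor of the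
  product has absolute value at least \<open>1\<close>, and the factor at \<open>c = 1\<close> contributes another
  \<open>|x|\<close>. This quadratic growth is what makes all series below converge.
\<close>

lemma nv_fin_exp_ge:
  assumes "D \<ge> 1" "\<delta> \<ge> 0" "\<And>c. c \<in> polys_below D \<Longrightarrow> nv (x + of_A c) \<ge> \<delta>"
  shows "nv (fin_exp D x) \<ge> \<delta>\<^sup>2"
proof -
  let ?B = "polys_below D :: 'a poly set"
  have "finite ?B" "?B \<noteq> {}" using finite_polys_below zero_in_polys_below[of D] by blast+
  then obtain b where b: "b \<in> ?B" "\<And>c. c \<in> ?B \<Longrightarrow> nv (x + of_A b) \<le> nv (x + of_A c)"
    using arg_min_if_finite(1) arg_min_least[of ?B _ "\<lambda>b. nv (x + of_A b)"] by blast
  define y where "y = x + of_A b"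
  have y: "nv y \<le> nv (y + of_A c)" if "c \<in> ?B" for c
    using b(2)[of "b + c"] b(1) that by (auto simp: y_def of_A_add add_in_polys_below add_ac)
  have fac: "nv (1 + y / of_A c) = nv (y + of_A c) / nv (of_A c)" if "c \<noteq> 0" for c
    using that by (simp add: nv_divide[symmetric] field_simps)
  have fac_ge: "nv (1 + y / of_A c) \<ge> 1" if "c \<in> ?B" "c \<noteq> 0" for c
  proof -
    have "nv (of_A c) \<le> max (nv (y + of_A c)) (nv y)" using nv_diff_le[of "y + of_A c" y] by simp
    also have "\<dots> = nv (y + of_A c)" using y[OF that(1)] by simp
    finally show ?thesis using that by (simp add: fac)
  qed
  have one: "1 \<in> ?B - {0}" using one_in_polys_below[OF assms(1)] by auto
  have "nv y \<le> nv (1 + y / of_A 1)" using y[of 1] one by (simp add: add.commute)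
  also have "\<dots> \<le> nv (1 + y / of_A 1) * (\<Prod>c\<in>?B - {0} - {1}. nv (1 + y / of_A c))"
  proof -
    have "1 \<le> (\<Prod>c\<in>?B - {0} - {1}. nv (1 + y / of_A c))"
      by (rule prod_ge_1) (use fac_ge in auto)
    then show ?thesis using mult_left_mono[of 1 _ "nv (1 + y / of_A 1)"] by simp
  qed
  also have "\<dots> = (\<Prod>c\<in>?B - {0}. nv (1 + y / of_A c))"
    by (rule prod.remove[symmetric]) (use one finite_polys_below in auto)
  finally have "nv y * nv y \<le> nv (fin_exp D y)"
    unfolding fin_exp_alt abs_mult nv_prod by (intro mult_left_mono) auto
  moreover have "fin_exp D y = fin_exp D x"
    using b(1) by (simp add: y_def fin_exp_add fin_exp_of_A)
  moreover have "\<delta> * \<delta> \<le> nv y * nv y"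
    using assms(2) assms(3)[OF b(1)] by (intro mult_mono) (auto simp: y_def)
  ultimately show ?thesis by (simp add: power2_eq_square)
qed

subsection \<open>Distance from \<open>K_\<infinity>\<close>\<close>

lemma far_affine:
  assumes "far \<delta> x" "\<alpha> \<noteq> 0"
  shows "far (abs_Kinf \<alpha> * \<delta>) (of_Kinf \<alpha> * x + of_Kinf \<beta>)"
  unfolding far_def
proof
  fix \<xi>
  have "of_Kinf \<alpha> * x + of_Kinf \<beta> - of_Kinf \<xi> = of_Kinf \<alpha> * (x - of_Kinf ((\<xi> - \<beta>) / \<alpha>))"
    using assms(2) by (simp add: of_Kinf_divide of_Kinf_diff field_simps)
  then have "nv (of_Kinf \<alpha> * x + of_Kinf \<beta> - of_Kinf \<xi>)
      = abs_Kinf \<alpha> * nv (x - of_Kinf ((\<xi> - \<beta>) / \<alpha>))"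
    by (simp add: abs_mult nv_of_Kinf)
  also have "\<dots> \<ge> abs_Kinf \<alpha> * \<delta>"
    using assms(1) by (intro mult_left_mono) (auto simp: far_def abs_Kinf_def)
  finally show "abs_Kinf \<alpha> * \<delta> \<le> nv (of_Kinf \<alpha> * x + of_Kinf \<beta> - of_Kinf \<xi>)" .
qed

lemma far_add: "far \<delta> x \<Longrightarrow> far \<delta> (x + of_Kinf \<beta>)"
  using far_affine[of \<delta> x 1 \<beta>] by (simp add: abs_Kinf_def)

lemma far_mult: "far \<delta> x \<Longrightarrow> a \<noteq> 0 \<Longrightarrow> far (nv (of_A a) * \<delta>) (of_A a * x)"
  using far_affine[of \<delta> x "Kinf_of_A a" 0] by (simp add: of_A_def nv_of_Kinf)

lemma far_divide: "far \<delta> x \<Longrightarrow> a \<noteq> 0 \<Longrightarrow> far (\<delta> / nv (of_A a)) (x / of_A a)"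
  using far_affine[of \<delta> x "1 / Kinf_of_A a" 0]
  by (simp add: of_Kinf_divide nv_of_Kinf[symmetric] nv_divide of_A_def)

lemma far_add_of_A: "far \<delta> x \<Longrightarrow> nv (x + of_A c) \<ge> \<delta>"
  unfolding far_def
  by (metis diff_minus_eq_add of_A_def of_Kinf_minus)

lemma far_add_of_A_neq_0: "far \<delta> x \<Longrightarrow> \<delta> > 0 \<Longrightarrow> x + of_A c \<noteq> 0"
  using far_add_of_A[of \<delta> x c] by auto

lemma nv_fin_exp_far:
  assumes "far \<delta> x" "\<delta> > 0" "D \<ge> 1"
  shows "nv (fin_exp D x) \<ge> \<delta>\<^sup>2"
  using assms by (intro nv_fin_exp_ge) (auto intro: far_add_of_A)

lemma recip_sum_far:
  assumes "far \<delta> x" "\<delta> > 0"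
  shows "recip_sum D x = 1 / fin_exp D x"
  by (rule recip_sum_eq) (use assms far_add_of_A_neq_0 in auto)

lemma nv_recip_sum_le:
  assumes "far \<delta> x" "\<delta> > 0" "D \<ge> 1"
  shows "nv (recip_sum D x) \<le> 1 / \<delta>\<^sup>2"
proof -
  have "nv (recip_sum D x) = 1 / nv (fin_exp D x)"
    using assms by (simp add: recip_sum_far nv_divide)
  also have "\<dots> \<le> 1 / \<delta>\<^sup>2"
    using nv_fin_exp_far[OF assms] assms(2) by (intro divide_left_mono mult_pos_pos) (auto intro: less_le_trans)
  finally show ?thesis .
qed

lemma nv_recip_sum_diff_le:
  assumes "nv x < real CARD('a) ^ N" "D \<ge> N" "D' \<ge> N"
  shows "nv (recip_sum D x - recip_sum D' x) \<le> 1 / real CARD('a) ^ N"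
proof -
  have *: "nv (recip_sum D x - recip_sum N x) \<le> 1 / real CARD('a) ^ N" if "D \<ge> N" for D
  proof -
    have "recip_sum D x - recip_sum N x = (\<Sum>c\<in>polys_below D - polys_below N. 1 / (x + of_A c))"
      unfolding recip_sum_def
      using sum.subset_diff[OF polys_below_mono[OF that] finite_polys_below,
          of "\<lambda>c. 1 / (x + of_A c)"] by simp
    also have "nv \<dots> \<le> 1 / real CARD('a) ^ N"
    proof (rule nv_sum_le)
      fix c :: "'a poly" assume "c \<in> polys_below D - polys_below N"
      then have c: "nv (of_A c) \<ge> real CARD('a) ^ N" by (intro nv_of_A_ge) auto
      then have "nv (x + of_A c) = nv (of_A c)"
        using assms(1) nv_add_eq[of x "of_A c"] by (simp add: add.commute)
      with c show "nv (1 / (x + of_A c)) \<le> 1 / real CARD('a) ^ N"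
        by (simp add: nv_divide frac_le)
    qed auto
    finally show ?thesis .
  qed
  from nv_diff_leI[OF *[OF assms(2)] *[OF assms(3)]] show ?thesis by simp
qed

text \<open>
  Split off the constant coefficient and expand binomially. Every term with a smaller exponent is a
  power sum over one dimension less and vanishes by induction; the remaining term does not depend
  on the constant coefficient, so it occurs \<open>q\<close> times.
\<close>

lemma power_sum_eq_0:
  fixes L :: "'a poly \<Rightarrow> 'c"
  assumes "\<And>p p'. L (p + p') = L p + L p'" "i < d"
  shows "(\<Sum>p\<in>polys_below d. (\<beta> + L p) ^ i) = 0"
  using assms
proof (induction d arbitrary: L i \<beta>)
  case (Suc d)
  define L' where "L' p = L (pCons 0 p)" for p
  have L'_add: "L' (p + p') = L' p + L' p'" for p p'
    using Suc.prems(1)[of "pCons 0 p" "pCons 0 p'"] by (simp add: L'_def)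
  have L_pCons: "L (pCons c p) = L [:c:] + L' p" for c p
    using Suc.prems(1)[of "[:c:]" "pCons 0 p"] by (simp add: L'_def)
  define S where "S = (\<Sum>p\<in>polys_below d. L' p ^ i)"
  have S: "(\<Sum>p\<in>polys_below d. (\<gamma> + L' p) ^ i) = S" for \<gamma>
  proof -
    have "(\<Sum>p\<in>polys_below d. (\<gamma> + L' p) ^ i)
        = (\<Sum>k\<le>i. of_nat (i choose k) * \<gamma> ^ k * (\<Sum>p\<in>polys_below d. L' p ^ (i - k)))"
      unfolding binomial_ring sum_distrib_left by (rule sum.swap)
    also have "\<dots> = (\<Sum>k\<in>{0}. of_nat (i choose k) * \<gamma> ^ k * (\<Sum>p\<in>polys_below d. L' p ^ (i - k)))"
    proof (rule sum.mono_neutral_right)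
      show "\<forall>k\<in>{..i} - {0}. of_nat (i choose k) * \<gamma> ^ k * (\<Sum>p\<in>polys_below d. L' p ^ (i - k)) = 0"
      proof
        fix k assume "k \<in> {..i} - {0}"
        then have "i - k < d" using Suc.prems(2) by auto
        from Suc.IH[of L', OF L'_add this, of 0]
        show "of_nat (i choose k) * \<gamma> ^ k * (\<Sum>p\<in>polys_below d. L' p ^ (i - k)) = 0" by simp
      qed
    qed auto
    finally show ?thesis by (simp add: S_def)
  qed
  have "(\<Sum>p\<in>polys_below (Suc d). (\<beta> + L p) ^ i)
      = (\<Sum>c\<in>UNIV. \<Sum>p\<in>polys_below d. ((\<beta> + L [:c:]) + L' p) ^ i)"
    unfolding sum_polys_below_Suc by (intro sum.cong refl) (subst L_pCons, simp add: add.assoc)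
  also have "\<dots> = of_nat CARD('a) * S" by (simp only: S) simp
  finally show ?case by (simp add: q_eq_0)
qed auto

lemma power_tendsto_at_top: "\<exists>N. x < real CARD('a) ^ N"
  using real_arch_pow[OF q_gt_1] by blast

end

context carlitz_period
begin

text \<open>
  The exponential function rescaled to the lattice \<open>A\<close> and to derivative \<open>1\<close> at \<open>0\<close>. Its
  reciprocal \<open>recip x\<close> is the sum of \<open>1 / (x + c)\<close> over all \<open>c\<close> in \<open>A\<close>, and it is the parameter
  \<open>u\<close> at the cusp up to the factor \<open>per\<close>.
\<close>

definition lat_exp :: "'c \<Rightarrow> 'c" where
  "lat_exp x = lattice_exp (range (\<lambda>a. per * of_A a)) (per * x) / per"

definition recip :: "'c \<Rightarrow> 'c" where
  "recip x = per * u x"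

lemma recip_eq: "recip x = 1 / lat_exp x"
  using per_nonzero by (simp add: recip_def u_def lat_exp_def)

text \<open>
  The unordered product defining the exponential function converges, and its value can be
  computed along the exhaustion of \<open>A\<close> by degree: a factor with \<open>|c| > |x|\<close> is close to \<open>1\<close>.
\<close>

lemma fin_exp_tendsto: "(\<lambda>D. fin_exp D x) \<longlonglongrightarrow> lat_exp x"
proof -
  define pr where "pr F = (\<Prod>c\<in>F. 1 - x / of_A c)" for F :: "'a poly set"
  define B where "B D = (polys_below D :: 'a poly set) - {0}" for D
  define Q where "Q N = nv x / real CARD('a) ^ N" for N :: nat
  have Q_pos: "Q N \<ge> 0" for N using q_gt_1 by (simp add: Q_def)
  have Q_lim: "\<exists>N. \<forall>n\<ge>N. Q n < e" if "e > 0" for e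
  proof -
    obtain N where N: "nv x / e < real CARD('a) ^ N" using power_tendsto_at_top by blast
    have "Q n < e" if "n \<ge> N" for n
    proof -
      have "real CARD('a) ^ N \<le> real CARD('a) ^ n"
        using that q_gt_1 by (intro power_increasing) auto
      with N have "nv x / e < real CARD('a) ^ n" by simp
      then show ?thesis using \<open>e > 0\<close> q_gt_1 by (simp add: Q_def field_simps)
    qed
    then show ?thesis by blast
  qed
  have finB: "finite (B D)" for D by (simp add: B_def finite_polys_below)
  have B_mono: "B D \<subseteq> B D'" if "D \<le> D'" for D D'
    using polys_below_mono[OF that] by (auto simp: B_def)
  have close: "nv (pr F - 1) \<le> Q N" if "finite F" "F \<inter> polys_below N = {}" "Q N \<le> 1" for F N
    unfolding pr_def
  proof (rule nv_prod_minus_one_le)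
    fix c assume "c \<in> F"
    then have "c \<notin> polys_below N" using that(2) by auto
    then have "nv (of_A c) \<ge> real CARD('a) ^ N" by (rule nv_of_A_ge)
    then have "nv (x / of_A c) \<le> Q N"
      unfolding nv_divide Q_def using q_gt_1 by (intro frac_le) auto
    then show "nv (1 - x / of_A c - 1) \<le> Q N" by simp
  qed (use that Q_pos in auto)
  obtain M where M: "\<forall>n\<ge>M. Q n < 1" using Q_lim[of 1] by auto
  define K where "K = nv (pr (B M))"
  have split: "pr F = pr (B N) * pr (F - B N)" if "finite F" "B N \<subseteq> F" for F N
    unfolding pr_def using prod.subset_diff[OF that(2,1)] by (simp add: mult.commute)
  \<comment> \<open>All further factors have absolute value 1, so the partial products are bounded.\<close>
  have K: "nv (pr F) = K" if "finite F" "B M \<subseteq> F" "0 \<notin> F" for F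
  proof -
    have "nv (pr (F - B M) - 1) \<le> Q M"
      by (rule close) (use that M in \<open>auto simp: B_def intro: less_imp_le\<close>)
    then have "nv (pr (F - B M) - 1) < nv 1" using M by force
    then have "nv (1 + (pr (F - B M) - 1)) = 1" using nv_add_eq by fastforce
    then show ?thesis using split[OF that(1,2)] by (simp add: abs_mult K_def)
  qed
  have diff: "nv (pr F - pr (B N)) \<le> K * Q N"
    if "finite F" "B N \<subseteq> F" "0 \<notin> F" "N \<ge> M" for F N
  proof -
    have "pr F - pr (B N) = pr (B N) * (pr (F - B N) - 1)"
      using split[OF that(1,2)] by (simp add: algebra_simps)
    then have "nv (pr F - pr (B N)) = nv (pr (B N)) * nv (pr (F - B N) - 1)" by (simp add: abs_mult)
    also have "nv (pr (B N)) = K"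
      using that(4) by (intro K finB B_mono) (auto simp: B_def)
    also have "nv (pr (F - B N) - 1) \<le> Q N"
      by (rule close) (use that M in \<open>auto simp: B_def intro: less_imp_le\<close>)
    finally show ?thesis by (simp add: K_def mult_left_mono)
  qed
  have small: "\<exists>N\<ge>M. \<forall>n\<ge>N. K * Q n \<le> e" if "e > 0" for e
  proof -
    have K1: "K + 1 > 0" by (simp add: K_def add_nonneg_pos)
    then obtain N where N: "\<forall>n\<ge>N. Q n < e / (K + 1)" using Q_lim[of "e / (K + 1)"] divide_pos_pos[OF \<open>e > 0\<close> K1] by blast
    have "K * Q n \<le> e" if "n \<ge> N" for n
    proof -
      have "(K + 1) * Q n \<le> e" using N that K1 by (simp add: pos_less_divide_eq mult.commute less_imp_le)
      then show ?thesis using Q_pos[of n] by (simp add: algebra_simps)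
    qed
    then show ?thesis by (intro exI[of _ "max M N"]) auto
  qed
  have "\<exists>l. (\<lambda>D. pr (B D)) \<longlonglongrightarrow> l"
  proof (rule convergent_nv_Cauchy)
    fix e :: real assume "e > 0"
    then obtain N where N: "N \<ge> M" "K * Q N \<le> e" using small by blast
    have "nv (pr (B n) - pr (B N)) \<le> e" if "n \<ge> N" for n
      using diff[of "B n" N] finB B_mono[OF that] N by (auto simp: B_def)
    then have "nv (pr (B m) - pr (B n)) \<le> e" if "m \<ge> N" "n \<ge> N" for m n
      using nv_diff_leI[of "pr (B m) - pr (B N)" e "pr (B n) - pr (B N)"] that by simp
    then show "\<exists>N. \<forall>m\<ge>N. \<forall>n\<ge>N. nv (pr (B m) - pr (B n)) \<le> e" by blast
  qed
  then obtain l where l: "(\<lambda>D. pr (B D)) \<longlonglongrightarrow> l" by blast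
  define L where "L = range (\<lambda>a. per * of_A (a :: 'a poly))"
  define g where "g a = per * of_A a" for a :: "'a poly"
  have inj: "inj g" using per_nonzero by (auto simp: inj_def g_def)
  have img: "(\<Prod>w\<in>g ` F. 1 - per * x / w) = pr F" for F
    unfolding pr_def using inj per_nonzero
    by (subst prod.reindex) (auto intro: inj_on_subset simp: g_def)
  have "((\<lambda>F. \<Prod>w\<in>F. 1 - per * x / w) \<longlongrightarrow> l) (finite_subsets_at_top (L - {0}))"
    unfolding tendsto_iff_nv
  proof (intro allI impI)
    fix e :: real assume "e > 0"
    then obtain N0 where N0: "N0 \<ge> M" "\<forall>n\<ge>N0. K * Q n \<le> e / 2" using small[of "e / 2"] by auto
    obtain N1 where N1: "\<forall>n\<ge>N1. nv (pr (B n) - l) < e"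
      using l \<open>e > 0\<close> unfolding tendsto_iff_nv eventually_sequentially by blast
    define N where "N = max N0 N1"
    show "\<forall>\<^sub>F F in finite_subsets_at_top (L - {0}). nv ((\<Prod>w\<in>F. 1 - per * x / w) - l) < e"
      unfolding eventually_finite_subsets_at_top
    proof (intro exI[of _ "g ` B N"] conjI allI impI)
      show "finite (g ` B N)" using finB by simp
      show "g ` B N \<subseteq> L - {0}" using per_nonzero by (auto simp: g_def L_def B_def)
      fix Y assume Y: "finite Y \<and> g ` B N \<subseteq> Y \<and> Y \<subseteq> L - {0}"
      define F where "F = g -` Y"
      have "Y \<subseteq> range g" using Y by (auto simp: L_def g_def)
      then have YF: "Y = g ` F" by (auto simp: F_def)
      have F: "finite F" "B N \<subseteq> F" "0 \<notin> F"
        using Y inj by (auto simp: F_def g_def finite_vimageI)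
      have "nv (pr F - pr (B N)) < e"
      proof -
        have "nv (pr F - pr (B N)) \<le> K * Q N"
          by (rule diff[OF F]) (use N0(1) in \<open>simp add: N_def\<close>)
        also have "\<dots> \<le> e / 2" using N0(2) by (simp add: N_def)
        finally show ?thesis using \<open>e > 0\<close> by simp
      qed
      moreover have "nv (pr (B N) - l) < e" using N1 by (simp add: N_def)
      ultimately have "nv (pr F - l) < e"
        using abs_ultrametric[of "pr F - pr (B N)" "pr (B N) - l"] by simp
      then show "nv ((\<Prod>w\<in>Y. 1 - per * x / w) - l) < e" by (simp add: YF img)
    qed
  qed
  then have "Lim (finite_subsets_at_top (L - {0})) (\<lambda>F. \<Prod>w\<in>F. 1 - per * x / w) = l"
    by (intro tendsto_Lim) auto
  then have "lat_exp x = x * l"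
    using per_nonzero by (simp add: lat_exp_def lattice_exp_def L_def)
  moreover have "fin_exp D x = x * pr (B D)" for D
    by (simp add: fin_exp_def pr_def B_def)
  ultimately show ?thesis using lim_mult_const[OF l, of x] by simp
qed

lemma lat_exp_add: "lat_exp (x + y) = lat_exp x + lat_exp y"
proof (rule LIMSEQ_unique)
  show "(\<lambda>D. fin_exp D (x + y)) \<longlonglongrightarrow> lat_exp (x + y)" by (rule fin_exp_tendsto)
  show "(\<lambda>D. fin_exp D (x + y)) \<longlonglongrightarrow> lat_exp x + lat_exp y"
    unfolding fin_exp_add by (intro lim_add fin_exp_tendsto)
qed

lemma lat_exp_of_A [simp]: "lat_exp (of_A a) = 0"
proof (rule LIMSEQ_unique)
  show "(\<lambda>D. fin_exp D (of_A a)) \<longlonglongrightarrow> lat_exp (of_A a)" by (rule fin_exp_tendsto)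
  have "\<forall>\<^sub>F D in sequentially. fin_exp D (of_A a) = 0"
    unfolding eventually_sequentially
    by (intro exI[of _ "Suc (degree a)"]) (auto simp: fin_exp_of_A polys_below_iff_degree)
  then show "(\<lambda>D. fin_exp D (of_A a)) \<longlonglongrightarrow> 0" by (rule tendsto_eventually)
qed

text \<open>
  Subtracting its polynomial part moves an element of \<open>K_\<infinity>\<close> into the open unit disc, where all
  factors of the exponential product have absolute value \<open>1\<close>.
\<close>

lemma nv_lat_exp_of_Kinf_le: "nv (lat_exp (of_Kinf \<xi>)) \<le> 1"
proof -
  define a where "a = fls_prpart \<xi> + [:fls_nth \<xi> 0:]"
  \<comment> \<open>\<open>fls_prpart\<close> keeps the strictly positive powers of \<open>T\<close>; adding the constant term gives the polynomial part.\<close>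
  define \<eta> where "\<eta> = \<xi> - Kinf_of_A a"
  have "coeff a n = fls_nth \<xi> (- int n)" for n
    by (cases n) (auto simp: a_def)
  then have "fls_nth \<eta> k = 0" if "k < 1" for k
    using that by (simp add: \<eta>_def Kinf_of_A_nth)
  then have "\<eta> = 0 \<or> fls_subdegree \<eta> \<ge> 1" by (metis fls_subdegree_geI)
  moreover have "real CARD('a) powi (- fls_subdegree \<eta>) < 1" if "fls_subdegree \<eta> \<ge> 1"
    using that q_gt_1 by (simp add: power_int_minus power_int_def inverse_eq_divide power_less_one_iff)
  ultimately have \<eta>: "nv (of_Kinf \<eta>) < 1"
    by (auto simp: nv_of_Kinf abs_Kinf_def)
  have "nv (fin_exp D (of_Kinf \<eta>)) \<le> 1" for D
  proof -
    have "nv (1 - of_Kinf \<eta> / of_A c) = 1" if "c \<noteq> 0" for c :: "'a poly"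
    proof -
      have "nv (- (of_Kinf \<eta> / of_A c)) < nv 1"
        using \<eta> nv_of_A_ge_1[OF that] by (simp add: nv_divide divide_less_eq)
      from nv_add_eq[OF this] show ?thesis by simp
    qed
    then have "nv (fin_exp D (of_Kinf \<eta>)) = nv (of_Kinf \<eta>)"
      by (simp add: fin_exp_def abs_mult nv_prod)
    with \<eta> show ?thesis by simp
  qed
  then have "nv (lat_exp (of_Kinf \<eta>)) \<le> 1"
    by (intro lim_nv_le[OF fin_exp_tendsto]) auto
  moreover have "of_Kinf \<xi> = of_Kinf \<eta> + of_A a"
    by (simp add: \<eta>_def of_Kinf_diff of_A_def)
  ultimately show ?thesis by (simp add: lat_exp_add)
qed

lemma nv_lat_exp_far:
  assumes "far \<delta> x" "\<delta> > 0"
  shows "nv (lat_exp x) \<ge> \<delta>\<^sup>2"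
proof (rule tendsto_lowerbound[OF lim_nv[OF fin_exp_tendsto]])
  show "\<forall>\<^sub>F D in sequentially. \<delta>\<^sup>2 \<le> nv (fin_exp D x)"
    unfolding eventually_sequentially using nv_fin_exp_far[OF assms] by blast
qed simp

lemma lat_exp_far_neq_0: "far \<delta> x \<Longrightarrow> \<delta> > 0 \<Longrightarrow> lat_exp x \<noteq> 0"
  using nv_lat_exp_far[of \<delta> x] by auto

lemma nv_recip_le: "far \<delta> x \<Longrightarrow> \<delta> > 0 \<Longrightarrow> nv (recip x) \<le> 1 / \<delta>\<^sup>2"
  using nv_lat_exp_far[of \<delta> x]
  by (simp add: recip_eq nv_divide frac_le)

lemma recip_sum_tendsto:
  assumes "far \<delta> x" "\<delta> > 0"
  shows "(\<lambda>D. recip_sum D x) \<longlonglongrightarrow> recip x"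
  unfolding recip_sum_far[OF assms] recip_eq
  by (intro lim_inverse fin_exp_tendsto lat_exp_far_neq_0[OF assms])

lemma recip_add_of_A: "recip (x + of_A a) = recip x"
  by (simp add: recip_eq lat_exp_add)

text \<open>
  The sum over \<open>A\<close> is split into the residue classes modulo \<open>s\<close>.
\<close>

lemma recip_distribution:
  assumes "far \<delta> x" "\<delta> > 0" "s \<noteq> 0"
  shows "recip x = (\<Sum>r\<in>polys_below (degree s). recip ((x + of_A r) / of_A s)) / of_A s"
proof (rule LIMSEQ_unique)
  have s: "of_A s \<noteq> 0" using assms(3) by simp
  have "recip_sum (D + degree s) x
      = (1 / of_A s) * (\<Sum>r\<in>polys_below (degree s). recip_sum D ((x + of_A r) / of_A s))" for D
  proof -
    have "recip_sum (D + degree s) x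
        = (\<Sum>r\<in>polys_below (degree s). \<Sum>t\<in>polys_below D. 1 / (x + of_A (r + s * t)))"
      unfolding recip_sum_def by (rule sum_polys_below_division[OF assms(3)])
    also have "\<dots> = (\<Sum>r\<in>polys_below (degree s). \<Sum>t\<in>polys_below D.
        (1 / of_A s) * (1 / ((x + of_A r) / of_A s + of_A t)))"
      using s by (intro sum.cong refl) (simp add: of_A_add of_A_mult field_simps)
    finally show ?thesis by (simp only: recip_sum_def sum_distrib_left)
  qed
  moreover have "(\<lambda>D. recip_sum (D + degree s) x) \<longlonglongrightarrow> recip x"
    by (rule LIMSEQ_ignore_initial_segment[OF recip_sum_tendsto[OF assms(1,2)]])
  ultimately show "(\<lambda>D. (1 / of_A s) * (\<Sum>r\<in>polys_below (degree s).
      recip_sum D ((x + of_A r) / of_A s))) \<longlonglongrightarrow> recip x" by simp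
  have "far (\<delta> / nv (of_A s)) ((x + of_A r) / of_A s)" for r
    using far_divide[OF far_add[OF assms(1)] assms(3)] by (simp add: of_A_def)
  then have "(\<lambda>D. (1 / of_A s) * (\<Sum>r\<in>polys_below (degree s). recip_sum D ((x + of_A r) / of_A s)))
      \<longlonglongrightarrow> (1 / of_A s) * (\<Sum>r\<in>polys_below (degree s). recip ((x + of_A r) / of_A s))"
    using assms(2) s by (intro lim_mult_const lim_sum recip_sum_tendsto[of "\<delta> / nv (of_A s)"]) auto
  then show "(\<lambda>D. (1 / of_A s) * (\<Sum>r\<in>polys_below (degree s). recip_sum D ((x + of_A r) / of_A s)))
      \<longlonglongrightarrow> (\<Sum>r\<in>polys_below (degree s). recip ((x + of_A r) / of_A s)) / of_A s"
    by simp
qed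

end

section \<open>The false Eisenstein series\<close>

context completed_alg_closure
begin

lemma abs_Kinf_le:
  fixes y :: "'a fls"
  assumes "\<And>i. i \<le> int n \<Longrightarrow> fls_nth y i = 0"
  shows "abs_Kinf y \<le> 1 / real CARD('a) ^ n"
proof (cases "y = 0")
  case False
  then have "fls_nth y (fls_subdegree y) \<noteq> 0" by simp
  then have "fls_subdegree y \<ge> int n" using assms[of "fls_subdegree y"] by linarith
  then have "real CARD('a) powi (- fls_subdegree y) \<le> real CARD('a) powi (- int n)"
    using q_gt_1 by (intro power_int_increasing) auto
  then show ?thesis
    using False by (simp add: abs_Kinf_def power_int_minus inverse_eq_divide)
qed (simp add: abs_Kinf_def)

lemma fls_nth_eq_0_of_abs_Kinf_less:
  fixes y :: "'a fls"
  assumes "abs_Kinf y < 1 / real CARD('a) ^ n" "i \<le> int n"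
  shows "fls_nth y i = 0"
proof (rule ccontr)
  assume nz: "fls_nth y i \<noteq> 0"
  then have "fls_subdegree y \<le> int n" using fls_subdegree_leI[of y i] assms(2) by linarith
  then have "real CARD('a) powi (- int n) \<le> real CARD('a) powi (- fls_subdegree y)"
    using q_gt_1 by (intro power_int_increasing) auto
  moreover have "y \<noteq> 0" using nz by auto
  ultimately show False
    using assms(1) by (simp add: abs_Kinf_def power_int_minus inverse_eq_divide)
qed

text \<open>A point of \<open>Omega\<close> has positive distance from \<open>K_\<infinity>\<close> because \<open>K_\<infinity>\<close> is complete.\<close>

lemma Omega_imp_far:
  assumes "z \<in> Omega"
  shows "\<exists>\<delta>>0. far \<delta> z"
proof (rule ccontr)
  assume "\<not> ?thesis"
  then have "\<exists>\<xi>. nv (z - of_Kinf \<xi>) < 1 / real CARD('a) ^ n" for n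
    unfolding far_def using q_gt_1 by (metis not_le zero_less_divide_1_iff zero_less_power
        order_less_trans zero_less_one)
  then obtain \<eta> where \<eta>: "\<And>n. nv (z - of_Kinf (\<eta> n)) < 1 / real CARD('a) ^ n" by metis
  have agree: "fls_nth (\<eta> n') i = fls_nth (\<eta> n) i" if "n \<le> n'" "i \<le> int n" for n n' i
  proof -
    have "1 / real CARD('a) ^ n' \<le> 1 / real CARD('a) ^ n"
      using that(1) q_gt_1 by (intro divide_left_mono power_increasing) auto
    then have "nv ((z - of_Kinf (\<eta> n)) - (z - of_Kinf (\<eta> n'))) < 1 / real CARD('a) ^ n"
      using nv_diff_le[of "z - of_Kinf (\<eta> n)" "z - of_Kinf (\<eta> n')"] \<eta>[of n] \<eta>[of n'] by linarith
    then have "abs_Kinf (\<eta> n' - \<eta> n) < 1 / real CARD('a) ^ n"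
      by (simp add: nv_of_Kinf[symmetric] of_Kinf_diff)
    from fls_nth_eq_0_of_abs_Kinf_less[OF this that(2)] show ?thesis by simp
  qed
  \<comment> \<open>The coefficient of index \<open>i\<close> is stable from the approximation number \<open>nat i\<close> on.\<close>
  define Y where "Y = Abs_fls (\<lambda>i. fls_nth (\<eta> (nat i)) i)"
  have Y: "fls_nth Y i = fls_nth (\<eta> (nat i)) i" for i
    unfolding Y_def
    by (subst nth_Abs_fls_lower_bound[of "min 0 (fls_subdegree (\<eta> 0))"]) auto
  have "nv (z - of_Kinf Y) \<le> 1 / real CARD('a) ^ n" for n
  proof -
    have "fls_nth (\<eta> n - Y) i = 0" if "i \<le> int n" for i
      using agree[of "nat i" n i] that by (simp add: Y)
    then have "nv (of_Kinf (\<eta> n - Y)) \<le> 1 / real CARD('a) ^ n"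
      unfolding nv_of_Kinf by (rule abs_Kinf_le)
    from nv_add_le[OF less_imp_le[OF \<eta>[of n]] this] show ?thesis by (simp add: of_Kinf_diff)
  qed
  then have "nv (z - of_Kinf Y) \<le> 0"
  proof (rule_tac ccontr)
    assume *: "\<not> nv (z - of_Kinf Y) \<le> 0"
    obtain n where "1 / nv (z - of_Kinf Y) < real CARD('a) ^ n" using power_tendsto_at_top by blast
    then have "1 / real CARD('a) ^ n < nv (z - of_Kinf Y)"
      using * q_gt_1 by (simp add: field_simps)
    with \<open>\<And>n. nv (z - of_Kinf Y) \<le> 1 / real CARD('a) ^ n\<close>[of n] show False by simp
  qed
  then have "z = of_Kinf Y" by simp
  with assms show False by (auto simp: Omega_def)
qed

lemma far_imp_Omega: "far \<delta> z \<Longrightarrow> \<delta> > 0 \<Longrightarrow> z \<in> Omega"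
  unfolding far_def Omega_def
  by (metis ComplI cancel_comm_monoid_add_class.diff_cancel dist_self imageE not_le)

text \<open>
  Truncation of the conditionally convergent double sum of \<open>a / (a z + b)\<close> over \<open>A \<times> A\<close>.
\<close>

definition box_sum :: "nat \<Rightarrow> nat \<Rightarrow> 'c \<Rightarrow> 'c" where
  "box_sum D D' z
     = (\<Sum>a\<in>polys_below D. \<Sum>b\<in>polys_below D'. of_A a / (of_A a * z + of_A b))"

lemma box_sum_eq:
  "box_sum D D' z = (\<Sum>a\<in>polys_below D. of_A a * recip_sum D' (of_A a * z))"
  by (simp add: box_sum_def recip_sum_def sum_distrib_left)

text \<open>
  The quadratic lower bound for the exponential function outweighs the factor \<open>a\<close>.
\<close>

lemma nv_box_term_le:
  assumes "far \<delta> z" "\<delta> > 0" "D' \<ge> 1" "a \<noteq> 0"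
  shows "nv (of_A a * recip_sum D' (of_A a * z)) \<le> 1 / (nv (of_A a) * \<delta>\<^sup>2)"
proof -
  let ?a = "nv (of_A a)"
  have a: "?a > 0" using assms(4) by simp
  have "nv (recip_sum D' (of_A a * z)) \<le> 1 / (?a * \<delta>)\<^sup>2"
    using a assms by (intro nv_recip_sum_le far_mult) auto
  then have "?a * nv (recip_sum D' (of_A a * z)) \<le> ?a * (1 / (?a * \<delta>)\<^sup>2)"
    using a by (intro mult_left_mono) auto
  also have "\<dots> = 1 / (?a * \<delta>\<^sup>2)" using a by (simp add: field_simps power2_eq_square)
  finally show ?thesis by (simp add: abs_mult)
qed

text \<open>
  Terms with large \<open>a\<close> are small uniformly in the range of \<open>b\<close>, and for the finitely many
  remaining \<open>a\<close> the sum over \<open>b\<close> converges uniformly.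
\<close>

lemma box_sum_uniformly_Cauchy:
  assumes "\<delta> > 0" "\<epsilon> > 0"
  shows "\<exists>N. \<forall>D\<ge>N. \<forall>D'\<ge>N. \<forall>E\<ge>N. \<forall>E'\<ge>N. \<forall>z. far \<delta> z \<longrightarrow> nv z \<le> R \<longrightarrow>
           nv (box_sum D D' z - box_sum E E' z) \<le> \<epsilon>"
proof -
  let ?q = "real CARD('a)"
  obtain K where K: "1 / (\<epsilon> * \<delta>\<^sup>2) < ?q ^ K" using power_tendsto_at_top by blast
  obtain M where M: "max (?q ^ K * \<bar>R\<bar>) (?q ^ K / \<epsilon>) < ?q ^ M" using power_tendsto_at_top by blast
  \<comment> \<open>\<open>K\<close> bounds the degree of the relevant \<open>a\<close>; \<open>M\<close> is then so large that \<open>|b|\<close> exceeds \<open>|a z|\<close> beyond it.\<close>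
  define N where "N = max K (max M 1)"
  have *: "nv (box_sum D D' z - box_sum K M z) \<le> \<epsilon>"
    if "D \<ge> N" "D' \<ge> N" "far \<delta> z" "nv z \<le> R" for D D' z
  proof -
    have "box_sum D D' z - box_sum K M z
        = (\<Sum>a\<in>polys_below D - polys_below K. of_A a * recip_sum D' (of_A a * z))
        + (\<Sum>a\<in>polys_below K. of_A a * (recip_sum D' (of_A a * z) - recip_sum M (of_A a * z)))"
      unfolding box_sum_eq right_diff_distrib sum_subtractf
      using that(1) by (subst sum.subset_diff[of "polys_below K" "polys_below D"])
        (auto simp: N_def finite_polys_below dest: polys_below_mono[THEN subsetD, rotated])
    moreover have "nv (\<Sum>a\<in>polys_below D - polys_below K. of_A a * recip_sum D' (of_A a * z)) \<le> \<epsilon>"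
    proof (rule nv_sum_le)
      fix a :: "'a poly" assume a: "a \<in> polys_below D - polys_below K"
      then have a0: "a \<noteq> 0" by auto
      have "1 / (\<epsilon> * \<delta>\<^sup>2) < nv (of_A a)" using nv_of_A_ge[of a K] a K by auto
      then have "1 / (nv (of_A a) * \<delta>\<^sup>2) \<le> \<epsilon>" using assms a0 by (simp add: field_simps)
      moreover have "nv (of_A a * recip_sum D' (of_A a * z)) \<le> 1 / (nv (of_A a) * \<delta>\<^sup>2)"
        using that a0 assms by (intro nv_box_term_le) (auto simp: N_def)
      ultimately show "nv (of_A a * recip_sum D' (of_A a * z)) \<le> \<epsilon>" by linarith
    qed (use assms in auto)
    moreover have "nv (\<Sum>a\<in>polys_below K.
        of_A a * (recip_sum D' (of_A a * z) - recip_sum M (of_A a * z))) \<le> \<epsilon>"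
    proof (rule nv_sum_le)
      fix a :: "'a poly" assume a: "a \<in> polys_below K"
      have aK: "nv (of_A a) \<le> ?q ^ K" using nv_of_A_less[OF a] by simp
      have "nv (of_A a * z) \<le> ?q ^ K * \<bar>R\<bar>"
        unfolding abs_mult using aK that(4) by (intro mult_mono) auto
      also have "\<dots> < ?q ^ M" using M by simp
      finally have "nv (recip_sum D' (of_A a * z) - recip_sum M (of_A a * z)) \<le> 1 / ?q ^ M"
        using that(2) by (intro nv_recip_sum_diff_le) (auto simp: N_def)
      then have "nv (of_A a * (recip_sum D' (of_A a * z) - recip_sum M (of_A a * z)))
          \<le> ?q ^ K * (1 / ?q ^ M)"
        unfolding abs_mult using aK by (intro mult_mono) auto
      also have "\<dots> \<le> \<epsilon>" using M assms(2) q_gt_1 by (simp add: field_simps)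
      finally show "nv (of_A a * (recip_sum D' (of_A a * z) - recip_sum M (of_A a * z))) \<le> \<epsilon>" .
    qed (use assms in auto)
    ultimately show ?thesis by (simp add: nv_add_le)
  qed
  have "nv (box_sum D D' z - box_sum E E' z) \<le> \<epsilon>"
    if "D \<ge> N" "D' \<ge> N" "E \<ge> N" "E' \<ge> N" "far \<delta> z" "nv z \<le> R" for D D' E E' z
    using nv_diff_leI[OF *[OF that(1,2,5,6)] *[OF that(3,4,5,6)]] by simp
  then show ?thesis by blast
qed

text \<open>
  Up to the factor \<open>- per\<close> this is Gekeler's false Eisenstein series, the sum of \<open>a * u (a z)\<close> over
  the monic polynomials \<open>a\<close>: each monic \<open>a\<close> stands for \<open>q - 1\<close> equal terms.
\<close>

definition eis :: "'c \<Rightarrow> 'c" where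
  "eis z = (if z \<in> Omega then lim (\<lambda>D. box_sum D D z) else 0)"

lemma box_sum_tendsto_eis:
  assumes "z \<in> Omega"
  shows "(\<lambda>D. box_sum D D z) \<longlonglongrightarrow> eis z"
proof -
  obtain \<delta> where \<delta>: "\<delta> > 0" "far \<delta> z" using Omega_imp_far[OF assms] by auto
  have "\<exists>l. (\<lambda>D. box_sum D D z) \<longlonglongrightarrow> l"
  proof (rule convergent_nv_Cauchy)
    fix e :: real assume "e > 0"
    from box_sum_uniformly_Cauchy[OF \<delta>(1) this, of "nv z"] \<delta>(2)
    show "\<exists>N. \<forall>m\<ge>N. \<forall>n\<ge>N. nv (box_sum m m z - box_sum n n z) \<le> e" by (meson order_refl)
  qed
  then have "convergent (\<lambda>D. box_sum D D z)" by (simp add: convergent_def)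
  then show ?thesis using assms by (simp add: eis_def convergent_LIMSEQ_iff)
qed

lemma box_sum_uniform:
  assumes "\<delta> > 0" "\<epsilon> > 0"
  shows "\<exists>N. \<forall>D\<ge>N. \<forall>D'\<ge>N. \<forall>z. far \<delta> z \<longrightarrow> nv z \<le> R \<longrightarrow> nv (box_sum D D' z - eis z) \<le> \<epsilon>"
proof -
  obtain N where N: "\<And>D D' E E' z. D \<ge> N \<Longrightarrow> D' \<ge> N \<Longrightarrow> E \<ge> N \<Longrightarrow> E' \<ge> N \<Longrightarrow> far \<delta> z \<Longrightarrow>
      nv z \<le> R \<Longrightarrow> nv (box_sum D D' z - box_sum E E' z) \<le> \<epsilon>"
    using box_sum_uniformly_Cauchy[OF assms, of R] by blast
  have "nv (box_sum D D' z - eis z) \<le> \<epsilon>"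
    if "D \<ge> N" "D' \<ge> N" "far \<delta> z" "nv z \<le> R" for D D' z
  proof (rule lim_nv_le)
    show "(\<lambda>E. box_sum D D' z - box_sum E E z) \<longlonglongrightarrow> box_sum D D' z - eis z"
      using that(3) assms(1) by (intro lim_diff box_sum_tendsto_eis tendsto_const far_imp_Omega)
    show "\<forall>\<^sub>F E in sequentially. nv (box_sum D D' z - box_sum E E z) \<le> \<epsilon>"
      unfolding eventually_sequentially using N[OF that(1,2) _ _ that(3,4)] by blast
  qed
  then show ?thesis by blast
qed

end

context carlitz_period
begin

text \<open>
  Summation over \<open>b\<close> first. Translations, units and the Hecke operator are easy to follow in this
  form, whereas the square boxes exhibit the symmetry in \<open>a\<close> and \<open>b\<close>.
\<close>

lemma eis_series:
  assumes "z \<in> Omega"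
  shows "(\<lambda>D. \<Sum>a\<in>polys_below D. of_A a * recip (of_A a * z)) \<longlonglongrightarrow> eis z"
  unfolding tendsto_iff_nv
proof (intro allI impI)
  fix e :: real assume "e > 0"
  obtain \<delta> where \<delta>: "\<delta> > 0" "far \<delta> z" using Omega_imp_far[OF assms] by auto
  obtain N where N: "\<And>D D'. D \<ge> N \<Longrightarrow> D' \<ge> N \<Longrightarrow> nv (box_sum D D' z - eis z) \<le> e / 2"
    using box_sum_uniform[OF \<delta>(1), of "e / 2" "nv z"] \<delta>(2) \<open>e > 0\<close> by auto
  have "nv ((\<Sum>a\<in>polys_below D. of_A a * recip (of_A a * z)) - eis z) \<le> e / 2" if "D \<ge> N" for D
  proof (rule lim_nv_le)
    have "(\<lambda>D'. of_A a * recip_sum D' (of_A a * z)) \<longlonglongrightarrow> of_A a * recip (of_A a * z)" for a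
    proof (cases "a = 0")
      case False
      then show ?thesis using \<delta>
        by (intro lim_mult_const recip_sum_tendsto[OF far_mult[OF \<delta>(2)]]) auto
    qed simp
    then show "(\<lambda>D'. box_sum D D' z - eis z)
        \<longlonglongrightarrow> (\<Sum>a\<in>polys_below D. of_A a * recip (of_A a * z)) - eis z"
      unfolding box_sum_eq by (intro lim_diff lim_sum tendsto_const)
    show "\<forall>\<^sub>F D' in sequentially. nv (box_sum D D' z - eis z) \<le> e / 2"
      unfolding eventually_sequentially using N[OF that] by blast
  qed
  then have "\<forall>D\<ge>N. nv ((\<Sum>a\<in>polys_below D. of_A a * recip (of_A a * z)) - eis z) < e"
    using \<open>e > 0\<close> by force
  then show "\<forall>\<^sub>F D in sequentially.
      nv ((\<Sum>a\<in>polys_below D. of_A a * recip (of_A a * z)) - eis z) < e"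
    unfolding eventually_sequentially by blast
qed

lemma Omega_affine:
  assumes "z \<in> Omega" "a \<noteq> 0" "d \<noteq> 0"
  shows "(of_A a * z + of_A b) / of_A d \<in> Omega"
proof -
  obtain \<delta> where \<delta>: "\<delta> > 0" "far \<delta> z" using Omega_imp_far[OF assms(1)] by auto
  have "far (nv (of_A a) * \<delta> / nv (of_A d)) ((of_A a * z + of_A b) / of_A d)"
    using far_divide[OF far_add[OF far_mult[OF \<delta>(2) assms(2)]] assms(3)] by (simp add: of_A_def)
  then show ?thesis by (rule far_imp_Omega) (use \<delta> assms in auto)
qed

lemma Omega_mult: "z \<in> Omega \<Longrightarrow> a \<noteq> 0 \<Longrightarrow> of_A a * z \<in> Omega"
  using Omega_affine[of z a 1 0] by simp

lemma Omega_add: "z \<in> Omega \<Longrightarrow> z + of_A b \<in> Omega"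
  using Omega_affine[of z 1 1 b] by simp

lemma Omega_neq_0: "z \<in> Omega \<Longrightarrow> z \<noteq> 0"
  unfolding Omega_def by (metis ComplD of_Kinf_0 rangeI)

lemma Omega_inverse: "z \<in> Omega \<Longrightarrow> 1 / z \<in> Omega"
  unfolding Omega_def
proof
  assume z: "z \<in> - range of_Kinf" and "1 / z \<in> range of_Kinf"
  then obtain \<xi> where "1 / z = of_Kinf \<xi>" by auto
  then have "z = of_Kinf (1 / \<xi>)" by (simp add: of_Kinf_divide) (metis div_by_1 divide_divide_eq_right mult_1 )
  with z show False by auto
qed

lemma eis_add_of_A:
  assumes "z \<in> Omega"
  shows "eis (z + of_A b) = eis z"
proof (rule LIMSEQ_unique[OF eis_series])
  have "recip (of_A a * (z + of_A b)) = recip (of_A a * z)" for a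
    using recip_add_of_A[of "of_A a * z" "a * b"] by (simp add: of_A_mult distrib_left)
  then show "(\<lambda>D. \<Sum>a\<in>polys_below D. of_A a * recip (of_A a * (z + of_A b))) \<longlonglongrightarrow> eis z"
    using eis_series[OF assms] by simp
qed (rule Omega_add[OF assms])

lemma eis_unit:
  assumes "z \<in> Omega" "c \<noteq> 0"
  shows "of_A [:c:] * eis (of_A [:c:] * z) = eis z"
proof (rule LIMSEQ_unique)
  have "(\<Sum>a\<in>polys_below D. of_A a * recip (of_A a * z))
      = of_A [:c:] * (\<Sum>a\<in>polys_below D. of_A a * recip (of_A a * (of_A [:c:] * z)))" for D
  proof -
    have "(\<Sum>a\<in>polys_below D. of_A a * recip (of_A a * z))
        = (\<Sum>a\<in>polys_below D. of_A (smult c a) * recip (of_A (smult c a) * z))"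
      by (rule sum.reindex_bij_witness[of _ "smult c" "smult (1 / c)"])
         (use assms(2) in \<open>auto simp: smult_in_polys_below\<close>)
    moreover have "of_A (smult c a) = of_A [:c:] * of_A a" for a by (simp flip: of_A_mult)
    ultimately show ?thesis by (simp add: sum_distrib_left mult_ac)
  qed
  then show "(\<lambda>D. of_A [:c:] * (\<Sum>a\<in>polys_below D. of_A a * recip (of_A a * (of_A [:c:] * z))))
      \<longlonglongrightarrow> eis z"
    using eis_series[OF assms(1)] by simp
  show "(\<lambda>D. of_A [:c:] * (\<Sum>a\<in>polys_below D. of_A a * recip (of_A a * (of_A [:c:] * z))))
      \<longlonglongrightarrow> of_A [:c:] * eis (of_A [:c:] * z)"
    using assms by (intro lim_mult_const eis_series Omega_mult) auto
qed

text \<open>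
  Square boxes are symmetric under exchanging the two summation variables. The inhomogeneous term
  counts the nonzero pairs in a box, whose number is \<open>-1\<close> in \<open>'c\<close>.
\<close>

lemma eis_inverse:
  assumes "z \<in> Omega"
  shows "eis (1 / z) = - z\<^sup>2 * eis z - z"
proof (rule LIMSEQ_unique[OF box_sum_tendsto_eis[OF Omega_inverse[OF assms]]])
  have z0: "z \<noteq> 0" by (rule Omega_neq_0[OF assms])
  obtain \<delta> where \<delta>: "\<delta> > 0" "far \<delta> z" using Omega_imp_far[OF assms] by auto
  have box: "box_sum D D (1 / z) = - z\<^sup>2 * box_sum D D z - z" if "D \<ge> 1" for D
  proof -
    let ?B = "polys_below D :: 'a poly set"
    have term_eq: "of_A a / (of_A a * (1 / z) + of_A b)
        = (z - z\<^sup>2 * (of_A b / (of_A b * z + of_A a))) - (if a = 0 \<and> b = 0 then z else 0)" for a b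
    proof (cases "b = 0")
      case False
      have "of_A b * z + of_A a \<noteq> 0"
        using far_add_of_A_neq_0[OF far_mult[OF \<delta>(2) False]] \<delta>(1) False by simp
      then show ?thesis using z0 False by (simp add: field_simps power2_eq_square)
    qed (use z0 in auto)
    have "(\<Sum>a\<in>?B. \<Sum>b\<in>?B. of_A a / (of_A a * (1 / z) + of_A b))
        = (\<Sum>a\<in>?B. \<Sum>b\<in>?B. z) - z\<^sup>2 * (\<Sum>a\<in>?B. \<Sum>b\<in>?B. of_A b / (of_A b * z + of_A a))
          - (\<Sum>a\<in>?B. \<Sum>b\<in>?B. if a = 0 \<and> b = 0 then z else 0)"
      unfolding term_eq by (simp add: sum_subtractf sum_distrib_left)
    also have "(\<Sum>a\<in>?B. \<Sum>b\<in>?B. z) = 0"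
      by (simp add: card_polys_below_eq_0[OF that])
    also have "(\<Sum>a\<in>?B. \<Sum>b\<in>?B. of_A b / (of_A b * z + of_A a)) = box_sum D D z"
      unfolding box_sum_def by (rule sum.swap)
    also have "(\<Sum>a\<in>?B. \<Sum>b\<in>?B. if a = 0 \<and> b = 0 then z else 0)
        = (\<Sum>a\<in>?B. if a = 0 then z else 0)"
      by (intro sum.cong refl) (simp add: finite_polys_below)
    also have "\<dots> = z" by (simp add: finite_polys_below)
    finally show ?thesis by (simp add: box_sum_def)
  qed
  have "(\<lambda>D. - z\<^sup>2 * box_sum D D z - z) \<longlonglongrightarrow> - z\<^sup>2 * eis z - z"
    by (intro lim_diff lim_mult_const box_sum_tendsto_eis tendsto_const assms)
  then show "(\<lambda>D. box_sum D D (1 / z)) \<longlonglongrightarrow> - z\<^sup>2 * eis z - z"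
    by (rule Lim_transform_eventually)
       (auto simp: eventually_sequentially box intro!: exI[of _ 1])
qed

end

section \<open>Integral matrices\<close>

lemma mat2_nth [simp]:
  "mat2 a b c d $ 1 $ 1 = a" "mat2 a b c d $ 1 $ 2 = b"
  "mat2 a b c d $ 2 $ 1 = c" "mat2 a b c d $ 2 $ 2 = d"
  by (simp_all add: mat2_def)

lemma mat2_eta: "mat2 (\<gamma> $ 1 $ 1) (\<gamma> $ 1 $ 2) (\<gamma> $ 2 $ 1) (\<gamma> $ 2 $ 2) = \<gamma>"
  by (simp add: vec_eq_iff forall_2)

lemma mat2_eq_iff: "mat2 a b c d = mat2 a' b' c' d' \<longleftrightarrow> a = a' \<and> b = b' \<and> c = c' \<and> d = d'"
  by (auto simp: vec_eq_iff forall_2)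

lemma matrix_mult_nth_2: "(\<gamma> ** \<delta>) $ i $ j = \<gamma> $ i $ 1 * \<delta> $ 1 $ j + \<gamma> $ i $ 2 * \<delta> $ 2 $ j"
  for \<gamma> \<delta> :: "'b::semiring_1^2^2"
  by (simp add: matrix_matrix_mult_def sum_2)

lemma mat2_mult: "mat2 a b c d ** mat2 a' b' c' d' =
    mat2 (a * a' + b * c') (a * b' + b * d') (c * a' + d * c') (c * b' + d * d')"
  for a :: "'b::semiring_1"
  by (simp add: vec_eq_iff forall_2 matrix_mult_nth_2)

lemma det_mat2: "det (mat2 a b c d) = a * d - b * c" for a :: "'b::comm_ring_1"
  by (simp add: det_2)

lemma mat_1_eq_mat2: "mat 1 = mat2 1 0 0 (1 :: 'b::semiring_1)"
  by (simp add: vec_eq_iff forall_2 mat_def)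

lemma invertible_iff_is_unit_det:
  fixes \<gamma> :: "'a::field poly^2^2"
  shows "invertible \<gamma> \<longleftrightarrow> is_unit (det \<gamma>)"
proof
  assume "invertible \<gamma>"
  then obtain \<delta> where "\<gamma> ** \<delta> = mat 1" by (auto simp: invertible_def)
  then have "det \<gamma> * det \<delta> = 1" by (metis det_mul det_I)
  then show "is_unit (det \<gamma>)" by (metis dvd_triv_left)
next
  assume "is_unit (det \<gamma>)"
  then obtain e where "1 = det \<gamma> * e" by (rule dvdE)
  moreover obtain a b c d where \<gamma>: "\<gamma> = mat2 a b c d" by (metis mat2_eta)
  ultimately have e: "e * (a * d - b * c) = 1" by (simp add: det_mat2 mult.commute)
  let ?\<delta> = "mat2 (e * d) (- (e * b)) (- (e * c)) (e * a)"
  have "\<gamma> ** ?\<delta> = mat2 (e * (a * d - b * c)) 0 0 (e * (a * d - b * c))"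
    "?\<delta> ** \<gamma> = mat2 (e * (a * d - b * c)) 0 0 (e * (a * d - b * c))"
    unfolding \<gamma> mat2_mult mat2_eq_iff by (simp_all add: right_diff_distrib mult_ac)
  then have "\<gamma> ** ?\<delta> = mat 1" "?\<delta> ** \<gamma> = mat 1"
    unfolding e mat_1_eq_mat2 .
  then show "invertible \<gamma>" by (auto simp: invertible_def)
qed

lemma GL2_A_iff: "\<gamma> \<in> GL2_A \<longleftrightarrow> is_unit (det \<gamma>)"
  by (simp add: GL2_A_def invertible_iff_is_unit_det)

lemma Gamma0_iff: "\<gamma> \<in> Gamma0 n \<longleftrightarrow> is_unit (det \<gamma>) \<and> n dvd \<gamma> $ 2 $ 1"
  by (simp add: Gamma0_def GL2_A_iff)

lemma is_unit_poly_const: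
  fixes p :: "'a::field poly"
  assumes "is_unit p"
  obtains c where "c \<noteq> 0" "p = [:c:]"
  using assms that unfolding is_unit_poly_iff by (auto simp: dvd_field_iff)

text \<open>
  Together with the invertible upper triangular matrices these generate \<open>GL\<^sub>2(A)\<close>.
\<close>

inductive_set elementary_products :: "('a::field poly^2^2) set" where
  one: "mat 1 \<in> elementary_products"
| translation: "g \<in> elementary_products \<Longrightarrow> mat2 1 t 0 1 ** g \<in> elementary_products"
| swap: "g \<in> elementary_products \<Longrightarrow> mat2 0 1 1 0 ** g \<in> elementary_products"

text \<open>
  Euclid's algorithm on the first column. It serves two purposes: it reduces the transformation law
  under \<open>GL\<^sub>2(A)\<close> to generators, and it reduces the behaviour at all cusps to upper triangular
  matrices.
\<close>

lemma upper_triangular_decomposition: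
  fixes M :: "'a::field poly^2^2"
  shows "\<exists>g U. g \<in> elementary_products \<and> M = g ** U \<and> U $ 2 $ 1 = 0"
proof (induction "if M $ 2 $ 1 = 0 then 0 else Suc (degree (M $ 2 $ 1))"
    arbitrary: M rule: less_induct)
  case less
  show ?case
  proof (cases "M $ 2 $ 1 = 0")
    case True
    then show ?thesis using elementary_products.one by (intro exI[of _ "mat 1"] exI[of _ M]) simp
  next
    case False
    define t where "t = M $ 1 $ 1 div M $ 2 $ 1"
    define M' where "M' = mat2 (M $ 2 $ 1) (M $ 2 $ 2)
      (M $ 1 $ 1 - t * M $ 2 $ 1) (M $ 1 $ 2 - t * M $ 2 $ 2)"
    have c': "M' $ 2 $ 1 = M $ 1 $ 1 mod M $ 2 $ 1"
      by (simp add: M'_def t_def minus_div_mult_eq_mod)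
    then have "(if M' $ 2 $ 1 = 0 then 0 else Suc (degree (M' $ 2 $ 1)))
        < (if M $ 2 $ 1 = 0 then 0 else Suc (degree (M $ 2 $ 1)))"
      using False degree_mod_less[OF False, of "M $ 1 $ 1"] by auto
    from less.hyps[OF this] obtain g and U :: "'a poly^2^2"
      where g: "g \<in> elementary_products" "M' = g ** U" "U $ 2 $ 1 = 0" by blast
    have "M = mat2 1 t 0 1 ** (mat2 0 1 1 0 ** M')"
      by (simp add: M'_def vec_eq_iff forall_2 matrix_mult_nth_2)
    also have "\<dots> = (mat2 1 t 0 1 ** (mat2 0 1 1 0 ** g)) ** U"
      by (simp add: g(2) matrix_mul_assoc)
    finally show ?thesis
      using g by (blast intro: elementary_products.intros)
  qed
qed

lemma is_unit_det_elementary_products: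
  "g \<in> elementary_products \<Longrightarrow> is_unit (det g)"
  by (induction rule: elementary_products.induct) (auto simp: det_mul det_mat2)

context completed_alg_closure
begin

definition num :: "'a poly^2^2 \<Rightarrow> 'c \<Rightarrow> 'c" where
  "num \<gamma> z = of_A (\<gamma> $ 1 $ 1) * z + of_A (\<gamma> $ 1 $ 2)"

definition den :: "'a poly^2^2 \<Rightarrow> 'c \<Rightarrow> 'c" where
  "den \<gamma> z = of_A (\<gamma> $ 2 $ 1) * z + of_A (\<gamma> $ 2 $ 2)"

lemma slash_A_eq:
  assumes "z \<in> Omega"
  shows "slash_A 2 1 f \<gamma> z = of_A (det \<gamma>) / (den \<gamma> z)\<^sup>2 * f (num \<gamma> z / den \<gamma> z)"
proof -
  have "of_Kinf (det (map_matrix Kinf_of_A \<gamma>)) = of_A (det \<gamma>)"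
    by (simp add: det_2 of_A_def Kinf_of_A_mult Kinf_of_A_diff)
  then show ?thesis
    using assms
    by (simp add: slash_def num_def den_def of_A_def power_int_minus field_simps)
qed

lemma slash_outside: "z \<notin> Omega \<Longrightarrow> slash k l f \<gamma> z = 0"
  by (simp add: slash_def)

lemma Omega_linear_neq_0:
  assumes "z \<in> Omega" "a \<noteq> 0 \<or> b \<noteq> 0"
  shows "of_A a * z + of_A b \<noteq> 0"
proof (cases "a = 0")
  case False
  show ?thesis
  proof
    assume "of_A a * z + of_A b = 0"
    then have "z = of_Kinf (- Kinf_of_A b / Kinf_of_A a)"
      using False by (simp add: of_Kinf_divide of_Kinf_minus of_A_def field_simps add_eq_0_iff)
    with assms(1) show False by (auto simp: Omega_def)
  qed
qed (use assms in auto)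

lemma den_neq_0:
  assumes "z \<in> Omega" "det \<gamma> \<noteq> 0"
  shows "den \<gamma> z \<noteq> 0"
  unfolding den_def by (rule Omega_linear_neq_0) (use assms in \<open>auto simp: det_2\<close>)

text \<open>The Moebius action preserves \<open>Omega\<close>, since its inverse preserves \<open>K_\<infinity>\<close>.\<close>

lemma Omega_moebius:
  assumes "z \<in> Omega" "det \<gamma> \<noteq> 0"
  shows "num \<gamma> z / den \<gamma> z \<in> Omega"
proof (rule ccontr)
  assume "num \<gamma> z / den \<gamma> z \<notin> Omega"
  then obtain \<xi> where \<xi>: "num \<gamma> z / den \<gamma> z = of_Kinf \<xi>" by (auto simp: Omega_def)
  define a b c d where "a = Kinf_of_A (\<gamma> $ 1 $ 1)" and "b = Kinf_of_A (\<gamma> $ 1 $ 2)"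
    and "c = Kinf_of_A (\<gamma> $ 2 $ 1)" and "d = Kinf_of_A (\<gamma> $ 2 $ 2)"
  note defs = a_def b_def c_def d_def
  have det: "a * d - b * c \<noteq> 0"
    using assms(2) by (simp add: defs det_2 flip: Kinf_of_A_mult Kinf_of_A_diff)
  have "num \<gamma> z = of_Kinf \<xi> * den \<gamma> z"
    using \<xi> den_neq_0[OF assms] by (simp add: field_simps)
  then have eq: "of_Kinf (a - \<xi> * c) * z = of_Kinf (\<xi> * d - b)"
    by (simp add: num_def den_def of_A_def defs of_Kinf_diff of_Kinf_mult algebra_simps)
  have "a - \<xi> * c \<noteq> 0"
  proof
    assume *: "a - \<xi> * c = 0"
    with eq have "\<xi> * d - b = 0" by simp
    with * have "a = \<xi> * c" "b = \<xi> * d" by auto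
    with det show False by (simp add: algebra_simps)
  qed
  then have "z = of_Kinf ((\<xi> * d - b) / (a - \<xi> * c))"
    using eq by (simp add: of_Kinf_divide field_simps)
  with assms(1) show False by (auto simp: Omega_def)
qed

lemma den_mult:
  assumes "z \<in> Omega" "det \<delta> \<noteq> 0"
  shows "den (\<gamma> ** \<delta>) z = den \<gamma> (num \<delta> z / den \<delta> z) * den \<delta> z"
  using den_neq_0[OF assms]
  by (simp add: den_def[of \<gamma>] den_def[of "\<gamma> ** \<delta>"] matrix_mult_nth_2 of_A_add of_A_mult field_simps)
     (simp add: num_def den_def algebra_simps)

lemma num_mult:
  assumes "z \<in> Omega" "det \<delta> \<noteq> 0"
  shows "num (\<gamma> ** \<delta>) z = num \<gamma> (num \<delta> z / den \<delta> z) * den \<delta> z"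
  using den_neq_0[OF assms]
  by (simp add: num_def[of \<gamma>] num_def[of "\<gamma> ** \<delta>"] matrix_mult_nth_2 of_A_add of_A_mult field_simps)
     (simp add: num_def den_def algebra_simps)

lemma slash_A_mult:
  assumes "det \<delta> \<noteq> 0"
  shows "slash_A 2 1 f (\<gamma> ** \<delta>) = slash_A 2 1 (slash_A 2 1 f \<gamma>) \<delta>"
proof
  fix z
  show "slash_A 2 1 f (\<gamma> ** \<delta>) z = slash_A 2 1 (slash_A 2 1 f \<gamma>) \<delta> z"
  proof (cases "z \<in> Omega")
    case True
    note nz = den_neq_0[OF True assms]
    show ?thesis
      unfolding slash_A_eq[OF True] slash_A_eq[OF Omega_moebius[OF True assms]]
        den_mult[OF True assms] num_mult[OF True assms]
      using nz by (simp add: det_mul of_A_mult power2_eq_square field_simps)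
  qed (simp add: slash_outside)
qed

lemma slash_A_diff: "slash_A k l (\<lambda>z. f z - g z) \<gamma> z = slash_A k l f \<gamma> z - slash_A k l g \<gamma> z"
  by (simp add: slash_def algebra_simps)

text \<open>
  Subtracting the logarithmic derivative \<open>c / (c z + d)\<close> of the automorphy factor turns the
  transformation law of the false Eisenstein series into invariance.
\<close>

definition eis_slash :: "'a poly^2^2 \<Rightarrow> 'c \<Rightarrow> 'c" where
  "eis_slash \<gamma> z =
     (if z \<in> Omega then slash_A 2 1 eis \<gamma> z - of_A (\<gamma> $ 2 $ 1) / den \<gamma> z else 0)"

text \<open>
  The logarithmic derivative of the automorphy factor is a cocycle of weight two and type one.
\<close>

lemma eis_slash_mult:
  assumes "z \<in> Omega" "det \<gamma> \<noteq> 0" "det \<delta> \<noteq> 0"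
  shows "eis_slash (\<gamma> ** \<delta>) z = slash_A 2 1 (eis_slash \<gamma>) \<delta> z - of_A (\<delta> $ 2 $ 1) / den \<delta> z"
proof -
  let ?w = "num \<delta> z / den \<delta> z"
  have w: "?w \<in> Omega" by (rule Omega_moebius[OF assms(1,3)])
  note nz = den_neq_0[OF assms(1,3)] den_neq_0[OF w assms(2)]
  have "of_A ((\<gamma> ** \<delta>) $ 2 $ 1) * den \<delta> z - of_A (\<delta> $ 2 $ 1) * den (\<gamma> ** \<delta>) z
      = of_A (det \<delta>) * of_A (\<gamma> $ 2 $ 1)"
    by (simp add: den_def matrix_mult_nth_2 det_2 of_A_add of_A_mult of_A_diff algebra_simps)
  then have "of_A ((\<gamma> ** \<delta>) $ 2 $ 1) * den \<delta> z
      = of_A (det \<delta>) * of_A (\<gamma> $ 2 $ 1) + of_A (\<delta> $ 2 $ 1) * (den \<gamma> ?w * den \<delta> z)"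
    unfolding den_mult[OF assms(1,3)] by (simp add: diff_eq_eq)
  then have "of_A ((\<gamma> ** \<delta>) $ 2 $ 1) / den (\<gamma> ** \<delta>) z
      = of_A (det \<delta>) / (den \<delta> z)\<^sup>2 * (of_A (\<gamma> $ 2 $ 1) / den \<gamma> ?w) + of_A (\<delta> $ 2 $ 1) / den \<delta> z"
    unfolding den_mult[OF assms(1,3)]
    using nz by (simp add: field_simps power2_eq_square)
  then show ?thesis
    using assms(1) w unfolding eis_slash_def slash_A_mult[OF assms(3)]
    by (simp add: slash_A_eq[OF assms(1)] eis_slash_def right_diff_distrib)
qed

end

context carlitz_period
begin

lemma eis_slash_upper:
  fixes \<gamma> :: "'a poly^2^2"
  assumes "z \<in> Omega" "\<gamma> $ 2 $ 1 = 0"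
  shows "eis_slash \<gamma> z = of_A (\<gamma> $ 1 $ 1) / of_A (\<gamma> $ 2 $ 2)
    * eis ((of_A (\<gamma> $ 1 $ 1) * z + of_A (\<gamma> $ 1 $ 2)) / of_A (\<gamma> $ 2 $ 2))"
  using assms
  by (simp add: eis_slash_def slash_A_eq num_def den_def det_2 of_A_mult power2_eq_square)

lemma eis_slash_mult_invariant:
  assumes "\<And>z. z \<in> Omega \<Longrightarrow> eis_slash g z = eis z" "z \<in> Omega" "det g \<noteq> 0" "det \<delta> \<noteq> 0"
  shows "eis_slash (g ** \<delta>) z = eis_slash \<delta> z"
  using assms Omega_moebius[OF assms(2,4)]
  by (simp add: eis_slash_mult) (simp add: eis_slash_def slash_A_eq)

lemma eis_slash_elementary_products:
  assumes "g \<in> elementary_products" "z \<in> Omega" "det \<delta> \<noteq> 0"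
  shows "eis_slash (g ** \<delta>) z = eis_slash \<delta> z"
  using assms
proof (induction arbitrary: \<delta> rule: elementary_products.induct)
  case one
  then show ?case by simp
next
  case (translation g t)
  have "det g \<noteq> 0" using is_unit_det_elementary_products[OF translation.hyps] by auto
  then have "eis_slash (mat2 1 t 0 1 ** (g ** \<delta>)) z = eis_slash (g ** \<delta>) z"
    using translation.prems
    by (intro eis_slash_mult_invariant)
       (auto simp: eis_slash_upper eis_add_of_A det_mat2 det_mul)
  with translation show ?case by (simp add: matrix_mul_assoc)
next
  case (swap g)
  have "det g \<noteq> 0" using is_unit_det_elementary_products[OF swap.hyps] by auto
  moreover have "eis_slash (mat2 0 1 1 0) w = eis w" if "w \<in> Omega" for w
    using that Omega_neq_0[OF that]
    by (simp add: eis_slash_def slash_A_eq num_def den_def det_mat2 of_A_minus eis_inverse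
        field_simps power2_eq_square)
  ultimately have "eis_slash (mat2 0 1 1 0 ** (g ** \<delta>)) z = eis_slash (g ** \<delta>) z"
    using swap.prems
    by (intro eis_slash_mult_invariant) (auto simp: det_mat2 det_mul)
  with swap show ?case by (simp add: matrix_mul_assoc)
qed

text \<open>
  After Euclid's algorithm only an upper triangular matrix with constant diagonal remains, that is,
  a scaling by a unit followed by a translation.
\<close>

theorem eis_slash_GL2_A:
  assumes "is_unit (det \<gamma>)" "z \<in> Omega"
  shows "eis_slash \<gamma> z = eis z"
proof -
  obtain g and U :: "'a poly^2^2"
    where g: "g \<in> elementary_products" "\<gamma> = g ** U" "U $ 2 $ 1 = 0"
    using upper_triangular_decomposition by blast
  have U: "is_unit (det U)" using assms(1) by (simp add: g(2) det_mul is_unit_mult_iff)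
  then have "is_unit (U $ 1 $ 1)" "is_unit (U $ 2 $ 2)"
    by (simp_all add: det_2 g(3) is_unit_mult_iff)
  then obtain \<alpha> \<beta> where ab: "\<alpha> \<noteq> 0" "\<beta> \<noteq> 0" "U $ 1 $ 1 = [:\<alpha>:]" "U $ 2 $ 2 = [:\<beta>:]"
    by (metis is_unit_poly_const)
  let ?e = "[:\<alpha> / \<beta>:]" and ?b = "smult (1 / \<beta>) (U $ 1 $ 2)"
  have "of_A [:\<alpha>:] = of_A [:\<beta>:] * of_A ?e" "of_A (U $ 1 $ 2) = of_A [:\<beta>:] * of_A ?b"
    using ab by (simp_all flip: of_A_mult)
  then have e: "of_A [:\<alpha>:] / of_A [:\<beta>:] = of_A ?e"
    "(of_A [:\<alpha>:] * z + of_A (U $ 1 $ 2)) / of_A [:\<beta>:] = of_A ?e * z + of_A ?b"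
    using ab by (simp_all add: field_simps)
  have "eis_slash \<gamma> z = eis_slash U z"
    unfolding g(2) by (rule eis_slash_elementary_products[OF g(1) assms(2)]) (use U in auto)
  also have "\<dots> = of_A ?e * eis (of_A ?e * z + of_A ?b)"
    unfolding eis_slash_upper[OF assms(2) g(3)] ab e by simp
  also have "\<dots> = eis z"
    using ab assms(2) by (simp add: eis_add_of_A Omega_mult eis_unit)
  finally show ?thesis .
qed

corollary eis_slash_GL2_A_mult:
  assumes "is_unit (det \<gamma>)" "z \<in> Omega" "det \<delta> \<noteq> 0"
  shows "eis_slash (\<gamma> ** \<delta>) z = eis_slash \<delta> z"
  by (rule eis_slash_mult_invariant) (use assms eis_slash_GL2_A in auto)

end

section \<open>Rigid holomorphy\<close>

context completed_alg_closure
begin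

definition rational_on :: "'c set \<Rightarrow> ('c \<Rightarrow> 'c) \<Rightarrow> bool" where
  "rational_on S f \<longleftrightarrow> (\<exists>p q. \<forall>z\<in>S. poly q z \<noteq> 0 \<and> f z = poly p z / poly q z)"

lemma rational_onI: "(\<And>z. z \<in> S \<Longrightarrow> poly q z \<noteq> 0 \<and> f z = poly p z / poly q z) \<Longrightarrow> rational_on S f"
  unfolding rational_on_def by blast

lemma rational_on_add:
  assumes "rational_on S f" "rational_on S g"
  shows "rational_on S (\<lambda>z. f z + g z)"
proof -
  obtain p q p' q' where "\<forall>z\<in>S. poly q z \<noteq> 0 \<and> f z = poly p z / poly q z"
    "\<forall>z\<in>S. poly q' z \<noteq> 0 \<and> g z = poly p' z / poly q' z"
    using assms unfolding rational_on_def by blast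
  then show ?thesis
    by (intro rational_onI[where p = "p * q' + p' * q" and q = "q * q'"]) (auto simp: field_simps)
qed

lemma rational_on_cmult:
  assumes "rational_on S f"
  shows "rational_on S (\<lambda>z. c * f z)"
proof -
  obtain p q where "\<forall>z\<in>S. poly q z \<noteq> 0 \<and> f z = poly p z / poly q z"
    using assms unfolding rational_on_def by blast
  then show ?thesis by (intro rational_onI[where p = "[:c:] * p" and q = q]) auto
qed

lemma rational_on_0: "rational_on S (\<lambda>_. 0)"
  by (rule rational_onI[where p = 0 and q = 1]) auto

lemma rational_on_sum:
  assumes "\<And>i. i \<in> I \<Longrightarrow> rational_on S (f i)"
  shows "rational_on S (\<lambda>z. \<Sum>i\<in>I. f i z)"
  using assms
  by (induction I rule: infinite_finite_induct) (auto intro: rational_on_0 rational_on_add)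

lemma rigid_holomorphicI:
  assumes "\<And>n. \<exists>f' :: nat \<Rightarrow> 'c \<Rightarrow> 'c. (\<forall>i. rational_on (Omega_affinoid n) (f' i)) \<and>
      (\<forall>e>0. \<exists>N. \<forall>i\<ge>N. \<forall>z\<in>Omega_affinoid n. nv (f' i z - f z) \<le> e)"
  shows "rigid_holomorphic f"
  unfolding rigid_holomorphic_def
proof
  fix n
  obtain f' :: "nat \<Rightarrow> 'c \<Rightarrow> 'c" where f': "\<And>i. rational_on (Omega_affinoid n) (f' i)"
    "\<And>e. e > 0 \<Longrightarrow> \<exists>N. \<forall>i\<ge>N. \<forall>z\<in>Omega_affinoid n. nv (f' i z - f z) \<le> e"
    using assms[of n] by auto
  obtain p q where pq: "\<And>i z. z \<in> Omega_affinoid n \<Longrightarrow>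
      poly (q i) z \<noteq> 0 \<and> f' i z = poly (p i) z / poly (q i) z"
    using f'(1) unfolding rational_on_def by metis
  have "uniform_limit (Omega_affinoid n) (\<lambda>i z. poly (p i) z / poly (q i) z) f sequentially"
    unfolding uniform_limit_iff
  proof (intro allI impI)
    fix e :: real assume "e > 0"
    then obtain N where N: "\<forall>i\<ge>N. \<forall>z\<in>Omega_affinoid n. nv (f' i z - f z) \<le> e / 2"
      using f'(2)[of "e / 2"] by auto
    have "dist (poly (p i) z / poly (q i) z) (f z) < e"
      if "i \<ge> N" "z \<in> Omega_affinoid n" for i z
    proof -
      have "nv (f' i z - f z) \<le> e / 2" using N that by blast
      then show ?thesis
        using pq[OF that(2), of i] \<open>e > 0\<close> by (subst dist_eq) simp
    qed
    then show "\<forall>\<^sub>F i in sequentially. \<forall>z\<in>Omega_affinoid n.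
        dist (poly (p i) z / poly (q i) z) (f z) < e"
      unfolding eventually_sequentially by blast
  qed
  with pq show "\<exists>p q. (\<forall>i. \<forall>z\<in>Omega_affinoid n. poly (q i) z \<noteq> 0) \<and>
      uniform_limit (Omega_affinoid n) (\<lambda>i z. poly (p i) z / poly (q i) z) f sequentially"
    by blast
qed

lemma rigid_holomorphicD:
  assumes "rigid_holomorphic f"
  obtains f' :: "nat \<Rightarrow> 'c \<Rightarrow> 'c" where "\<And>i. rational_on (Omega_affinoid n) (f' i)"
    "\<And>e. e > 0 \<Longrightarrow> \<exists>N. \<forall>i\<ge>N. \<forall>z\<in>Omega_affinoid n. nv (f' i z - f z) \<le> e"
proof -
  obtain p q where pq: "\<forall>i. \<forall>z\<in>Omega_affinoid n. poly (q i) z \<noteq> 0"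
    "uniform_limit (Omega_affinoid n) (\<lambda>i z. poly (p i) z / poly (q i) z) f sequentially"
    using assms unfolding rigid_holomorphic_def by meson
  show ?thesis
  proof (rule that[of "\<lambda>i z. poly (p i) z / poly (q i) z"])
    show "rational_on (Omega_affinoid n) (\<lambda>z. poly (p i) z / poly (q i) z)" for i
      using pq(1) by (intro rational_onI) auto
    fix e :: real assume "e > 0"
    then have "\<forall>\<^sub>F i in sequentially. \<forall>z\<in>Omega_affinoid n.
        dist (poly (p i) z / poly (q i) z) (f z) < e"
      using pq(2) unfolding uniform_limit_iff by blast
    then show "\<exists>N. \<forall>i\<ge>N. \<forall>z\<in>Omega_affinoid n. nv (poly (p i) z / poly (q i) z - f z) \<le> e"
      unfolding eventually_sequentially dist_eq[symmetric] by (meson less_imp_le)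
  qed
qed

lemma rigid_holomorphic_diff:
  assumes "rigid_holomorphic f" "rigid_holomorphic g"
  shows "rigid_holomorphic (\<lambda>z. f z - g z)"
proof (rule rigid_holomorphicI)
  fix n
  obtain f' :: "nat \<Rightarrow> 'c \<Rightarrow> 'c" where f': "\<And>i. rational_on (Omega_affinoid n) (f' i)"
    "\<And>e. e > 0 \<Longrightarrow> \<exists>N. \<forall>i\<ge>N. \<forall>z\<in>Omega_affinoid n. nv (f' i z - f z) \<le> e"
    using rigid_holomorphicD[OF assms(1)] by blast
  obtain g' :: "nat \<Rightarrow> 'c \<Rightarrow> 'c" where g': "\<And>i. rational_on (Omega_affinoid n) (g' i)"
    "\<And>e. e > 0 \<Longrightarrow> \<exists>N. \<forall>i\<ge>N. \<forall>z\<in>Omega_affinoid n. nv (g' i z - g z) \<le> e"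
    using rigid_holomorphicD[OF assms(2)] by blast
  have "rational_on (Omega_affinoid n) (\<lambda>z. f' i z - g' i z)" for i
    using rational_on_add[OF f'(1) rational_on_cmult[OF g'(1), of "- 1"]] by simp
  moreover have "\<exists>N. \<forall>i\<ge>N. \<forall>z\<in>Omega_affinoid n. nv (f' i z - g' i z - (f z - g z)) \<le> e"
    if e: "e > 0" for e
  proof -
    obtain N N' where N: "\<forall>i\<ge>N. \<forall>z\<in>Omega_affinoid n. nv (f' i z - f z) \<le> e"
      "\<forall>i\<ge>N'. \<forall>z\<in>Omega_affinoid n. nv (g' i z - g z) \<le> e"
      using f'(2)[OF e] g'(2)[OF e] by blast
    have "nv (f' i z - g' i z - (f z - g z)) \<le> e"
      if "i \<ge> max N N'" "z \<in> Omega_affinoid n" for i z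
      using nv_diff_leI[of "f' i z - f z" e "g' i z - g z"] N that by (simp add: algebra_simps)
    then show ?thesis by blast
  qed
  ultimately show "\<exists>h :: nat \<Rightarrow> 'c \<Rightarrow> 'c. (\<forall>i. rational_on (Omega_affinoid n) (h i)) \<and>
      (\<forall>e>0. \<exists>N. \<forall>i\<ge>N. \<forall>z\<in>Omega_affinoid n. nv (h i z - (f z - g z)) \<le> e)"
    by (intro exI[of _ "\<lambda>i z. f' i z - g' i z"]) blast
qed

end

context carlitz_period
begin

lemma eis_slash_diag:
  "z \<in> Omega \<Longrightarrow> eis_slash (mat2 n 0 0 1) z = of_A n * eis (of_A n * z)"
  by (simp add: eis_slash_upper)

lemma rational_on_box_sum:
  assumes "S \<subseteq> Omega" "n \<noteq> 0"
  shows "rational_on S (\<lambda>z. box_sum D D' (of_A n * z))"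
  unfolding box_sum_def
proof (intro rational_on_sum)
  fix a b
  show "rational_on S (\<lambda>z. of_A a / (of_A a * (of_A n * z) + of_A b))"
  proof (cases "a = 0")
    case False
    show ?thesis
    proof (rule rational_onI[where p = "[:of_A a:]" and q = "[:of_A b, of_A (a * n):]"])
      fix z assume "z \<in> S"
      then have "of_A (a * n) * z + of_A b \<noteq> 0"
        using assms False by (intro Omega_linear_neq_0) auto
      then show "poly [:of_A b, of_A (a * n):] z \<noteq> 0 \<and> of_A a / (of_A a * (of_A n * z) + of_A b)
          = poly [:of_A a:] z / poly [:of_A b, of_A (a * n):] z"
        by (simp add: of_A_mult algebra_simps)
    qed
  qed (simp add: rational_on_0)
qed

text \<open>
  The box sums are rational functions with poles in \<open>K_\<infinity>\<close> and converge uniformly on affinoids.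
\<close>

lemma rigid_holomorphic_eis_slash_diag:
  assumes "n \<noteq> 0"
  shows "rigid_holomorphic (eis_slash (mat2 n 0 0 1))"
proof (rule rigid_holomorphicI)
  fix k
  let ?S = "Omega_affinoid k"
  let ?q = "real CARD('a)"
  define \<delta> where "\<delta> = nv (of_A n) * (1 / ?q ^ k)"
  have n: "nv (of_A n) > 0" using assms by simp
  have \<delta>: "\<delta> > 0" using q_gt_1 n by (simp add: \<delta>_def)
  have S: "far (1 / ?q ^ k) z" "nv z \<le> ?q ^ k" if "z \<in> ?S" for z
    using that by (auto simp: Omega_affinoid_def far_def dist_eq[symmetric])
  have SO: "?S \<subseteq> Omega" using S(1) q_gt_1 by (auto intro!: far_imp_Omega[of "1 / ?q ^ k"])
  have "\<exists>N. \<forall>i\<ge>N. \<forall>z\<in>?S. nv (of_A n * box_sum i i (of_A n * z) - eis_slash (mat2 n 0 0 1) z) \<le> e"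
    if "e > 0" for e
  proof -
    have "e / nv (of_A n) > 0" using that n by simp
    from box_sum_uniform[OF \<delta> this, of "nv (of_A n) * ?q ^ k"]
    obtain N where N: "\<And>D D' z. D \<ge> N \<Longrightarrow> D' \<ge> N \<Longrightarrow> far \<delta> z \<Longrightarrow> nv z \<le> nv (of_A n) * ?q ^ k \<Longrightarrow>
      nv (box_sum D D' z - eis z) \<le> e / nv (of_A n)" by blast
    have "nv (of_A n * box_sum i i (of_A n * z) - eis_slash (mat2 n 0 0 1) z) \<le> e"
      if "i \<ge> N" "z \<in> ?S" for i z
    proof -
      have "far \<delta> (of_A n * z)" unfolding \<delta>_def by (rule far_mult[OF S(1)[OF that(2)] assms])
      moreover have "nv (of_A n * z) \<le> nv (of_A n) * ?q ^ k"
        using S(2)[OF that(2)] unfolding abs_mult by (intro mult_left_mono) auto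
      ultimately have "nv (box_sum i i (of_A n * z) - eis (of_A n * z)) \<le> e / nv (of_A n)"
        using N[OF that(1,1)] by blast
      moreover have zO: "z \<in> Omega" using SO that(2) by auto
      ultimately show ?thesis
        unfolding eis_slash_diag[OF zO] right_diff_distrib[symmetric] abs_mult
        using n by (simp add: pos_le_divide_eq mult.commute)
    qed
    then show ?thesis by blast
  qed
  then show "\<exists>f' :: nat \<Rightarrow> 'c \<Rightarrow> 'c. (\<forall>i. rational_on ?S (f' i)) \<and>
      (\<forall>e>0. \<exists>N. \<forall>i\<ge>N. \<forall>z\<in>?S. nv (f' i z - eis_slash (mat2 n 0 0 1) z) \<le> e)"
    using rational_on_cmult[OF rational_on_box_sum[OF SO assms]]
    by (intro exI[of _ "\<lambda>i z. of_A n * box_sum i i (of_A n * z)"]) blast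
qed

section \<open>Expansions at the cusps\<close>

text \<open>
  The coefficient of \<open>recip w ^ (i + 1)\<close> in the expansion of \<open>recip (s * w + \<eta>)\<close>.
\<close>

definition recip_coeff :: "'a poly \<Rightarrow> 'a fls \<Rightarrow> nat \<Rightarrow> 'c" where
  "recip_coeff s \<eta> i
     = (\<Sum>r\<in>polys_below (degree s). (- lat_exp ((of_Kinf \<eta> + of_A r) / of_A s)) ^ i) / of_A s"

text \<open>
  The coefficient is a power sum over a coset of an additive group with \<open>q ^ degree s\<close> elements.
  Its vanishing in low degrees says that \<open>recip (s * w + \<eta>)\<close> vanishes to high order at the cusp
  when \<open>s\<close> has large degree.
\<close>

lemma recip_coeff_eq_0:
  assumes "i < degree s"
  shows "recip_coeff s \<eta> i = 0"
proof -
  have "(\<Sum>r\<in>polys_below (degree s). (- lat_exp (of_Kinf \<eta> / of_A s) + - lat_exp (of_A r / of_A s)) ^ i) = 0"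
    by (rule power_sum_eq_0[OF _ assms]) (simp add: of_A_add add_divide_distrib lat_exp_add)
  then show ?thesis by (simp add: recip_coeff_def add_divide_distrib lat_exp_add)
qed

text \<open>
  The addition theorem \<open>recip (w + \<theta>) = v / (1 + v * lat_exp \<theta>)\<close> with \<open>v = recip w\<close> gives a
  geometric series, and the distribution relation reduces \<open>s * w\<close> to \<open>w\<close>.
\<close>

lemma recip_expansion:
  assumes "far \<delta> w" "\<delta> > 1" "s \<noteq> 0"
  shows "nv (recip (of_A s * w + of_Kinf \<eta>) - (\<Sum>i<I. recip_coeff s \<eta> i * recip w ^ Suc i))
           \<le> nv (recip w) ^ Suc I / nv (of_A s)"
proof -
  let ?v = "recip w"
  have "nv ?v \<le> 1 / \<delta>\<^sup>2" using nv_recip_le[OF assms(1)] assms(2) by simp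
  also have "\<dots> < 1" using assms(2) by (simp add: divide_less_eq one_less_power)
  finally have v: "nv ?v < 1" .
  have w: "lat_exp w \<noteq> 0" using lat_exp_far_neq_0[OF assms(1)] assms(2) by simp
  define \<beta> where "\<beta> r = lat_exp ((of_Kinf \<eta> + of_A r) / of_A s)" for r
  have "(of_Kinf \<eta> + of_A r) / of_A s = of_Kinf ((\<eta> + Kinf_of_A r) / Kinf_of_A s)" for r
    by (simp add: of_A_def of_Kinf_add of_Kinf_divide)
  then have \<beta>: "nv (\<beta> r) \<le> 1" for r
    unfolding \<beta>_def by (simp only: nv_lat_exp_of_Kinf_le)
  have one: "nv (1 + ?v * \<beta> r) = 1" for r
  proof -
    have "nv (?v * \<beta> r) < nv 1"
      using v \<beta>[of r] mult_left_le[of "nv (\<beta> r)" "nv ?v"] by (simp add: abs_mult)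
    from nv_add_eq[OF this] show ?thesis by simp
  qed
  have each: "nv (recip (w + (of_Kinf \<eta> + of_A r) / of_A s) - (\<Sum>i<I. (- \<beta> r) ^ i * ?v ^ Suc i))
      \<le> nv ?v ^ Suc I" for r
  proof -
    have nz: "1 + ?v * \<beta> r \<noteq> 0" using one[of r] by auto
    have rec: "recip (w + (of_Kinf \<eta> + of_A r) / of_A s) = ?v / (1 + ?v * \<beta> r)"
      using w nz by (simp add: recip_eq lat_exp_add \<beta>_def field_simps)
    have geo: "(1 + ?v * \<beta> r) * (\<Sum>i<I. (- \<beta> r) ^ i * ?v ^ Suc i) = ?v - (- \<beta> r) ^ I * ?v ^ Suc I"
      by (induction I) (simp_all add: distrib_left algebra_simps)
    then have "(\<Sum>i<I. (- \<beta> r) ^ i * ?v ^ Suc i) = (?v - (- \<beta> r) ^ I * ?v ^ Suc I) / (1 + ?v * \<beta> r)"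
      using nz by (simp add: eq_divide_eq mult.commute)
    then have "recip (w + (of_Kinf \<eta> + of_A r) / of_A s) - (\<Sum>i<I. (- \<beta> r) ^ i * ?v ^ Suc i)
        = (- \<beta> r) ^ I * ?v ^ Suc I / (1 + ?v * \<beta> r)"
      by (simp add: rec diff_divide_distrib)
    then have "nv (recip (w + (of_Kinf \<eta> + of_A r) / of_A s) - (\<Sum>i<I. (- \<beta> r) ^ i * ?v ^ Suc i))
        = nv (\<beta> r) ^ I * nv ?v ^ Suc I"
      by (simp add: nv_divide one abs_mult nv_power)
    also have "\<dots> \<le> 1 * nv ?v ^ Suc I"
      using \<beta>[of r] by (intro mult_right_mono power_le_one) auto
    finally show ?thesis by simp
  qed
  have s: "of_A s \<noteq> 0" using assms(3) by simp
  have "far (nv (of_A s) * \<delta>) (of_A s * w + of_Kinf \<eta>)"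
    by (intro far_add far_mult assms)
  then have "recip (of_A s * w + of_Kinf \<eta>)
      = (\<Sum>r\<in>polys_below (degree s). recip ((of_A s * w + of_Kinf \<eta> + of_A r) / of_A s)) / of_A s"
    using assms s by (intro recip_distribution) auto
  moreover have "(of_A s * w + of_Kinf \<eta> + of_A r) / of_A s = w + (of_Kinf \<eta> + of_A r) / of_A s" for r
    using s by (simp add: field_simps)
  moreover have "(\<Sum>i<I. recip_coeff s \<eta> i * ?v ^ Suc i)
      = (\<Sum>r\<in>polys_below (degree s). \<Sum>i<I. (- \<beta> r) ^ i * ?v ^ Suc i) / of_A s"
    unfolding recip_coeff_def \<beta>_def[symmetric] sum_divide_distrib sum_distrib_right
    by (subst sum.swap) simp
  ultimately have "recip (of_A s * w + of_Kinf \<eta>) - (\<Sum>i<I. recip_coeff s \<eta> i * ?v ^ Suc i)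
      = (\<Sum>r\<in>polys_below (degree s). recip (w + (of_Kinf \<eta> + of_A r) / of_A s)
          - (\<Sum>i<I. (- \<beta> r) ^ i * ?v ^ Suc i)) / of_A s"
    by (simp add: sum_subtractf diff_divide_distrib)
  moreover have "nv (\<Sum>r\<in>polys_below (degree s). recip (w + (of_Kinf \<eta> + of_A r) / of_A s)
          - (\<Sum>i<I. (- \<beta> r) ^ i * ?v ^ Suc i)) \<le> nv ?v ^ Suc I"
    by (rule nv_sum_le[OF each]) simp
  ultimately show ?thesis
    by (simp add: nv_divide divide_right_mono)
qed

text \<open>
  A coefficient of index \<open>i\<close> receives contributions only from terms with \<open>degree t \<le> i\<close>, so the
  double series can be summed in the other order.
\<close>

lemma eis_expansion:
  fixes s :: "'a poly" and \<eta> :: "'a fls"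
  assumes "s \<noteq> 0"
  shows "\<exists>c. \<forall>w \<delta>. far \<delta> w \<longrightarrow> \<delta> > 1 \<longrightarrow>
           (\<lambda>i. c i * recip w ^ Suc i) sums eis (of_A s * w + of_Kinf \<eta>)"
proof -
  define T where "T t i = of_A t * recip_coeff (t * s) (Kinf_of_A t * \<eta>) i" for t i
  define c where "c i = (\<Sum>t\<in>polys_below (Suc i). T t i)" for i
  have c: "c i = (\<Sum>t\<in>polys_below D. T t i)" if "i < D" for i D
    unfolding c_def
  proof (rule sum.mono_neutral_left)
    show "\<forall>t\<in>polys_below D - polys_below (Suc i). T t i = 0"
    proof
      fix t :: "'a poly" assume "t \<in> polys_below D - polys_below (Suc i)"
      then have "t \<noteq> 0" "i < degree t" by (auto simp: polys_below_iff_degree)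
      then have "i < degree (t * s)" using assms by (simp add: degree_mult_eq)
      then show "T t i = 0" by (simp add: T_def recip_coeff_eq_0)
    qed
  qed (use that polys_below_mono[of "Suc i" D] finite_polys_below in auto)
  have "(\<lambda>i. c i * recip w ^ Suc i) sums eis (of_A s * w + of_Kinf \<eta>)"
    if w: "far \<delta> w" "\<delta> > 1" for w \<delta>
  proof -
    let ?v = "recip w" and ?x = "of_A s * w + of_Kinf \<eta>"
    have "nv ?v \<le> 1 / \<delta>\<^sup>2" using nv_recip_le[OF w(1)] w(2) by simp
    also have "\<dots> < 1" using w(2) by (simp add: divide_less_eq one_less_power)
    finally have v: "nv ?v < 1" .
    have diff: "nv ((\<Sum>i<I. c i * ?v ^ Suc i) - (\<Sum>t\<in>polys_below I. of_A t * recip (of_A t * ?x)))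
        \<le> nv ?v ^ Suc I" for I
    proof -
      have "(\<Sum>i<I. c i * ?v ^ Suc i) = (\<Sum>i<I. \<Sum>t\<in>polys_below I. T t i * ?v ^ Suc i)"
        by (intro sum.cong refl) (simp add: c[of _ I] sum_distrib_right)
      also have "\<dots> = (\<Sum>t\<in>polys_below I. \<Sum>i<I. T t i * ?v ^ Suc i)" by (rule sum.swap)
      finally have "(\<Sum>i<I. c i * ?v ^ Suc i) - (\<Sum>t\<in>polys_below I. of_A t * recip (of_A t * ?x))
          = (\<Sum>t\<in>polys_below I. (\<Sum>i<I. T t i * ?v ^ Suc i) - of_A t * recip (of_A t * ?x))"
        by (simp add: sum_subtractf)
      also have "nv \<dots> \<le> nv ?v ^ Suc I"
      proof (rule nv_sum_le)
        fix t :: "'a poly"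
        show "nv ((\<Sum>i<I. T t i * ?v ^ Suc i) - of_A t * recip (of_A t * ?x)) \<le> nv ?v ^ Suc I"
        proof (cases "t = 0")
          case False
          let ?y = "of_A (t * s) * w + of_Kinf (Kinf_of_A t * \<eta>)"
          have ts: "t * s \<noteq> 0" using False assms by simp
          have x: "of_A t * ?x = ?y"
            by (simp add: of_A_def of_Kinf_mult Kinf_of_A_mult algebra_simps)
          have "(\<Sum>i<I. T t i * ?v ^ Suc i) - of_A t * recip (of_A t * ?x)
              = - (of_A t * (recip ?y
                  - (\<Sum>i<I. recip_coeff (t * s) (Kinf_of_A t * \<eta>) i * ?v ^ Suc i)))"
            unfolding x by (simp add: T_def sum_distrib_left right_diff_distrib mult.assoc)
          then have "nv ((\<Sum>i<I. T t i * ?v ^ Suc i) - of_A t * recip (of_A t * ?x))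
              = nv (of_A t) * nv (recip ?y
                  - (\<Sum>i<I. recip_coeff (t * s) (Kinf_of_A t * \<eta>) i * ?v ^ Suc i))"
            by (simp only: nv_minus abs_mult)
          also have "\<dots> \<le> nv (of_A t) * (nv ?v ^ Suc I / nv (of_A (t * s)))"
            by (intro mult_left_mono recip_expansion[OF w ts]) auto
          also have "\<dots> = nv ?v ^ Suc I / nv (of_A s)"
            using False assms by (simp add: of_A_mult abs_mult)
          also have "\<dots> \<le> nv ?v ^ Suc I / 1"
            using nv_of_A_ge_1[OF assms] by (intro divide_left_mono) auto
          finally show ?thesis by simp
        qed (simp add: T_def)
      qed simp
      finally show ?thesis .
    qed
    have "?x \<in> Omega"
      using w assms by (intro far_imp_Omega[of "nv (of_A s) * \<delta>"] far_add far_mult) auto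
    then have lim: "(\<lambda>I. \<Sum>t\<in>polys_below I. of_A t * recip (of_A t * ?x)) \<longlonglongrightarrow> eis ?x"
      by (rule eis_series)
    have "(\<lambda>I. nv ?v ^ Suc I) \<longlonglongrightarrow> 0"
      using v by (intro LIMSEQ_Suc LIMSEQ_power_zero) simp
    then have "(\<lambda>I. (\<Sum>i<I. c i * ?v ^ Suc i)
        - (\<Sum>t\<in>polys_below I. of_A t * recip (of_A t * ?x))) \<longlonglongrightarrow> 0"
      unfolding tendsto_nv_diff[of _ 0]
      by (rule tendsto_sandwich[OF _ _ tendsto_const, rotated 2]) (use diff in auto)
    from lim_add[OF this lim] show ?thesis by (simp add: sums_def)
  qed
  then show ?thesis by blast
qed

lemma far_infdist:
  assumes "infdist z (range of_Kinf) \<ge> \<delta>"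
  shows "far \<delta> z"
  unfolding far_def
proof
  fix \<xi>
  have "infdist z (range of_Kinf) \<le> dist z (of_Kinf \<xi>)" by (rule infdist_le) auto
  with assms show "\<delta> \<le> nv (z - of_Kinf \<xi>)" by (subst (asm) dist_eq) simp
qed

text \<open>
  For an upper triangular matrix with diagonal \<open>(a, d)\<close> and \<open>a * d\<close> dividing \<open>N\<close>, the argument
  \<open>(a z + b) / d\<close> equals \<open>s * (z / N) + b / d\<close> with \<open>s = a * N / d\<close> in \<open>A\<close>. The radius
  \<open>|N|\<close> ensures that \<open>z / N\<close> has distance greater than \<open>1\<close> from \<open>K_\<infinity>\<close>.
\<close>

lemma eis_slash_cusp_expansion:
  fixes M :: "'a poly^2^2"
  assumes "det M dvd N" "N \<noteq> 0"
  shows "\<exists>c R. \<forall>z\<in>Omega. infdist z (range of_Kinf) > R \<longrightarrow>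
           (\<lambda>i. c i * u (z / of_A N) ^ Suc i) sums eis_slash M z"
proof -
  obtain g and U :: "'a poly^2^2"
    where g: "g \<in> elementary_products" "M = g ** U" "U $ 2 $ 1 = 0"
    using upper_triangular_decomposition by blast
  define a b d where "a = U $ 1 $ 1" and "b = U $ 1 $ 2" and "d = U $ 2 $ 2"
  have detU: "det U = a * d" by (simp add: det_2 g(3) a_def d_def)
  have "det U dvd N" using assms(1) unfolding g(2) det_mul by (rule dvd_mult_right)
  then obtain k where k: "N = a * d * k" unfolding detU by (rule dvdE)
  with assms(2) have nz: "a \<noteq> 0" "d \<noteq> 0" "k \<noteq> 0" by auto
  define s where "s = a * (a * k)"
  define \<eta> where "\<eta> = Kinf_of_A b / Kinf_of_A d"
  have s: "s \<noteq> 0" using nz by (simp add: s_def)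
  obtain c where c: "\<And>w \<delta>. far \<delta> w \<Longrightarrow> \<delta> > 1 \<Longrightarrow>
      (\<lambda>i. c i * recip w ^ Suc i) sums eis (of_A s * w + of_Kinf \<eta>)"
    using eis_expansion[OF s, of \<eta>] by blast
  define c' where "c' i = of_A a / of_A d * c i * per ^ Suc i" for i
  have "(\<lambda>i. c' i * u (z / of_A N) ^ Suc i) sums eis_slash M z"
    if z: "z \<in> Omega" "infdist z (range of_Kinf) > nv (of_A N)" for z
  proof -
    define \<delta> where "\<delta> = infdist z (range of_Kinf) / nv (of_A N)"
    have "far \<delta> (z / of_A N)"
      unfolding \<delta>_def by (intro far_divide far_infdist order_refl assms(2))
    moreover have "\<delta> > 1" using z(2) assms(2) by (simp add: \<delta>_def)
    ultimately have sums: "(\<lambda>i. c i * recip (z / of_A N) ^ Suc i)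
        sums eis (of_A s * (z / of_A N) + of_Kinf \<eta>)" by (rule c)
    have "of_A s * (z / of_A N) + of_Kinf \<eta> = (of_A a * z + of_A b) / of_A d"
      using nz by (simp add: s_def k of_A_mult \<eta>_def of_Kinf_divide field_simps flip: of_A_def)
    moreover have "eis_slash M z = eis_slash U z"
      unfolding g(2) by (rule eis_slash_elementary_products[OF g(1) z(1)]) (use detU nz in simp)
    ultimately have "eis_slash M z = of_A a / of_A d * eis (of_A s * (z / of_A N) + of_Kinf \<eta>)"
      using eis_slash_upper[OF z(1) g(3)] by (simp add: a_def b_def d_def)
    moreover have "(\<lambda>n. of_A a / of_A d * (\<Sum>i<n. c i * recip (z / of_A N) ^ Suc i))
        \<longlonglongrightarrow> of_A a / of_A d * eis (of_A s * (z / of_A N) + of_Kinf \<eta>)"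
      using sums unfolding sums_def by (rule lim_mult_const)
    moreover have "of_A a / of_A d * (\<Sum>i<n. c i * recip (z / of_A N) ^ Suc i)
        = (\<Sum>i<n. c' i * u (z / of_A N) ^ Suc i)" for n
      unfolding sum_distrib_left
      by (intro sum.cong refl) (simp add: c'_def recip_def power_mult_distrib)
    ultimately show ?thesis by (simp add: sums_def)
  qed
  then show ?thesis by blast
qed

section \<open>Cusp forms\<close>

text \<open>
  Both terms carry the same correction \<open>c / (c z + d)\<close>, with \<open>(c, d)\<close> the bottom row of \<open>\<gamma>\<close>.
\<close>

lemma slash_A_eis_slash_diff:
  assumes "det M \<noteq> 0" "det M' \<noteq> 0" "det \<gamma> \<noteq> 0"
  shows "slash_A 2 1 (\<lambda>z. eis_slash M z - eis_slash M' z) \<gamma>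
       = (\<lambda>z. eis_slash (M ** \<gamma>) z - eis_slash (M' ** \<gamma>) z)"
proof
  fix z
  show "slash_A 2 1 (\<lambda>z. eis_slash M z - eis_slash M' z) \<gamma> z
      = eis_slash (M ** \<gamma>) z - eis_slash (M' ** \<gamma>) z"
    using assms by (cases "z \<in> Omega")
      (auto simp: slash_A_diff eis_slash_mult, auto simp: eis_slash_def slash_outside)
qed

text \<open>
  Conjugation by \<open>diag (n, 1)\<close> maps \<open>Gamma0 n\<close> into \<open>GL\<^sub>2(A)\<close>.
\<close>

lemma eis_slash_diag_Gamma0:
  assumes "\<gamma> \<in> Gamma0 N" "n dvd N" "n \<noteq> 0"
  shows "eis_slash (mat2 n 0 0 1 ** \<gamma>) = eis_slash (mat2 n 0 0 1)"
proof
  fix z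
  have \<gamma>: "is_unit (det \<gamma>)" "n dvd \<gamma> $ 2 $ 1" using assms by (auto simp: Gamma0_iff)
  then obtain c where c: "\<gamma> $ 2 $ 1 = n * c" by auto
  define \<gamma>' where "\<gamma>' = mat2 (\<gamma> $ 1 $ 1) (n * \<gamma> $ 1 $ 2) c (\<gamma> $ 2 $ 2)"
  have "mat2 n 0 0 1 ** \<gamma> = \<gamma>' ** mat2 n 0 0 1"
    by (simp add: \<gamma>'_def vec_eq_iff forall_2 matrix_mult_nth_2 c)
  moreover have "det \<gamma>' = det \<gamma>" by (simp add: \<gamma>'_def det_mat2 det_2 c mult_ac)
  ultimately show "eis_slash (mat2 n 0 0 1 ** \<gamma>) z = eis_slash (mat2 n 0 0 1) z"
    using \<gamma>(1) assms(3)
    by (cases "z \<in> Omega") (auto simp: eis_slash_GL2_A_mult det_mat2, auto simp: eis_slash_def)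
qed

lemma sums_diff_nv:
  assumes "f sums a" "g sums b"
  shows "(\<lambda>i. f i - g i) sums (a - b :: 'c)"
  using lim_diff[OF assms[unfolded sums_def]] by (simp add: sums_def sum_subtractf)

theorem eis_slash_diag_diff_in_cusp_forms:
  assumes "n dvd N" "n' dvd N" "N \<noteq> 0"
  shows "(\<lambda>z. eis_slash (mat2 n 0 0 1) z - eis_slash (mat2 n' 0 0 1) z) \<in> cusp_forms 2 1 N"
    (is "?f \<in> _")
proof -
  have nz: "n \<noteq> 0" "n' \<noteq> 0" using assms by auto
  have slash: "slash_A 2 1 ?f \<gamma>
      = (\<lambda>z. eis_slash (mat2 n 0 0 1 ** \<gamma>) z - eis_slash (mat2 n' 0 0 1 ** \<gamma>) z)"
    if "is_unit (det \<gamma>)" for \<gamma>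
    using that nz by (intro slash_A_eis_slash_diff) (auto simp: det_mat2)
  have "vanishes_at_cusps 2 1 N ?f"
    unfolding vanishes_at_cusps_def
  proof
    fix \<gamma> :: "'a poly^2^2" assume "\<gamma> \<in> GL2_A"
    then have \<gamma>: "is_unit (det \<gamma>)" by (simp add: GL2_A_iff)
    have "det (mat2 n 0 0 1 ** \<gamma>) dvd N" "det (mat2 n' 0 0 1 ** \<gamma>) dvd N"
      using assms \<gamma> by (simp_all add: det_mul det_mat2 mult_unit_dvd_iff)
    then obtain c R c' R' where
      "\<And>z. z \<in> Omega \<Longrightarrow> infdist z (range of_Kinf) > R \<Longrightarrow>
         (\<lambda>i. c i * u (z / of_A N) ^ Suc i) sums eis_slash (mat2 n 0 0 1 ** \<gamma>) z"
      "\<And>z. z \<in> Omega \<Longrightarrow> infdist z (range of_Kinf) > R' \<Longrightarrow>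
         (\<lambda>i. c' i * u (z / of_A N) ^ Suc i) sums eis_slash (mat2 n' 0 0 1 ** \<gamma>) z"
      using eis_slash_cusp_expansion[OF _ assms(3)] by meson
    then have "\<forall>z\<in>Omega. infdist z (range of_Kinf) > max R R' \<longrightarrow>
        (\<lambda>i. (c i - c' i) * u (z / of_A N) ^ Suc i) sums slash_A 2 1 ?f \<gamma> z"
      unfolding slash[OF \<gamma>] left_diff_distrib by (auto intro!: sums_diff_nv)
    then show "\<exists>c R. \<forall>z\<in>Omega. infdist z (range of_Kinf) > R \<longrightarrow>
        (\<lambda>i. c i * u (z / of_A N) ^ Suc i) sums slash_A 2 1 ?f \<gamma> z"
      by (intro exI[of _ "\<lambda>i. c i - c' i"] exI[of _ "max R R'"])
  qed
  moreover have "slash_A 2 1 ?f \<gamma> = ?f" if "\<gamma> \<in> Gamma0 N" for \<gamma>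
  proof -
    have "is_unit (det \<gamma>)" using that by (simp add: Gamma0_iff)
    from slash[OF this] show ?thesis
      using that assms nz by (simp add: eis_slash_diag_Gamma0)
  qed
  moreover have "rigid_holomorphic ?f"
    using nz by (intro rigid_holomorphic_diff rigid_holomorphic_eis_slash_diag)
  moreover have "?f z = 0" if "z \<notin> Omega" for z using that by (simp add: eis_slash_def)
  ultimately show ?thesis by (simp add: cusp_forms_def)
qed

lemma cusp_forms_diff:
  assumes "f \<in> cusp_forms k l n" "g \<in> cusp_forms k l n"
  shows "(\<lambda>z. f z - g z) \<in> cusp_forms k l n"
proof -
  have slash: "slash_A k l (\<lambda>z. f z - g z) \<gamma> = (\<lambda>z. slash_A k l f \<gamma> z - slash_A k l g \<gamma> z)" for \<gamma>
    by (rule ext) (rule slash_A_diff)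
  have "vanishes_at_cusps k l n (\<lambda>z. f z - g z)"
    unfolding vanishes_at_cusps_def
  proof
    fix \<gamma> :: "'a poly^2^2" assume "\<gamma> \<in> GL2_A"
    then obtain c R c' R' where
      "\<And>z. z \<in> Omega \<Longrightarrow> infdist z (range of_Kinf) > R \<Longrightarrow>
         (\<lambda>i. c i * u (z / of_A n) ^ Suc i) sums slash_A k l f \<gamma> z"
      "\<And>z. z \<in> Omega \<Longrightarrow> infdist z (range of_Kinf) > R' \<Longrightarrow>
         (\<lambda>i. c' i * u (z / of_A n) ^ Suc i) sums slash_A k l g \<gamma> z"
      using assms unfolding cusp_forms_def vanishes_at_cusps_def mem_Collect_eq by meson
    then have "\<forall>z\<in>Omega. infdist z (range of_Kinf) > max R R' \<longrightarrow>
        (\<lambda>i. (c i - c' i) * u (z / of_A n) ^ Suc i) sums slash_A k l (\<lambda>z. f z - g z) \<gamma> z"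
      unfolding slash left_diff_distrib by (auto intro!: sums_diff_nv)
    then show "\<exists>c R. \<forall>z\<in>Omega. infdist z (range of_Kinf) > R \<longrightarrow>
        (\<lambda>i. c i * u (z / of_A n) ^ Suc i) sums slash_A k l (\<lambda>z. f z - g z) \<gamma> z"
      by (intro exI[of _ "\<lambda>i. c i - c' i"] exI[of _ "max R R'"])
  qed
  with assms show ?thesis
    by (simp add: cusp_forms_def slash rigid_holomorphic_diff)
qed

end

section \<open>The Hecke relation at \<open>P\<close>\<close>

context carlitz_period
begin

text \<open>
  If \<open>P\<close> divides \<open>t\<close>, all summands agree and their number is a power of \<open>q\<close>. Otherwise \<open>t * b\<close> runs
  through the residues modulo \<open>P\<close> and the distribution relation applies.
\<close>

lemma sum_recip_residues:
  assumes "prime_elem P" "z \<in> Omega"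
  shows "(\<Sum>b\<in>polys_below (degree P). recip (of_A t * ((z + of_A b) / of_A P)))
       = (if P dvd t then 0 else of_A P * recip (of_A t * z))"
proof (cases "P dvd t")
  case True
  then obtain t' where t: "t = P * t'" by auto
  have P: "P \<noteq> 0" "degree P \<ge> 1"
    using assms(1) by (auto simp: prime_elem_def is_unit_iff_degree Suc_le_eq)
  have "of_A t * ((z + of_A b) / of_A P) = of_A t' * z + of_A (t' * b)" for b
    using P by (simp add: t of_A_mult field_simps)
  then show ?thesis
    using True card_polys_below_eq_0[OF P(2)] by (simp add: recip_add_of_A)
next
  case False
  have P: "P \<noteq> 0" using assms(1) by auto
  obtain \<delta> where \<delta>: "\<delta> > 0" "far \<delta> z" using Omega_imp_far[OF assms(2)] by auto
  have t0: "t \<noteq> 0" using False by auto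
  have "recip (of_A t * ((z + of_A b) / of_A P)) = recip ((of_A t * z + of_A (t * b mod P)) / of_A P)"
    for b
  proof -
    have "of_A (t * b) = of_A (t * b mod P) + of_A P * of_A (t * b div P)"
      by (simp add: mod_mult_div_eq flip: of_A_mult of_A_add)
    then have "of_A t * ((z + of_A b) / of_A P)
        = (of_A t * z + of_A (t * b mod P)) / of_A P + of_A (t * b div P)"
      using P by (simp add: of_A_mult field_simps)
    then show ?thesis by (simp add: recip_add_of_A)
  qed
  then have "(\<Sum>b\<in>polys_below (degree P). recip (of_A t * ((z + of_A b) / of_A P)))
      = (\<Sum>b\<in>polys_below (degree P). recip ((of_A t * z + of_A (t * b mod P)) / of_A P))" by simp
  also have "\<dots> = (\<Sum>r\<in>polys_below (degree P). recip ((of_A t * z + of_A r) / of_A P))"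
    by (rule sum.reindex_bij_betw[OF bij_betw_mult_residues[OF assms(1) False]])
  also have "\<dots> = of_A P * recip (of_A t * z)"
  proof -
    have "recip (of_A t * z)
        = (\<Sum>r\<in>polys_below (degree P). recip ((of_A t * z + of_A r) / of_A P)) / of_A P"
      by (rule recip_distribution[OF far_mult[OF \<delta>(2) t0] _ P]) (use \<delta> t0 in simp)
    then show ?thesis using P by simp
  qed
  finally show ?thesis using False by simp
qed

text \<open>
  The false Eisenstein series is an eigenform of the Hecke operator at \<open>P\<close>, with eigenvalue \<open>1\<close> for
  the normalization by the slash operator of weight two and type one: the first term contributes
  the multiples of \<open>P\<close> to the sum over \<open>t\<close>, the others contribute the rest.
\<close>

theorem eis_hecke:
  assumes "prime_elem P" "z \<in> Omega"
  shows "eis_slash (mat2 P 0 0 1) z + (\<Sum>b\<in>polys_below (degree P). eis_slash (mat2 1 b 0 P) z) = eis z"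
proof (rule LIMSEQ_unique)
  have P: "P \<noteq> 0" using assms(1) by auto
  let ?p = "degree P"
  define S where "S D w = (\<Sum>t\<in>polys_below D. of_A t * recip (of_A t * w))" for D w
  have lim: "(\<lambda>D. S D w) \<longlonglongrightarrow> eis w" if "w \<in> Omega" for w
    unfolding S_def by (rule eis_series[OF that])
  have in_Omega: "(z + of_A b) / of_A P \<in> Omega" for b
    using Omega_affine[OF assms(2), of 1 P b] P by simp
  have val: "eis_slash (mat2 1 b 0 P) z = 1 / of_A P * eis ((z + of_A b) / of_A P)" for b
    using assms(2) by (simp add: eis_slash_upper)
  show "(\<lambda>D. of_A P * S D (of_A P * z)
        + (\<Sum>b\<in>polys_below ?p. 1 / of_A P * S (D + ?p) ((z + of_A b) / of_A P)))
      \<longlonglongrightarrow> eis_slash (mat2 P 0 0 1) z + (\<Sum>b\<in>polys_below ?p. eis_slash (mat2 1 b 0 P) z)"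
    unfolding eis_slash_diag[OF assms(2)] val
    by (intro lim_add lim_sum lim_mult_const lim LIMSEQ_ignore_initial_segment in_Omega
        Omega_mult assms P)
  have "of_A P * S D (of_A P * z)
      + (\<Sum>b\<in>polys_below ?p. 1 / of_A P * S (D + ?p) ((z + of_A b) / of_A P)) = S (D + ?p) z" for D
  proof -
    let ?B = "polys_below (D + ?p) :: 'a poly set"
    have fin: "finite ?B" by (rule finite_polys_below)
    have "of_A P * S D (of_A P * z)
        = (\<Sum>t\<in>polys_below D. of_A (P * t) * recip (of_A (P * t) * z))"
      by (simp add: S_def sum_distrib_left of_A_mult mult_ac)
    also have "\<dots> = (\<Sum>t\<in>{t \<in> ?B. P dvd t}. of_A t * recip (of_A t * z))"
      by (rule sum.reindex_bij_witness[of _ "\<lambda>t. t div P" "\<lambda>t. P * t"])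
         (use P dvd_mult_in_polys_below[OF P] in auto)
    finally have 1: "of_A P * S D (of_A P * z)
        = (\<Sum>t\<in>{t \<in> ?B. P dvd t}. of_A t * recip (of_A t * z))" .
    have "(\<Sum>b\<in>polys_below ?p. 1 / of_A P * S (D + ?p) ((z + of_A b) / of_A P))
        = (\<Sum>t\<in>?B. 1 / of_A P * (of_A t
            * (\<Sum>b\<in>polys_below ?p. recip (of_A t * ((z + of_A b) / of_A P)))))"
      unfolding S_def sum_distrib_left by (rule sum.swap)
    also have "\<dots> = (\<Sum>t\<in>?B. if P dvd t then 0 else of_A t * recip (of_A t * z))"
      using P by (intro sum.cong refl, subst sum_recip_residues[OF assms]) simp
    also have "\<dots> = (\<Sum>t\<in>{t \<in> ?B. \<not> P dvd t}. of_A t * recip (of_A t * z))"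
      unfolding sum.inter_filter[OF fin] by (intro sum.cong refl) auto
    finally have 2: "(\<Sum>b\<in>polys_below ?p. 1 / of_A P * S (D + ?p) ((z + of_A b) / of_A P))
        = (\<Sum>t\<in>{t \<in> ?B. \<not> P dvd t}. of_A t * recip (of_A t * z))" .
    have "?B = {t \<in> ?B. P dvd t} \<union> {t \<in> ?B. \<not> P dvd t}" by auto
    then have "S (D + ?p) z = (\<Sum>t\<in>{t \<in> ?B. P dvd t} \<union> {t \<in> ?B. \<not> P dvd t}.
        of_A t * recip (of_A t * z))"
      unfolding S_def by simp
    also have "\<dots> = (\<Sum>t\<in>{t \<in> ?B. P dvd t}. of_A t * recip (of_A t * z))
        + (\<Sum>t\<in>{t \<in> ?B. \<not> P dvd t}. of_A t * recip (of_A t * z))"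
      by (rule sum.union_disjoint) (use fin in auto)
    finally show ?thesis by (simp only: 1 2)
  qed
  then show "(\<lambda>D. of_A P * S D (of_A P * z)
        + (\<Sum>b\<in>polys_below ?p. 1 / of_A P * S (D + ?p) ((z + of_A b) / of_A P))) \<longlonglongrightarrow> eis z"
    using LIMSEQ_ignore_initial_segment[OF lim[OF assms(2)], of ?p] by simp
qed

end

section \<open>Cosets and the projective line over the residue field\<close>

text \<open>
  The point of the projective line modulo \<open>P\<close> given by the bottom row \<open>(c, d)\<close>: \<open>Some b\<close> stands
  for \<open>(1 : b)\<close> and \<open>None\<close> for \<open>(0 : 1)\<close>.
\<close>

definition bottom_point :: "'a::field poly \<Rightarrow> 'a poly^2^2 \<Rightarrow> 'a poly option" where
  "bottom_point P \<gamma> = (if P dvd \<gamma> $ 2 $ 1 then None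
     else Some (SOME b. b \<in> polys_below (degree P) \<and> P dvd \<gamma> $ 2 $ 2 - \<gamma> $ 2 $ 1 * b))"

text \<open>
  The projective line over the residue field of \<open>P\<close>.
\<close>

definition points :: "'a::field poly \<Rightarrow> 'a poly option set" where
  "points P = insert None (Some ` polys_below (degree P))"

lemma bottom_point_None: "bottom_point P \<gamma> = None \<longleftrightarrow> P dvd \<gamma> $ 2 $ 1"
  by (simp add: bottom_point_def)

lemma bottom_point_Some_iff:
  fixes P :: "'a::{field,finite} poly"
  assumes "prime_elem P"
  shows "bottom_point P \<gamma> = Some b \<longleftrightarrow>
    \<not> P dvd \<gamma> $ 2 $ 1 \<and> b \<in> polys_below (degree P) \<and> P dvd \<gamma> $ 2 $ 2 - \<gamma> $ 2 $ 1 * b"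
proof (cases "P dvd \<gamma> $ 2 $ 1")
  case False
  let ?c = "\<gamma> $ 2 $ 1" and ?d = "\<gamma> $ 2 $ 2"
  let ?Q = "\<lambda>b. b \<in> polys_below (degree P) \<and> P dvd ?d - ?c * b"
  have P: "P \<noteq> 0" using assms by auto
  note bij = bij_betw_mult_residues[OF assms False]
  have Q_iff: "?Q b \<longleftrightarrow> b \<in> polys_below (degree P) \<and> ?c * b mod P = ?d mod P" for b
    by (metis mod_eq_dvd_iff)
  have "?d mod P \<in> (\<lambda>r. ?c * r mod P) ` polys_below (degree P)"
    using bij mod_in_polys_below[OF P] by (simp add: bij_betw_def)
  then obtain b0 where "?Q b0" unfolding Q_iff by auto
  moreover have "b = b'" if "?Q b" "?Q b'" for b b'
    using that bij unfolding Q_iff by (metis bij_betw_def inj_onD)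
  ultimately have "?Q b \<longleftrightarrow> b = (SOME b. ?Q b)" by (metis (mono_tags, lifting) someI)
  then show ?thesis using False by (auto simp: bottom_point_def)
qed (simp add: bottom_point_def)

lemma bottom_point_in_points:
  fixes P :: "'a::{field,finite} poly"
  assumes "prime_elem P"
  shows "bottom_point P \<gamma> \<in> points P"
  using bottom_point_Some_iff[OF assms] by (cases "bottom_point P \<gamma>") (auto simp: points_def)

lemma Gamma0_mult:
  assumes "\<gamma> \<in> Gamma0 n" "\<delta> \<in> Gamma0 n"
  shows "\<gamma> ** \<delta> \<in> Gamma0 n"
  using assms by (auto simp: Gamma0_iff det_mul matrix_mult_nth_2)

lemma Gamma0_mono: "m dvd n \<Longrightarrow> Gamma0 n \<subseteq> Gamma0 m"
  by (auto simp: Gamma0_iff intro: dvd_trans)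

lemma bottom_point_Gamma0_mult:
  fixes P :: "'a::{field,finite} poly"
  assumes "prime_elem P" "\<delta> \<in> Gamma0 P" "is_unit (det \<gamma>)"
  shows "bottom_point P (\<delta> ** \<gamma>) = bottom_point P \<gamma>"
proof -
  have \<delta>: "P dvd \<delta> $ 2 $ 1" "is_unit (det \<delta>)" using assms(2) by (auto simp: Gamma0_iff)
  have unit: "\<not> P dvd \<delta> $ 2 $ 2"
  proof
    assume "P dvd \<delta> $ 2 $ 2"
    with \<delta>(1) have "P dvd det \<delta>" by (simp add: det_2)
    with \<delta>(2) assms(1) show False by (meson dvd_trans prime_elem_def)
  qed
  have c: "P dvd (\<delta> ** \<gamma>) $ 2 $ 1 \<longleftrightarrow> P dvd \<gamma> $ 2 $ 1"
    using \<delta>(1) unit assms(1)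
    by (simp add: matrix_mult_nth_2 dvd_add_right_iff prime_elem_dvd_mult_iff)
  show ?thesis
  proof (cases "bottom_point P \<gamma>")
    case None
    then show ?thesis using c by (metis bottom_point_None)
  next
    case (Some b)
    then have b: "\<not> P dvd \<gamma> $ 2 $ 1" "b \<in> polys_below (degree P)" "P dvd \<gamma> $ 2 $ 2 - \<gamma> $ 2 $ 1 * b"
      by (simp_all add: bottom_point_Some_iff[OF assms(1)])
    have "(\<delta> ** \<gamma>) $ 2 $ 2 - (\<delta> ** \<gamma>) $ 2 $ 1 * b
        = \<delta> $ 2 $ 1 * (\<gamma> $ 1 $ 2 - \<gamma> $ 1 $ 1 * b) + \<delta> $ 2 $ 2 * (\<gamma> $ 2 $ 2 - \<gamma> $ 2 $ 1 * b)"
      by (simp add: matrix_mult_nth_2 algebra_simps)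
    also have "P dvd \<dots>" using \<delta>(1) b(3) by simp
    finally show ?thesis
      unfolding Some using b c by (simp add: bottom_point_Some_iff[OF assms(1)])
  qed
qed

text \<open>If the bottom rows agree as points modulo \<open>P\<close>, the quotient is lower triangular modulo \<open>P\<close>.\<close>

lemma bottom_point_eq_imp_Gamma0_quotient:
  fixes P :: "'a::{field,finite} poly"
  assumes "prime_elem P" "\<not> P dvd m" "\<gamma> \<in> Gamma0 m" "\<gamma>' \<in> Gamma0 m"
    and eq: "bottom_point P \<gamma> = bottom_point P \<gamma>'"
  shows "\<exists>\<delta>\<in>Gamma0 (P * m). \<gamma>' = \<delta> ** \<gamma>"
proof -
  obtain \<gamma>i where \<gamma>i: "\<gamma>i ** \<gamma> = mat 1" "\<gamma> ** \<gamma>i = mat 1"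
    using assms(3) by (auto simp: Gamma0_def GL2_A_def invertible_def)
  define \<delta> where "\<delta> = \<gamma>' ** \<gamma>i"
  have \<gamma>': "\<gamma>' = \<delta> ** \<gamma>" by (simp add: \<delta>_def \<gamma>i(1) flip: matrix_mul_assoc)
  have units: "is_unit (det \<gamma>)" "is_unit (det \<gamma>')" using assms(3,4) by (auto simp: Gamma0_iff)
  then have unit: "is_unit (det \<delta>)" unfolding \<gamma>' by (simp add: det_mul is_unit_mult_iff)
  have cross: "\<delta> $ 2 $ 1 * det \<gamma> = \<gamma>' $ 2 $ 1 * \<gamma> $ 2 $ 2 - \<gamma>' $ 2 $ 2 * \<gamma> $ 2 $ 1"
    unfolding \<gamma>' by (simp add: matrix_mult_nth_2 det_2 algebra_simps)
  have "P dvd \<gamma>' $ 2 $ 1 * \<gamma> $ 2 $ 2 - \<gamma>' $ 2 $ 2 * \<gamma> $ 2 $ 1"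
  proof (cases "bottom_point P \<gamma>")
    case None
    then show ?thesis using eq by (metis bottom_point_None dvd_diff dvd_mult dvd_mult2)
  next
    case (Some b)
    then have b: "P dvd \<gamma> $ 2 $ 2 - \<gamma> $ 2 $ 1 * b" "P dvd \<gamma>' $ 2 $ 2 - \<gamma>' $ 2 $ 1 * b"
      using eq by (metis bottom_point_Some_iff[OF assms(1)])+
    have "\<gamma>' $ 2 $ 1 * \<gamma> $ 2 $ 2 - \<gamma>' $ 2 $ 2 * \<gamma> $ 2 $ 1
        = \<gamma>' $ 2 $ 1 * (\<gamma> $ 2 $ 2 - \<gamma> $ 2 $ 1 * b) - \<gamma> $ 2 $ 1 * (\<gamma>' $ 2 $ 2 - \<gamma>' $ 2 $ 1 * b)"
      by (simp add: algebra_simps)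
    also have "P dvd \<dots>" using b by simp
    finally show ?thesis .
  qed
  then have P: "P dvd \<delta> $ 2 $ 1"
    using units(1) by (metis cross dvd_mult_unit_iff)
  have "m dvd \<gamma>' $ 2 $ 1 * \<gamma> $ 2 $ 2 - \<gamma>' $ 2 $ 2 * \<gamma> $ 2 $ 1"
    using assms(3,4) by (auto simp: Gamma0_iff)
  then have "m dvd \<delta> $ 2 $ 1"
    using units(1) by (metis cross dvd_mult_unit_iff)
  then obtain x where x: "\<delta> $ 2 $ 1 = m * x" by auto
  with P assms(1,2) have "P dvd x" by (simp add: prime_elem_dvd_mult_iff)
  then have "P * m dvd \<delta> $ 2 $ 1" by (auto simp: x mult_ac)
  with unit \<gamma>' show ?thesis by (auto simp: Gamma0_iff)
qed

lemma bottom_point_surj: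
  fixes P :: "'a::{field,finite} poly"
  assumes "prime_elem P" "\<not> P dvd m" "\<rho> \<in> points P"
  shows "\<exists>\<gamma>\<in>Gamma0 m. bottom_point P \<gamma> = \<rho>"
proof (cases \<rho>)
  case None
  then show ?thesis
    by (intro bexI[of _ "mat2 1 0 0 1"]) (auto simp: bottom_point_None Gamma0_iff det_mat2)
next
  case (Some b)
  then have b: "b \<in> polys_below (degree P)" using assms(3) by (auto simp: points_def)
  have P: "P \<noteq> 0" using assms by auto
  have "1 mod P \<in> (\<lambda>r. m * r mod P) ` polys_below (degree P)"
    using bij_betw_mult_residues[OF assms(1,2)] mod_in_polys_below[OF P] by (simp add: bij_betw_def)
  then obtain x where "m * x mod P = 1 mod P" by auto
  then have "P dvd m * x - 1" by (simp add: mod_eq_dvd_iff)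
  then obtain y where y: "m * x - 1 = P * y" by auto
  \<comment> \<open>With this \<open>e\<close> the bottom row \<open>(m, 1 + m * e)\<close> has \<open>1 + m * e\<close> congruent to \<open>m * b\<close> modulo \<open>P\<close>.\<close>
  define e where "e = x * m * b - x"
  have "1 + m * e - m * b = (m * x - 1) * (m * b - 1)"
    by (simp add: e_def algebra_simps)
  then have "P dvd 1 + m * e - m * b" by (simp add: y)
  then have "bottom_point P (mat2 1 e m (1 + m * e)) = Some b"
    using assms b by (simp add: bottom_point_Some_iff)
  moreover have "mat2 1 e m (1 + m * e) \<in> Gamma0 m" by (simp add: Gamma0_iff det_mat2 mult.commute)
  ultimately show ?thesis using Some by blast
qed

text \<open>
  The chosen representatives of the cosets run through the projective line exactly once, whatever
  the choice.
\<close>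

lemma bij_betw_cosets_points:
  fixes P :: "'a::{field,finite} poly"
  assumes "prime_elem P" "\<not> P dvd m"
  shows "\<And>R. R \<in> Gamma0_cosets (P * m) m \<Longrightarrow> (SOME \<gamma>. \<gamma> \<in> R) \<in> Gamma0 m"
    and "bij_betw (\<lambda>R. bottom_point P (SOME \<gamma>. \<gamma> \<in> R)) (Gamma0_cosets (P * m) m) (points P)"
proof -
  let ?C = "Gamma0_cosets (P * m) m"
  have sub: "Gamma0 (P * m) \<subseteq> Gamma0 m" "Gamma0 (P * m) \<subseteq> Gamma0 P"
    by (rule Gamma0_mono; simp)+
  have coset: "(SOME \<gamma>. \<gamma> \<in> R) \<in> Gamma0 m
      \<and> bottom_point P (SOME \<gamma>. \<gamma> \<in> R) = bottom_point P \<gamma>0"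
    if "\<gamma>0 \<in> Gamma0 m" "R = {\<delta> ** \<gamma>0 | \<delta>. \<delta> \<in> Gamma0 (P * m)}" for R \<gamma>0
  proof -
    have "mat2 1 0 0 1 \<in> Gamma0 (P * m)" by (simp add: Gamma0_iff det_mat2)
    then have "R \<noteq> {}" using that by blast
    then have "(SOME \<gamma>. \<gamma> \<in> R) \<in> R" by (simp add: some_in_eq)
    then have "\<exists>\<delta>\<in>Gamma0 (P * m). (SOME \<gamma>. \<gamma> \<in> R) = \<delta> ** \<gamma>0"
      using that(2) by blast
    then obtain \<delta> where \<delta>: "\<delta> \<in> Gamma0 (P * m)" "(SOME \<gamma>. \<gamma> \<in> R) = \<delta> ** \<gamma>0"
      by blast
    have "is_unit (det \<gamma>0)" using that by (simp add: Gamma0_iff)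
    then show ?thesis
      unfolding \<delta>(2) using \<delta>(1) that sub
      by (auto intro: Gamma0_mult bottom_point_Gamma0_mult[OF assms(1)])
  qed
  show "(SOME \<gamma>. \<gamma> \<in> R) \<in> Gamma0 m" if "R \<in> ?C" for R
    using that coset unfolding Gamma0_cosets_def by blast
  show "bij_betw (\<lambda>R. bottom_point P (SOME \<gamma>. \<gamma> \<in> R)) ?C (points P)"
    unfolding bij_betw_def
  proof
    show "inj_on (\<lambda>R. bottom_point P (SOME \<gamma>. \<gamma> \<in> R)) ?C"
    proof (rule inj_onI)
      fix R R' assume "R \<in> ?C" "R' \<in> ?C"
        and eq: "bottom_point P (SOME \<gamma>. \<gamma> \<in> R) = bottom_point P (SOME \<gamma>. \<gamma> \<in> R')"
      then obtain \<gamma> \<gamma>' where R: "\<gamma> \<in> Gamma0 m" "R = {\<delta> ** \<gamma> | \<delta>. \<delta> \<in> Gamma0 (P * m)}"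
        and R': "\<gamma>' \<in> Gamma0 m" "R' = {\<delta> ** \<gamma>' | \<delta>. \<delta> \<in> Gamma0 (P * m)}"
        unfolding Gamma0_cosets_def by blast
      have pt: "bottom_point P \<gamma> = bottom_point P \<gamma>'"
        using eq coset[OF R] coset[OF R'] by simp
      obtain \<delta> where \<delta>: "\<delta> \<in> Gamma0 (P * m)" "\<gamma>' = \<delta> ** \<gamma>"
        using bottom_point_eq_imp_Gamma0_quotient[OF assms R(1) R'(1) pt] by blast
      obtain \<delta>' where \<delta>': "\<delta>' \<in> Gamma0 (P * m)" "\<gamma> = \<delta>' ** \<gamma>'"
        using bottom_point_eq_imp_Gamma0_quotient[OF assms R'(1) R(1) pt[symmetric]] by blast
      have "R' \<subseteq> R"
        unfolding R R' \<delta>(2) matrix_mul_assoc using Gamma0_mult \<delta>(1) by blast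
      moreover have "R \<subseteq> R'"
      proof
        fix x assume "x \<in> R"
        then obtain \<epsilon> where "\<epsilon> \<in> Gamma0 (P * m)" "x = \<epsilon> ** \<gamma>" unfolding R by blast
        then have "\<epsilon> ** \<delta>' \<in> Gamma0 (P * m)" "x = (\<epsilon> ** \<delta>') ** \<gamma>'"
          using Gamma0_mult \<delta>' by (auto simp flip: matrix_mul_assoc)
        then show "x \<in> R'" unfolding R' by blast
      qed
      ultimately show "R = R'" by blast
    qed
    show "(\<lambda>R. bottom_point P (SOME \<gamma>. \<gamma> \<in> R)) ` ?C = points P"
    proof
      show "(\<lambda>R. bottom_point P (SOME \<gamma>. \<gamma> \<in> R)) ` ?C \<subseteq> points P"
        using bottom_point_in_points[OF assms(1)] by blast
      show "points P \<subseteq> (\<lambda>R. bottom_point P (SOME \<gamma>. \<gamma> \<in> R)) ` ?C"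
      proof
        fix \<rho> assume "\<rho> \<in> points P"
        then obtain \<gamma> where \<gamma>: "\<gamma> \<in> Gamma0 m" "bottom_point P \<gamma> = \<rho>"
          using bottom_point_surj[OF assms] by blast
        let ?R = "{\<delta> ** \<gamma> | \<delta>. \<delta> \<in> Gamma0 (P * m)}"
        have "?R \<in> ?C" using \<gamma>(1) unfolding Gamma0_cosets_def by blast
        moreover have "\<rho> = bottom_point P (SOME \<gamma>. \<gamma> \<in> ?R)"
          using coset[OF \<gamma>(1) refl] \<gamma>(2) by simp
        ultimately show "\<rho> \<in> (\<lambda>R. bottom_point P (SOME \<gamma>. \<gamma> \<in> R)) ` ?C"
          by (rule rev_image_eqI)
      qed
    qed
  qed
qed

context carlitz_period
begin

text \<open>
  The summands of the Hecke operator at \<open>P\<close>, indexed by the points of the projective line.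
\<close>

definition hecke_term :: "'a poly \<Rightarrow> 'a poly option \<Rightarrow> 'c \<Rightarrow> 'c" where
  "hecke_term P \<rho> = eis_slash (case \<rho> of None \<Rightarrow> mat2 P 0 0 1 | Some b \<Rightarrow> mat2 1 b 0 P)"

lemma sum_hecke_term:
  assumes "prime_elem P" "z \<in> Omega"
  shows "(\<Sum>\<rho>\<in>points P. hecke_term P \<rho> z) = eis z"
proof -
  have "(\<Sum>\<rho>\<in>points P. hecke_term P \<rho> z)
      = hecke_term P None z + (\<Sum>\<rho>\<in>Some ` polys_below (degree P). hecke_term P \<rho> z)"
    unfolding points_def by (subst sum.insert) (auto simp: finite_polys_below)
  also have "(\<Sum>\<rho>\<in>Some ` polys_below (degree P). hecke_term P \<rho> z)
      = (\<Sum>b\<in>polys_below (degree P). hecke_term P (Some b) z)"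
    by (subst sum.reindex) auto
  finally show ?thesis using eis_hecke[OF assms] by (simp add: hecke_term_def)
qed

text \<open>
  Up to a factor in \<open>GL\<^sub>2(A)\<close> on the left, \<open>diag (P, 1) \<gamma>\<close> is the standard matrix of determinant
  \<open>P\<close> belonging to the bottom row of \<open>\<gamma>\<close> modulo \<open>P\<close>.
\<close>

lemma eis_slash_diag_eq_hecke_term:
  assumes "prime_elem P" "is_unit (det \<gamma>)" "z \<in> Omega"
  shows "eis_slash (mat2 P 0 0 1 ** \<gamma>) z = hecke_term P (bottom_point P \<gamma>) z"
proof (cases "bottom_point P \<gamma>")
  case None
  then have "\<gamma> \<in> Gamma0 P" using assms(2) by (simp add: Gamma0_iff bottom_point_None)
  moreover have "P \<noteq> 0" using assms(1) by auto
  ultimately show ?thesis using None by (simp add: hecke_term_def eis_slash_diag_Gamma0)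
next
  case (Some b)
  then have "P dvd \<gamma> $ 2 $ 2 - \<gamma> $ 2 $ 1 * b" by (simp add: bottom_point_Some_iff[OF assms(1)])
  then obtain e where e: "\<gamma> $ 2 $ 2 - \<gamma> $ 2 $ 1 * b = P * e" by auto
  then have d: "\<gamma> $ 2 $ 2 = \<gamma> $ 2 $ 1 * b + P * e" by (simp add: diff_eq_eq add.commute)
  let ?\<delta> = "mat2 (P * \<gamma> $ 1 $ 1) (\<gamma> $ 1 $ 2 - \<gamma> $ 1 $ 1 * b) (\<gamma> $ 2 $ 1) e"
  have "mat2 P 0 0 1 ** \<gamma> = ?\<delta> ** mat2 1 b 0 P"
    by (simp add: vec_eq_iff forall_2 matrix_mult_nth_2 d algebra_simps)
  moreover have "det ?\<delta> = det \<gamma>" by (simp add: det_mat2 det_2 d algebra_simps)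
  ultimately show ?thesis
    using assms Some by (simp add: hecke_term_def eis_slash_GL2_A_mult det_mat2 prime_elem_def)
qed

end

section \<open>A form that is both old and new\<close>

context carlitz_period
begin

text \<open>
  The trace of the twist by \<open>diag (P, 1)\<close> is a Hecke operator.
\<close>

lemma sum_cosets_hecke:
  assumes P: "prime_elem P" "\<not> P dvd m" and z: "z \<in> Omega"
  shows "(\<Sum>R\<in>Gamma0_cosets (P * m) m. eis_slash (mat2 P 0 0 1 ** (SOME \<gamma>. \<gamma> \<in> R)) z) = eis z"
proof -
  note cosets = bij_betw_cosets_points[OF P]
  have "(\<Sum>R\<in>Gamma0_cosets (P * m) m. eis_slash (mat2 P 0 0 1 ** (SOME \<gamma>. \<gamma> \<in> R)) z)
      = (\<Sum>R\<in>Gamma0_cosets (P * m) m. hecke_term P (bottom_point P (SOME \<gamma>. \<gamma> \<in> R)) z)"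
    using cosets(1) P(1) z
    by (intro sum.cong refl eis_slash_diag_eq_hecke_term) (auto simp: Gamma0_iff)
  also have "\<dots> = (\<Sum>\<rho>\<in>points P. hecke_term P \<rho> z)"
    by (rule sum.reindex_bij_betw[OF cosets(2)])
  finally show ?thesis by (simp add: sum_hecke_term P z)
qed

text \<open>
  Conjugation with \<open>diag (m, 1)\<close> turns the bottom row \<open>(c, d)\<close> into \<open>(c / m, d)\<close>. Modulo \<open>P\<close>
  this multiplies the parameter \<open>b\<close> of the point \<open>(1 : b)\<close> by \<open>m\<close>, which permutes the points.
\<close>

lemma sum_cosets_hecke_diag:
  assumes P: "prime_elem P" "\<not> P dvd m" and z: "z \<in> Omega"
  shows "(\<Sum>R\<in>Gamma0_cosets (P * m) m. eis_slash (mat2 (P * m) 0 0 1 ** (SOME \<gamma>. \<gamma> \<in> R)) z)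
       = eis_slash (mat2 m 0 0 1) z"
proof -
  note cosets = bij_betw_cosets_points[OF P]
  have m0: "m \<noteq> 0" using P(2) by auto
  have P0: "P \<noteq> 0" using P(1) by auto
  have mz: "of_A m * z \<in> Omega" by (rule Omega_mult[OF z m0])
  define \<pi> where "\<pi> = map_option (\<lambda>b. m * b mod P)"
  have each: "eis_slash (mat2 (P * m) 0 0 1 ** \<gamma>) z
      = of_A m * hecke_term P (\<pi> (bottom_point P \<gamma>)) (of_A m * z)" if \<gamma>: "\<gamma> \<in> Gamma0 m" for \<gamma>
  proof -
    obtain c where c: "\<gamma> $ 2 $ 1 = m * c" using \<gamma> by (auto simp: Gamma0_iff)
    define \<gamma>' where "\<gamma>' = mat2 (\<gamma> $ 1 $ 1) (m * \<gamma> $ 1 $ 2) c (\<gamma> $ 2 $ 2)"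
    have "det \<gamma>' = det \<gamma>" by (simp add: \<gamma>'_def det_mat2 det_2 c mult_ac)
    with \<gamma> have unit: "is_unit (det \<gamma>')" by (simp add: Gamma0_iff)
    have "mat2 (P * m) 0 0 1 ** \<gamma> = (mat2 P 0 0 1 ** \<gamma>') ** mat2 m 0 0 1"
      by (simp add: \<gamma>'_def vec_eq_iff forall_2 matrix_mult_nth_2 c mult_ac)
    moreover have "eis_slash ((mat2 P 0 0 1 ** \<gamma>') ** mat2 m 0 0 1) z
        = of_A m * eis_slash (mat2 P 0 0 1 ** \<gamma>') (of_A m * z)"
      using unit P0 m0 z
      by (subst eis_slash_mult) (auto simp: det_mul det_mat2 slash_A_eq num_def den_def)
    moreover have "eis_slash (mat2 P 0 0 1 ** \<gamma>') (of_A m * z)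
        = hecke_term P (bottom_point P \<gamma>') (of_A m * z)"
      by (rule eis_slash_diag_eq_hecke_term[OF P(1) unit mz])
    moreover have "bottom_point P \<gamma>' = \<pi> (bottom_point P \<gamma>)"
    proof (cases "bottom_point P \<gamma>")
      case None
      then have "P dvd c" using P by (simp add: bottom_point_None c prime_elem_dvd_mult_iff)
      then have "bottom_point P \<gamma>' = None" by (simp add: bottom_point_None \<gamma>'_def)
      then show ?thesis using None by (simp add: \<pi>_def)
    next
      case (Some b)
      then have b: "\<not> P dvd m * c" "P dvd \<gamma> $ 2 $ 2 - m * c * b"
        by (simp_all add: bottom_point_Some_iff[OF P(1)] c)
      have eq: "\<gamma> $ 2 $ 2 - c * (m * b mod P) = \<gamma> $ 2 $ 2 - m * c * b + c * (m * b - m * b mod P)"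
        by (simp add: algebra_simps)
      have "P dvd \<gamma> $ 2 $ 2 - c * (m * b mod P)"
        unfolding eq using b(2) by (intro dvd_add dvd_mult) (simp_all add: minus_mod_eq_mult_div)
      moreover have "\<not> P dvd c" using b(1) by (metis dvd_mult)
      ultimately have "bottom_point P \<gamma>' = Some (m * b mod P)"
        using mod_in_polys_below[OF P0]
        by (simp add: bottom_point_Some_iff[OF P(1)] \<gamma>'_def)
      then show ?thesis using Some by (simp add: \<pi>_def)
    qed
    ultimately show ?thesis by simp
  qed
  have "(\<Sum>R\<in>Gamma0_cosets (P * m) m. eis_slash (mat2 (P * m) 0 0 1 ** (SOME \<gamma>. \<gamma> \<in> R)) z)
      = (\<Sum>R\<in>Gamma0_cosets (P * m) m.
          of_A m * hecke_term P (\<pi> (bottom_point P (SOME \<gamma>. \<gamma> \<in> R))) (of_A m * z))"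
    using cosets(1) by (intro sum.cong refl each)
  also have "\<dots> = (\<Sum>\<rho>\<in>points P. of_A m * hecke_term P (\<pi> \<rho>) (of_A m * z))"
    by (rule sum.reindex_bij_betw[OF cosets(2)])
  also have "\<dots> = of_A m * (\<Sum>\<rho>\<in>points P. hecke_term P (\<pi> \<rho>) (of_A m * z))"
    by (simp add: sum_distrib_left)
  also have "(\<Sum>\<rho>\<in>points P. hecke_term P (\<pi> \<rho>) (of_A m * z))
      = (\<Sum>\<rho>\<in>points P. hecke_term P \<rho> (of_A m * z))"
  proof (rule sum.reindex_bij_betw)
    note bij = bij_betw_mult_residues[OF P]
    show "bij_betw \<pi> (points P) (points P)"
      unfolding bij_betw_def
    proof
      show "inj_on \<pi> (points P)"
        using bij_betw_imp_inj_on[OF bij] by (auto simp: inj_on_def points_def \<pi>_def)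
      show "\<pi> ` points P = points P"
      proof -
        have "Some ` (\<lambda>r. m * r mod P) ` polys_below (degree P) = Some ` polys_below (degree P)"
          by (simp only: bij_betw_imp_surj_on[OF bij])
        then show ?thesis by (simp add: points_def \<pi>_def image_image)
      qed
    qed
  qed
  also have "\<dots> = eis (of_A m * z)" by (rule sum_hecke_term[OF P(1) mz])
  finally show ?thesis using z by (simp add: eis_slash_diag)
qed

lemma card_cosets:
  fixes P m :: "'a poly"
  assumes P: "prime_elem P" "\<not> P dvd m"
  shows "(of_nat (card (Gamma0_cosets (P * m) m)) :: 'c) = 1"
proof -
  have "degree P \<ge> 1" using P(1) by (auto simp: prime_elem_def is_unit_iff_degree Suc_le_eq)
  moreover have "card (Gamma0_cosets (P * m) m) = card (points P)"
    by (rule bij_betw_same_card[OF bij_betw_cosets_points(2)[OF P]])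
  moreover have "card (points P) = Suc (card (polys_below (degree P) :: 'a poly set))"
    unfolding points_def by (subst card_insert_disjoint) (auto simp: finite_polys_below card_image)
  ultimately show ?thesis using card_polys_below_eq_0[of "degree P"] by simp
qed

text \<open>
  With \<open>f = eis - eis | diag (m, 1)\<close>, a cusp form for \<open>Gamma0 m\<close>, this is
  \<open>f - f | diag (P, 1)\<close>.
\<close>

definition old_new_form :: "'a poly \<Rightarrow> 'a poly \<Rightarrow> 'c \<Rightarrow> 'c" where
  "old_new_form P m z =
     (eis_slash (mat2 1 0 0 1) z - eis_slash (mat2 m 0 0 1) z)
     - (eis_slash (mat2 P 0 0 1) z - eis_slash (mat2 (P * m) 0 0 1) z)"

lemma old_new_form_in_cusp_forms:
  assumes "P \<noteq> 0" "m \<noteq> 0"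
  shows "old_new_form P m \<in> cusp_forms 2 1 (P * m)"
  unfolding old_new_form_def
  by (intro cusp_forms_diff eis_slash_diag_diff_in_cusp_forms) (use assms in auto)

lemma old_new_form_in_old_forms:
  assumes "P \<noteq> 0" "m \<noteq> 0"
  shows "old_new_form P m \<in> old_forms 2 1 P m"
proof -
  let ?E = "\<lambda>n. eis_slash (mat2 n 0 0 1)"
  have "slash_A 2 1 (\<lambda>z. ?E m z - ?E 1 z) (mat2 P 0 0 1) = (\<lambda>z. ?E (P * m) z - ?E P z)"
    using assms by (subst slash_A_eis_slash_diff) (auto simp: det_mat2 mat2_mult mult_ac)
  then have "old_new_form P m
      = (\<lambda>z. (?E 1 z - ?E m z) + slash_A 2 1 (\<lambda>z. ?E m z - ?E 1 z) (mat2 P 0 0 1) z)"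
    by (auto simp: old_new_form_def)
  moreover have "(\<lambda>z. ?E 1 z - ?E m z) \<in> cusp_forms 2 1 m" "(\<lambda>z. ?E m z - ?E 1 z) \<in> cusp_forms 2 1 m"
    by (intro eis_slash_diag_diff_in_cusp_forms; use assms in simp)+
  ultimately show ?thesis
    unfolding old_forms_def mem_Collect_eq
    by (intro exI[of _ "\<lambda>z. ?E 1 z - ?E m z"] exI[of _ "\<lambda>z. ?E m z - ?E 1 z"] conjI)
qed

lemma slash_A_old_new_form:
  assumes "P \<noteq> 0" "m \<noteq> 0" "det \<gamma> \<noteq> 0"
  shows "slash_A 2 1 (old_new_form P m) \<gamma> z =
     (eis_slash \<gamma> z - eis_slash (mat2 m 0 0 1 ** \<gamma>) z)
     - (eis_slash (mat2 P 0 0 1 ** \<gamma>) z - eis_slash (mat2 (P * m) 0 0 1 ** \<gamma>) z)"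
proof -
  let ?E = "\<lambda>n. eis_slash (mat2 n 0 0 1)"
  have "old_new_form P m = (\<lambda>z. (?E 1 z - ?E m z) - (?E P z - ?E (P * m) z))"
    by (simp add: old_new_form_def fun_eq_iff)
  then have "slash_A 2 1 (old_new_form P m) \<gamma> z
      = slash_A 2 1 (\<lambda>z. ?E 1 z - ?E m z) \<gamma> z - slash_A 2 1 (\<lambda>z. ?E P z - ?E (P * m) z) \<gamma> z"
    by (simp only: slash_A_diff[of 2 1 "\<lambda>z. ?E 1 z - ?E m z"])
  moreover have "slash_A 2 1 (\<lambda>z. ?E 1 z - ?E m z) \<gamma>
      = (\<lambda>z. eis_slash (mat2 1 0 0 1 ** \<gamma>) z - eis_slash (mat2 m 0 0 1 ** \<gamma>) z)"
    "slash_A 2 1 (\<lambda>z. ?E P z - ?E (P * m) z) \<gamma>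
      = (\<lambda>z. eis_slash (mat2 P 0 0 1 ** \<gamma>) z - eis_slash (mat2 (P * m) 0 0 1 ** \<gamma>) z)"
    using assms by (intro slash_A_eis_slash_diff; simp add: det_mat2)+
  moreover have "mat2 1 0 0 1 ** \<gamma> = \<gamma>" by (simp add: mat_1_eq_mat2[symmetric])
  ultimately show ?thesis by simp
qed

text \<open>
  The trace of \<open>f\<close> is the index times \<open>f\<close>, the index being \<open>q ^ degree P + 1\<close> and hence \<open>1\<close> in
  characteristic \<open>p\<close>. The trace of \<open>f | diag (P, 1)\<close> is the Hecke eigenform \<open>f\<close> again.
\<close>

lemma level_trace_old_new_form:
  assumes P: "prime_elem P" "\<not> P dvd m"
  shows "level_trace 2 1 (P * m) m (old_new_form P m) = (\<lambda>_. 0)"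
proof
  fix z
  have nz: "P \<noteq> 0" "m \<noteq> 0" using P by auto
  show "level_trace 2 1 (P * m) m (old_new_form P m) z = 0"
  proof (cases "z \<in> Omega")
    case True
    let ?C = "Gamma0_cosets (P * m) m"
    let ?\<gamma> = "\<lambda>R :: ('a poly^2^2) set. SOME \<gamma>. \<gamma> \<in> R"
    have "slash_A 2 1 (old_new_form P m) (?\<gamma> R) z
        = (eis z - eis_slash (mat2 m 0 0 1) z)
          - (eis_slash (mat2 P 0 0 1 ** ?\<gamma> R) z - eis_slash (mat2 (P * m) 0 0 1 ** ?\<gamma> R) z)"
      if "R \<in> ?C" for R
    proof -
      have \<gamma>: "?\<gamma> R \<in> Gamma0 m" by (rule bij_betw_cosets_points(1)[OF P that])
      then have unit: "is_unit (det (?\<gamma> R))" by (simp add: Gamma0_iff)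
      then have "det (?\<gamma> R) \<noteq> 0" by auto
      from slash_A_old_new_form[OF nz this, of z] show ?thesis
        using eis_slash_GL2_A[OF unit True] eis_slash_diag_Gamma0[OF \<gamma> dvd_refl nz(2)] by simp
    qed
    then have "level_trace 2 1 (P * m) m (old_new_form P m) z
        = (\<Sum>R\<in>?C. (eis z - eis_slash (mat2 m 0 0 1) z)
          - (eis_slash (mat2 P 0 0 1 ** ?\<gamma> R) z - eis_slash (mat2 (P * m) 0 0 1 ** ?\<gamma> R) z))"
      unfolding level_trace_def by (intro sum.cong refl)
    also have "\<dots> = of_nat (card ?C) * (eis z - eis_slash (mat2 m 0 0 1) z)
        - (eis z - eis_slash (mat2 m 0 0 1) z)"
      by (simp only: sum_subtractf sum_constant sum_cosets_hecke[OF P True]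
          sum_cosets_hecke_diag[OF P True] right_diff_distrib)
    finally show ?thesis by (simp add: card_cosets[OF P])
  qed (simp add: level_trace_def slash_outside)
qed

text \<open>
  Up to scalar matrices, which act trivially in weight two and type one, and up to elements of
  \<open>Gamma0 m\<close>, the Atkin-Lehner matrix is \<open>diag (P, 1)\<close> and its product with \<open>diag (P, 1)\<close> is the
  identity. So the operator interchanges \<open>f\<close> and \<open>f | diag (P, 1)\<close>.
\<close>

lemma atkin_lehner_old_new_form:
  assumes P: "prime_elem P" "\<not> P dvd m"
  shows "atkin_lehner 2 1 P m (old_new_form P m) = (\<lambda>z. - old_new_form P m z)"
proof
  fix z
  have nz: "P \<noteq> 0" "m \<noteq> 0" using P by auto
  have "1 mod P \<in> (\<lambda>r. m * r mod P) ` polys_below (degree P)"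
    using bij_betw_imp_surj_on[OF bij_betw_mult_residues[OF P]] mod_in_polys_below[OF nz(1)] by simp
  then obtain x where "m * x mod P = 1 mod P" by auto
  then have "P dvd m * x - 1" by (simp add: mod_eq_dvd_iff)
  then obtain y where y: "m * x - 1 = P * y" by auto
  have "P\<^sup>2 * (- y) - P * m * (- x) = P * (m * x - 1) - P * (P * y) + P"
    by (simp add: power2_eq_square algebra_simps)
  also have "\<dots> = P" by (simp add: y)
  finally have "\<exists>bd. case bd of (b, d) \<Rightarrow> P\<^sup>2 * d - P * m * b = P" by blast
  from someI_ex[OF this] obtain b d where bd: "(SOME (b, d). P\<^sup>2 * d - P * m * b = P) = (b, d)"
    "P\<^sup>2 * d - P * m * b = P"
    by (cases "SOME (b, d). P\<^sup>2 * d - P * m * b = P") auto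
  have "P * (P * d - m * b) = P * 1" using bd(2) by (simp add: power2_eq_square algebra_simps)
  then have det1: "P * d - m * b = 1" using nz(1) by (simp only: mult_cancel_left) simp
  define W where "W = mat2 P b (P * m) (P * d)"
  have W: "atkin_lehner_mat P m = W" by (simp add: atkin_lehner_mat_def bd(1) W_def)
  have detW: "det W = P" using bd(2) by (simp add: W_def det_mat2 power2_eq_square mult_ac)
  show "atkin_lehner 2 1 P m (old_new_form P m) z = - old_new_form P m z"
  proof (cases "z \<in> Omega")
    case True
    have det2: "is_unit (P * d - m * b)" "is_unit (P * d - b * m)"
      using det1 by (simp_all add: mult.commute)
    have key: "eis_slash (mat2 a' b' c' d' ** D) z = eis_slash D z"
      if "a' * d' - b' * c' = 1" "det D \<noteq> 0" for a' b' c' d' D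
      by (rule eis_slash_GL2_A_mult[OF _ True]) (use that in \<open>simp_all add: det_mat2\<close>)
    have 1: "eis_slash W z = eis_slash (mat2 P 0 0 1) z"
    proof -
      have "W = mat2 1 b m (P * d) ** mat2 P 0 0 1" by (simp add: W_def mat2_mult mult_ac)
      then show ?thesis using nz det1 by (simp only:) (rule key, simp_all add: det_mat2 mult_ac)
    qed
    have 2: "eis_slash (mat2 m 0 0 1 ** W) z = eis_slash (mat2 (P * m) 0 0 1) z"
    proof -
      have "mat2 m 0 0 1 ** W = mat2 1 (m * b) 1 (P * d) ** mat2 (P * m) 0 0 1"
        by (simp add: W_def mat2_mult mult_ac)
      then show ?thesis using nz det1 by (simp only:) (rule key, simp_all add: det_mat2 mult_ac)
    qed
    have scalar: "eis_slash (mat2 (P * n) 0 0 P) z = eis_slash (mat2 n 0 0 1) z" for n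
      using nz True by (simp add: eis_slash_upper of_A_mult mult.assoc)
    have 3: "eis_slash (mat2 P 0 0 1 ** W) z = eis_slash (mat2 1 0 0 1) z"
    proof -
      have "mat2 P 0 0 1 ** W = mat2 P b m d ** mat2 (P * 1) 0 0 P"
        by (simp add: W_def mat2_mult mult_ac)
      then have "eis_slash (mat2 P 0 0 1 ** W) z = eis_slash (mat2 (P * 1) 0 0 P) z"
        using nz det1 by (simp only:) (rule key, simp_all add: det_mat2 mult_ac)
      then show ?thesis by (simp only: scalar)
    qed
    have 4: "eis_slash (mat2 (P * m) 0 0 1 ** W) z = eis_slash (mat2 m 0 0 1) z"
    proof -
      have "mat2 (P * m) 0 0 1 ** W = mat2 P (m * b) 1 d ** mat2 (P * m) 0 0 P"
        by (simp add: W_def mat2_mult mult_ac)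
      then have "eis_slash (mat2 (P * m) 0 0 1 ** W) z = eis_slash (mat2 (P * m) 0 0 P) z"
        using nz det1 by (simp only:) (rule key, simp_all add: det_mat2 mult_ac)
      then show ?thesis by (simp only: scalar)
    qed
    have "det W \<noteq> 0" using detW nz by simp
    from slash_A_old_new_form[OF nz this, of z] show ?thesis
      unfolding atkin_lehner_def W by (simp add: 1 2 3 4 old_new_form_def)
  qed (simp add: atkin_lehner_def slash_outside old_new_form_def eis_slash_def)
qed

lemma old_new_form_in_new_forms:
  assumes P: "prime_elem P" "\<not> P dvd m"
  shows "old_new_form P m \<in> new_forms 2 1 P m"
proof -
  have nz: "P \<noteq> 0" "m \<noteq> 0" using P by auto
  have "slash_A 2 1 (\<lambda>z. - old_new_form P m z) \<gamma> z = - slash_A 2 1 (old_new_form P m) \<gamma> z" for \<gamma> z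
    by (simp add: slash_def)
  then have "level_trace 2 1 (P * m) m (\<lambda>z. - old_new_form P m z) z
      = - level_trace 2 1 (P * m) m (old_new_form P m) z" for z
    by (simp add: level_trace_def sum_negf)
  then have "twisted_trace 2 1 P m (old_new_form P m) = (\<lambda>_. 0)"
    by (simp add: twisted_trace_def atkin_lehner_old_new_form[OF P] level_trace_old_new_form[OF P] fun_eq_iff)
  then show ?thesis
    using nz by (simp add: new_forms_def old_new_form_in_cusp_forms level_trace_old_new_form[OF P])
qed

section \<open>Nonvanishing\<close>

lemma exists_sqrt_T: "\<exists>z. nv z * nv z = real CARD('a)"
proof -
  obtain x :: "'a fls alg_closure" where x: "x ^ 2 = to_ac fls_X_inv"
    using nth_root_exists[of 2 "to_ac fls_X_inv :: 'a fls alg_closure"] by auto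
  have "j x * j x = of_Kinf fls_X_inv"
    using x by (simp add: of_Kinf_def power2_eq_square flip: j_mult)
  then have "nv (j x) * nv (j x) = abs_Kinf (fls_X_inv :: 'a fls)"
    by (simp add: nv_of_Kinf flip: abs_mult)
  then show ?thesis by (intro exI[of _ "j x"]) (simp add: abs_Kinf_def)
qed

text \<open>
  A square root of \<open>T\<close> has absolute value \<open>sqrt q\<close>, which lies outside the value group of \<open>K_\<infinity>\<close>.
  Hence no cancellation occurs in \<open>z - \<xi>\<close>, and the absolute values of all factors of the
  exponential product are explicit.
\<close>

lemma nv_of_Kinf_neq:
  assumes "nv z * nv z = real CARD('a)"
  shows "nv (of_Kinf \<xi>) \<noteq> nv z"
proof
  assume eq: "nv (of_Kinf \<xi>) = nv z"
  then have "\<xi> \<noteq> 0" using assms q_gt_1 by auto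
  let ?k = "- fls_subdegree \<xi>"
  have "real CARD('a) powi (?k + ?k) = real CARD('a) powi ?k * real CARD('a) powi ?k"
    using q_gt_1 by (intro power_int_add) auto
  also have "\<dots> = real CARD('a) powi 1"
    using assms eq \<open>\<xi> \<noteq> 0\<close> by (simp add: nv_of_Kinf abs_Kinf_def)
  finally have "real CARD('a) powi (?k + ?k) = real CARD('a) powi 1" .
  moreover have "?k + ?k < 1 \<or> 1 < ?k + ?k" by presburger
  ultimately show False
    using power_int_strict_increasing[OF _ q_gt_1] by (metis less_irrefl)
qed

lemma nv_diff_of_Kinf:
  assumes "nv z * nv z = real CARD('a)"
  shows "nv (z - of_Kinf \<xi>) = max (nv z) (nv (of_Kinf \<xi>))"
proof (cases "nv (of_Kinf \<xi>) < nv z")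
  case True
  then show ?thesis using nv_add_eq[of "- of_Kinf \<xi>" z] by simp
next
  case False
  then have "nv z < nv (of_Kinf \<xi>)" using nv_of_Kinf_neq[OF assms, of \<xi>] by simp
  then show ?thesis using nv_add_eq[of "- z" "of_Kinf \<xi>"] by (simp add: nv_diff_commute)
qed

lemma nv_one_minus_mult_divide:
  assumes "nv z * nv z = real CARD('a)" "b \<noteq> 0" "c \<noteq> 0"
  shows "nv (1 - of_A b * z / of_A c) = max 1 (nv (of_A b) * nv z / nv (of_A c))"
proof -
  have nz: "nv (of_A b) > 0" "nv (of_A c) > 0" using assms by simp_all
  have "1 - of_A b * z / of_A c = - (of_A b / of_A c) * (z - of_Kinf (Kinf_of_A c / Kinf_of_A b))"
    using assms(2,3) by (simp add: of_Kinf_divide field_simps flip: of_A_def)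
  then have "nv (1 - of_A b * z / of_A c)
      = nv (of_A b) / nv (of_A c) * nv (z - of_Kinf (Kinf_of_A c / Kinf_of_A b))"
    by (simp only: abs_mult nv_minus nv_divide)
  also have "nv (z - of_Kinf (Kinf_of_A c / Kinf_of_A b)) = max (nv z) (nv (of_A c) / nv (of_A b))"
    unfolding nv_diff_of_Kinf[OF assms(1)] by (simp only: of_Kinf_divide nv_divide of_A_def)
  also have "nv (of_A b) / nv (of_A c) * max (nv z) (nv (of_A c) / nv (of_A b))
      = max 1 (nv (of_A b) * nv z / nv (of_A c))"
    using nz by (auto simp: max_def field_simps)
  finally show ?thesis .
qed

text \<open>The factor at \<open>c = 1\<close> contributes the second power of \<open>|b|\<close>.\<close>

lemma nv_fin_exp_mult_ge:
  assumes z: "nv z * nv z = real CARD('a)" and b: "b \<noteq> 0" and D: "D \<ge> 1"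
  shows "nv (fin_exp D (of_A b * z)) \<ge> (nv (of_A b))\<^sup>2 * nv (fin_exp D z)"
proof -
  let ?B = "polys_below D - {0} :: 'a poly set"
  let ?f = "\<lambda>b c. nv (1 - of_A b * z / of_A c)"
  have one: "1 \<in> ?B" "finite ?B" using one_in_polys_below[OF D] finite_polys_below by auto
  have b1: "nv (of_A b) \<ge> 1" by (rule nv_of_A_ge_1[OF b])
  have z1: "nv z > 1"
    using z q_gt_1 mult_left_le[of "nv z" "nv z"] by (rule_tac ccontr) auto
  have f1: "?f b 1 = nv (of_A b) * ?f 1 1"
  proof -
    have "1 * 1 \<le> nv (of_A b) * nv z" using b1 z1 by (intro mult_mono) auto
    then show ?thesis
      using nv_one_minus_mult_divide[OF z b, of 1] nv_one_minus_mult_divide[OF z, of 1 1] z1 by simp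
  qed
  have fc: "?f b c \<ge> ?f 1 c" if "c \<in> ?B" for c
  proof -
    have c0: "c \<noteq> 0" using that by simp
    have "nv (of_A 1) * nv z / nv (of_A c) \<le> nv (of_A b) * nv z / nv (of_A c)"
      using b1 by (intro divide_right_mono mult_right_mono) auto
    then show ?thesis
      unfolding nv_one_minus_mult_divide[OF z b c0] nv_one_minus_mult_divide[OF z one_neq_zero c0]
      by (intro max.mono order_refl)
  qed
  have "nv (of_A b) * (\<Prod>c\<in>?B. ?f 1 c) = ?f b 1 * (\<Prod>c\<in>?B - {1}. ?f 1 c)"
    by (subst prod.remove[OF one(2,1)]) (simp add: f1 del: of_A_1)
  also have "\<dots> \<le> ?f b 1 * (\<Prod>c\<in>?B - {1}. ?f b c)"
    using fc by (intro mult_left_mono prod_mono) auto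
  also have "\<dots> = (\<Prod>c\<in>?B. ?f b c)" by (rule prod.remove[OF one(2,1), symmetric])
  finally have "(nv (of_A b) * nv z) * (nv (of_A b) * (\<Prod>c\<in>?B. ?f 1 c))
      \<le> (nv (of_A b) * nv z) * (\<Prod>c\<in>?B. ?f b c)"
    by (intro mult_left_mono) auto
  then show ?thesis
    by (simp add: fin_exp_def abs_mult nv_prod power2_eq_square mult_ac)
qed

lemma far_sqrt_T:
  assumes "nv z * nv z = real CARD('a)"
  shows "far (nv z) z" "nv z > 0" "z \<in> Omega"
proof -
  show "far (nv z) z" unfolding far_def nv_diff_of_Kinf[OF assms] by simp
  moreover show "nv z > 0" using assms q_gt_1 by (metis mult_zero_left not_one_less_zero
      zero_less_dist_iff dist_self)
  ultimately show "z \<in> Omega" by (rule far_imp_Omega)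
qed

lemma nv_recip_sum_mult_le:
  assumes z: "nv z * nv z = real CARD('a)" and b: "b \<noteq> 0" and D: "D \<ge> 1"
  shows "nv (of_A b * recip_sum D (of_A b * z)) \<le> nv (recip_sum D z) / nv (of_A b)"
proof -
  note far = far_sqrt_T[OF z]
  let ?b = "nv (of_A b)" and ?e = "nv (fin_exp D z)"
  have b0: "?b > 0" using b by simp
  have e0: "?e > 0" using nv_fin_exp_far[OF far(1,2) D] far(2) by (metis less_le_trans zero_less_power)
  have "recip_sum D (of_A b * z) = 1 / fin_exp D (of_A b * z)"
    by (rule recip_sum_far[OF far_mult[OF far(1) b]]) (use b0 far(2) in simp)
  then have "nv (of_A b * recip_sum D (of_A b * z)) = ?b / nv (fin_exp D (of_A b * z))"
    by (simp add: abs_mult nv_divide)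
  also have "\<dots> \<le> ?b / (?b\<^sup>2 * ?e)"
  proof (rule divide_left_mono[OF nv_fin_exp_mult_ge[OF z b D]])
    have pos: "?b\<^sup>2 * ?e > 0" using b0 e0 by simp
    then show "0 < nv (fin_exp D (of_A b * z)) * (?b\<^sup>2 * ?e)"
      using less_le_trans[OF pos nv_fin_exp_mult_ge[OF z b D]] by (simp only: mult_pos_pos[OF _ pos])
  qed simp
  also have "\<dots> = nv (recip_sum D z) / ?b"
    using b0 by (simp add: recip_sum_far[OF far(1,2)] nv_divide power2_eq_square)
  finally show ?thesis .
qed

lemma nv_box_sum_nonconstant_le:
  assumes z: "nv z * nv z = real CARD('a)" and D: "D \<ge> 1" and n: "degree n \<ge> 1"
  shows "nv (of_A n * box_sum D D (of_A n * z)) \<le> nv (recip_sum D z) / real CARD('a)"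
proof -
  have n0: "n \<noteq> 0" using n by auto
  have "of_A n * box_sum D D (of_A n * z)
      = (\<Sum>a\<in>polys_below D. of_A (a * n) * recip_sum D (of_A (a * n) * z))"
    by (simp add: box_sum_eq sum_distrib_left of_A_mult mult_ac)
  also have "nv \<dots> \<le> nv (recip_sum D z) / real CARD('a)"
  proof (rule nv_sum_le)
    fix a :: "'a poly"
    show "nv (of_A (a * n) * recip_sum D (of_A (a * n) * z)) \<le> nv (recip_sum D z) / real CARD('a)"
    proof (cases "a = 0")
      case False
      then have an: "a * n \<noteq> 0" using n0 by simp
      have "degree (a * n) \<ge> 1" using False n0 n by (simp add: degree_mult_eq)
      then have "real CARD('a) ^ 1 \<le> nv (of_A (a * n))"
        using q_gt_1 an by (simp add: nv_of_A self_le_power)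
      then have "nv (recip_sum D z) / nv (of_A (a * n)) \<le> nv (recip_sum D z) / real CARD('a)"
        using q_gt_1 by (intro divide_left_mono mult_pos_pos) auto
      with nv_recip_sum_mult_le[OF z an D] show ?thesis by linarith
    qed (use q_gt_1 in simp)
  qed (use q_gt_1 in simp)
  finally show ?thesis .
qed

text \<open>The \<open>q - 1\<close> constant values of \<open>a\<close> contribute the same term each.\<close>

lemma nv_box_sum_add_le:
  assumes z: "nv z * nv z = real CARD('a)" and D: "D \<ge> 1"
  shows "nv (box_sum D D z + recip_sum D z) \<le> nv (recip_sum D z) / real CARD('a)"
proof -
  let ?K = "polys_below 1 :: 'a poly set"
  have const: "of_A a * recip_sum D (of_A a * z) = recip_sum D z" if "a \<in> ?K - {0}" for a
  proof -
    have "degree a = 0" "a \<noteq> 0" using that by (auto simp: polys_below_iff_degree)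
    then obtain c where c: "a = [:c:]" "c \<noteq> 0" by (metis degree_eq_zeroE pCons_0_0)
    have "recip_sum D (of_A a * z) = (\<Sum>b\<in>polys_below D. 1 / (of_A a * z + of_A (smult c b)))"
      unfolding recip_sum_def
      by (rule sum.reindex_bij_witness[of _ "smult c" "smult (1 / c)"])
         (use c(2) in \<open>auto simp: smult_in_polys_below\<close>)
    also have "\<dots> = (\<Sum>b\<in>polys_below D. 1 / (of_A a * (z + of_A b)))"
      by (simp add: c distrib_left flip: of_A_mult)
    finally show ?thesis using c
      by (simp add: recip_sum_def sum_distrib_left)
  qed
  have "box_sum D D z = (\<Sum>a\<in>?K. of_A a * recip_sum D (of_A a * z))
      + (\<Sum>a\<in>polys_below D - ?K. of_A a * recip_sum D (of_A a * z))"
    unfolding box_sum_eq using sum.subset_diff[OF polys_below_mono[OF D] finite_polys_below]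
    by (simp add: add.commute)
  also have "(\<Sum>a\<in>?K. of_A a * recip_sum D (of_A a * z)) = (\<Sum>a\<in>?K - {0}. recip_sum D z)"
    using const by (subst sum.remove[of _ 0]) (simp_all add: finite_polys_below)
  also have "\<dots> = (\<Sum>a\<in>?K. recip_sum D z) - recip_sum D z"
    using sum.remove[of ?K 0 "\<lambda>_. recip_sum D z"] by (simp add: finite_polys_below)
  also have "(\<Sum>a\<in>?K. recip_sum D z) = 0"
    using card_polys_below_eq_0[of 1] by simp
  finally have "box_sum D D z + recip_sum D z
      = (\<Sum>a\<in>polys_below D - ?K. of_A a * recip_sum D (of_A a * z))" by simp
  also have "nv \<dots> \<le> nv (recip_sum D z) / real CARD('a)"
  proof (rule nv_sum_le)
    fix a assume "a \<in> polys_below D - ?K"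
    then have a: "a \<noteq> 0" "degree a \<ge> 1" by (auto simp: polys_below_iff_degree)
    then have "real CARD('a) ^ 1 \<le> nv (of_A a)"
      using q_gt_1 by (simp add: nv_of_A self_le_power)
    then have "nv (recip_sum D z) / nv (of_A a) \<le> nv (recip_sum D z) / real CARD('a)"
      using q_gt_1 by (intro divide_left_mono mult_pos_pos) auto
    with nv_recip_sum_mult_le[OF z a(1) D]
    show "nv (of_A a * recip_sum D (of_A a * z)) \<le> nv (recip_sum D z) / real CARD('a)" by linarith
  qed (use q_gt_1 in simp)
  finally show ?thesis .
qed

text \<open>
  At a square root of \<open>T\<close> the contribution \<open>- recip z\<close> of the constant \<open>a\<close> to \<open>eis z\<close> dominates all
  other terms of the four series in absolute value.
\<close>

theorem old_new_form_neq_0: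
  assumes "degree P \<ge> 1" "degree m \<ge> 1"
  shows "old_new_form P m \<noteq> (\<lambda>_. 0)"
proof
  assume zero: "old_new_form P m = (\<lambda>_. 0)"
  have nz: "P \<noteq> 0" "m \<noteq> 0" using assms by auto
  obtain z where z: "nv z * nv z = real CARD('a)" using exists_sqrt_T by blast
  note far = far_sqrt_T[OF z]
  define B where "B n D = of_A n * box_sum D D (of_A n * z)" for n D
  define H where "H D = (B 1 D - B m D) - (B P D - B (P * m) D)" for D
  have B: "(\<lambda>D. B n D) \<longlonglongrightarrow> eis_slash (mat2 n 0 0 1) z" if "n \<noteq> 0" for n
    unfolding B_def eis_slash_diag[OF far(3)]
    by (intro lim_mult_const box_sum_tendsto_eis Omega_mult far that)
  have "H \<longlonglongrightarrow> old_new_form P m z"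
    unfolding H_def old_new_form_def by (intro lim_diff B) (use nz in auto)
  from lim_nv[OF this] have H0: "(\<lambda>D. nv (H D)) \<longlonglongrightarrow> 0" by (simp add: zero)
  have "nv (H D) = nv (recip_sum D z)" if D: "D \<ge> 1" for D
  proof -
    let ?v = "nv (recip_sum D z)"
    have "nv (fin_exp D z) > 0"
      using nv_fin_exp_far[OF far(1,2) D] far(2) by (metis less_le_trans zero_less_power)
    then have v: "?v > 0" by (simp add: recip_sum_far[OF far(1,2)])
    have le: "nv (B n D) \<le> ?v / real CARD('a)" if "degree n \<ge> 1" for n
      unfolding B_def by (rule nv_box_sum_nonconstant_le[OF z D that])
    have "nv (B 1 D + recip_sum D z) \<le> ?v / real CARD('a)"
      using nv_box_sum_add_le[OF z D] by (simp add: B_def)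
    moreover have "degree (P * m) \<ge> 1" using assms nz by (simp add: degree_mult_eq)
    ultimately have "nv ((B 1 D + recip_sum D z - B m D) - (B P D - B (P * m) D)) \<le> ?v / real CARD('a)"
      by (intro nv_diff_leI le assms)
    then have "nv (H D + recip_sum D z) \<le> ?v / real CARD('a)" by (simp add: H_def algebra_simps)
    also have "\<dots> < nv (- recip_sum D z)" using v q_gt_1 by (simp add: divide_less_eq)
    finally show ?thesis using nv_add_eq[of "H D + recip_sum D z" "- recip_sum D z"] by simp
  qed
  then have "\<forall>\<^sub>F D in sequentially. nv (H D) = nv (recip_sum D z)"
    unfolding eventually_sequentially by blast
  from Lim_transform_eventually[OF H0 this] have "nv (recip z) = 0"
    by (rule LIMSEQ_unique[OF lim_nv[OF recip_sum_tendsto[OF far(1,2)]]])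
  then show False using lat_exp_far_neq_0[OF far(1,2)] by (simp add: recip_eq)
qed

end

theorem proposition4p13:
  fixes j :: "'a::finite_field fls alg_closure \<Rightarrow> 'c::{field, complete_space}"
    and per :: 'c
    and m P :: "'a poly"
    and r e :: nat
  assumes q: "Factorial_Ring.prime r" "odd r" "CARD('a) = r ^ e"
    and setting: "carlitz_period j per"
    and m: "Polynomial.lead_coeff m = 1" "\<not> is_unit m"
    and P: "Polynomial.lead_coeff P = 1" "Factorial_Ring.irreducible P" "\<not> P dvd m"
  shows "carlitz_period.old_forms j per 2 1 P m \<inter> carlitz_period.new_forms j per 2 1 P m
         \<noteq> {\<lambda>_. 0}"
proof -
  interpret carlitz_period j per by (rule setting)
  have prime: "prime_elem P" using P(2) by (rule field_poly_irreducible_imp_prime)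
  have nz: "P \<noteq> 0" "m \<noteq> 0" using P m by auto
  have deg: "degree P \<ge> 1" "degree m \<ge> 1"
    using prime m nz by (auto simp: prime_elem_def is_unit_iff_degree Suc_le_eq)
  have "old_new_form P m \<in> old_forms 2 1 P m \<inter> new_forms 2 1 P m"
    using old_new_form_in_old_forms[OF nz] old_new_form_in_new_forms[OF prime P(3)] by blast
  with old_new_form_neq_0[OF deg] show ?thesis by auto
qed

end
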